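(* Let $\mathsf{B}_\infty$ be the random collection of black cubes produced by the branching diffusion and cube-subdivision process described in the context. Let $\rho$ and $K$ be the absorption probability and first-branching density defined there, and let $Q_{D,k}$ be the combinatorial polynomial defined there. For measurable $\phi:\mathcal{M}\setminus\Gamma\to[0,1]$ put $$F[\phi](X)=\rho(X)+(1-\rho(X))\int_{\mathcal{M}\setminus\Gamma}K(X,Y)\,Q_{D,k}(\phi(Y))\,dY .$$ Let $P(X)=\lim_{n\to\infty}F_n[\rho](X)$, where $F_n$ is the $n$-th iterate of $F$, and put $$p_*=\int_{\mathcal{M}\setminus\Gamma}\gamma(X_0)\,P(X_0)\,dX_0 .$$ Let $p_D^{(1)}$ be the percolation threshold of nearest-neighbour site percolation on $\mathbb{Z}^D$. If $p_*>p_D^{(1)}$, then $\mathsf{B}_\infty$ percolates.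
   Context: **Diffusion.** $\mathcal{M}$ is a $d$-dimensional manifold and $\Gamma\subset\mathcal{M}$ is a closed subset (absorbing boundary). $X_t$ is a diffusion on $\mathcal{M}$ whose generator $\hat A$ is, in local coordinates, either $\hat A f=\frac12\sigma^{ik}\sigma^{kj}\partial_i\partial_j f+\mathcal{F}^i\partial_i f$ (Itô) or $\hat A f=\frac12\sigma^{ik}\partial_i(\sigma^{kj}\partial_j f)+\mathcal{F}^i\partial_i f$ (Stratonovich). The functions $\mathcal{F}^i,\sigma^{ij}$ and $n$ are smooth on $\mathcal{M}\setminus\Gamma$, with $n$ and $\sigma^{ij}$ positive, and $\Gamma$ is accessible. A particle reaching $\Gamma$ stays there forever and never branches. A particle located at $X\in\mathcal{M}\setminus\Gamma$ branches at rate $n(X)$. At branching it is replaced by $r=k^D$ particles at the same point, which then evolve independently as the same branching diffusion. Here $D$ and $k\ge 3$ are integers. Standing (non-degeneracy) assumption: $\lambda_1>0$, where $\lambda_1$ is the principal eigenvalue (the one with a strictly positive eigenfunction) of $\hat A\psi+(r-1)n\psi=\lambda\psi$, $\psi|_\Gamma=0$. For a single particle started at $X$: - $\rho(X)$ is the probability that it is eventually absorbed at $\Gamma$ without having branched before. - $K(X,Y)$ is the density in $Y\in\mathcal{M}\setminus\Gamma$ of the location of its first branching (a sub-probability density). **Cubes.** Space $\mathbb{R}^D$ is divided into unit cubes (cubes of level $0$) forming the cubic lattice. Independently for each unit cube, a point $X_0\in\mathcal{M}$ is chosen with probability density $\gamma$, and a branching diffusion is started from one particle at $X_0$, independently of the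 other cubes. Each particle corresponds to a cube. If the particle is absorbed at $\Gamma$, its cube is coloured black and never divided. If the particle branches, its cube (of level $L$) is divided into $r=k^D$ equal cubes of level $L+1$ ($k$ times smaller in linear size), which correspond bijectively to the $r$ offspring. Cubes that are not black are white. $\mathsf{B}_t$ is the collection of all black cubes, of all levels and in all unit cubes, present at time $t$. $\mathsf{B}_\infty=\bigcup_t\mathsf{B}_t$. **Percolation.** Two cubes (possibly of different sizes) are connected if they share a common face, i.e. have disjoint interiors and a face of one is contained in a face of the other. $\mathsf{B}_\infty$ percolates if almost surely there is a connected non-self-intersecting path of cubes of $\mathsf{B}_\infty$ (consecutive cubes connected) from some point up to infinity. The threshold $p_D^{(1)}$ is the critical probability for independent site percolation on $\mathbb{Z}^D$ with nearest-neighbour adjacency: for $p>p_D^{(1)}$, where sites are black independently with probability $p$, an infinite connected black cluster exists almost surely. **The polynomial $Q_{D,k}$.** Divide a $D$-dimensional cube into $k^D$ equal cells and colour each cell black independently with probability $p$. Then $Q_{D,k}(p)$ is the probability that there is a cluster of black cells, connected through common faces of cells, which touches every face of the large cube (so it connects each pair of faces) and whose cells cover strictly more than half of the area of each face of the large cube. For example, $Q_{2,3}(p)=12p^9-31p^8+20p^7$. *)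

theory Defs
  imports "HOL-Probability.Probability"
begin

section \<open>Smooth manifolds\<close>

text \<open>Only meant for open sets \<open>S\<close>, where the Frechet derivative is the usual one.\<close>

fun Ck_on :: "nat \<Rightarrow> 'a::euclidean_space set \<Rightarrow> ('a \<Rightarrow> 'b::real_normed_vector) \<Rightarrow> bool" where
  "Ck_on 0 S f \<longleftrightarrow> continuous_on S f"
| "Ck_on (Suc m) S f \<longleftrightarrow>
     f differentiable_on S \<and> (\<forall>b\<in>Basis. Ck_on m S (\<lambda>x. frechet_derivative f (at x) b))"

definition smooth_on :: "'a::euclidean_space set \<Rightarrow> ('a \<Rightarrow> 'b::real_normed_vector) \<Rightarrow> bool" where
  "smooth_on S f \<longleftrightarrow> (\<forall>m. Ck_on m S f)"

text \<open>
  The manifold is the whole type \<open>'m\<close> (second countable, Hausdorff) with an atlas modelled on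
  \<open>real ^ 'd\<close>, so its dimension is \<open>CARD('d)\<close>. A chart is a pair (domain, coordinate map); the
  coordinate map is only relevant on the domain.
\<close>

type_synonym ('m, 'd) chart = "'m set \<times> ('m \<Rightarrow> real ^ 'd)"

definition chart_inv :: "('m, 'd::finite) chart \<Rightarrow> real ^ 'd \<Rightarrow> 'm" where
  "chart_inv c = inv_into (fst c) (snd c)"

definition smooth_atlas ::
    "('m::{t2_space, second_countable_topology}, 'd::finite) chart set \<Rightarrow> bool" where
  "smooth_atlas \<A> \<longleftrightarrow>
     (\<Union>c\<in>\<A>. fst c) = UNIV \<and>
     (\<forall>c\<in>\<A>. open (fst c) \<and> open (snd c ` fst c) \<and>
        homeomorphism (fst c) (snd c ` fst c) (snd c) (chart_inv c)) \<and>
     (\<forall>c\<in>\<A>. \<forall>c'\<in>\<A>. smooth_on (snd c ` (fst c \<inter> fst c')) (snd c' \<circ> chart_inv c))"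

definition smooth_fun_on ::
    "('m, 'd::finite) chart set \<Rightarrow> 'm set \<Rightarrow> ('m \<Rightarrow> real) \<Rightarrow> bool" where
  "smooth_fun_on \<A> S f \<longleftrightarrow> (\<forall>c\<in>\<A>. smooth_on (snd c ` (fst c \<inter> S)) (f \<circ> chart_inv c))"

text \<open>
  Densities on the manifold (written \<open>dY\<close>) are taken with respect to a reference measure that
  has a smooth positive Lebesgue density in every chart.
\<close>

definition smooth_volume ::
    "('m::{t2_space, second_countable_topology}, 'd::finite) chart set \<Rightarrow> 'm measure \<Rightarrow> bool" where
  "smooth_volume \<A> vol \<longleftrightarrow> sets vol = sets borel \<and>
     (\<forall>c\<in>\<A>. \<exists>w :: real ^ 'd \<Rightarrow> real.
        smooth_on (snd c ` fst c) w \<and> (\<forall>y\<in>snd c ` fst c. 0 < w y) \<and>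
        (\<forall>B\<in>sets borel. B \<subseteq> fst c \<longrightarrow>
           emeasure vol B = (\<integral>\<^sup>+y\<in>snd c ` B. ennreal (w y) \<partial>lborel)))"


section \<open>The generator\<close>

datatype calculus = Ito | Stratonovich

definition partial :: "'d::finite \<Rightarrow> (real ^ 'd \<Rightarrow> real) \<Rightarrow> real ^ 'd \<Rightarrow> real" where
  "partial i g y = frechet_derivative g (at y) (axis i 1)"

definition local_generator ::
    "calculus \<Rightarrow> (real ^ 'd::finite \<Rightarrow> real ^ 'd ^ 'd) \<Rightarrow> (real ^ 'd \<Rightarrow> real ^ 'd) \<Rightarrow>
     (real ^ 'd \<Rightarrow> real) \<Rightarrow> real ^ 'd \<Rightarrow> real" where
  "local_generator cal sg b g y =
     (case cal of
        Ito \<Rightarrow> (1/2) * (\<Sum>i\<in>UNIV. \<Sum>j\<in>UNIV. \<Sum>k\<in>UNIV.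
                 sg y $ i $ k * sg y $ k $ j * partial i (partial j g) y)
      | Stratonovich \<Rightarrow> (1/2) * (\<Sum>i\<in>UNIV. \<Sum>j\<in>UNIV. \<Sum>k\<in>UNIV.
                 sg y $ i $ k * partial i (\<lambda>x. sg x $ k $ j * partial j g x) y))
     + (\<Sum>i\<in>UNIV. b y $ i * partial i g y)"

text \<open>
  \<open>sg c\<close> and \<open>b c\<close> are the coefficients in the chart \<open>c\<close>, as functions of the local coordinates.
  No transformation rule is prescribed for them (the Ito drift is not a vector field): what
  matters is that the local expressions define one operator \<open>\<G>\<close> on the manifold.
\<close>

definition diffusion_generator ::
    "('m, 'd::finite) chart set \<Rightarrow> 'm set \<Rightarrow> calculus \<Rightarrow>
     (('m, 'd) chart \<Rightarrow> real ^ 'd \<Rightarrow> real ^ 'd ^ 'd) \<Rightarrow> (('m, 'd) chart \<Rightarrow> real ^ 'd \<Rightarrow> real ^ 'd) \<Rightarrow>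
     (('m \<Rightarrow> real) \<Rightarrow> 'm \<Rightarrow> real) \<Rightarrow> bool" where
  "diffusion_generator \<A> \<Gamma> cal sg b \<G> \<longleftrightarrow>
     (\<forall>c\<in>\<A>. smooth_on (snd c ` (fst c - \<Gamma>)) (sg c) \<and> smooth_on (snd c ` (fst c - \<Gamma>)) (b c) \<and>
        (\<forall>y\<in>snd c ` (fst c - \<Gamma>). \<forall>v. v \<noteq> 0 \<longrightarrow> 0 < v \<bullet> (sg c y *v v))) \<and>
     (\<forall>f. smooth_fun_on \<A> (- \<Gamma>) f \<longrightarrow> (\<forall>c\<in>\<A>. \<forall>x\<in>fst c - \<Gamma>.
        \<G> f x = local_generator cal (sg c) (b c) (f \<circ> chart_inv c) (snd c x)))"

definition principal_eigenvalue ::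
    "('m::topological_space, 'd::finite) chart set \<Rightarrow> 'm set \<Rightarrow> (('m \<Rightarrow> real) \<Rightarrow> 'm \<Rightarrow> real) \<Rightarrow>
     ('m \<Rightarrow> real) \<Rightarrow> nat \<Rightarrow> real \<Rightarrow> bool" where
  "principal_eigenvalue \<A> \<Gamma> \<G> n r lam \<longleftrightarrow>
     (\<exists>\<psi>. continuous_on UNIV \<psi> \<and> smooth_fun_on \<A> (- \<Gamma>) \<psi> \<and>
        (\<forall>x\<in>- \<Gamma>. 0 < \<psi> x) \<and> (\<forall>x\<in>\<Gamma>. \<psi> x = 0) \<and>
        (\<forall>x\<in>- \<Gamma>. \<G> \<psi> x + (real r - 1) * n x * \<psi> x = lam * \<psi> x))"


section \<open>The diffusion\<close>

text \<open>Continuous paths on \<open>[0,\<infinity>)\<close> that stay forever at the point where they reach \<open>\<Gamma>\<close>.\<close>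

definition path_space :: "'m::topological_space set \<Rightarrow> (real \<Rightarrow> 'm) measure" where
  "path_space \<Gamma> = restrict_space (PiM {0..} (\<lambda>_. borel))
     {w. continuous_on {0..} w \<and> (\<forall>s t. 0 \<le> s \<and> s \<le> t \<and> w s \<in> \<Gamma> \<longrightarrow> w t = w s)}"

definition hits :: "'m set \<Rightarrow> (real \<Rightarrow> 'm) \<Rightarrow> bool" where
  "hits \<Gamma> w \<longleftrightarrow> (\<exists>t\<ge>0. w t \<in> \<Gamma>)"

definition hit_time :: "'m set \<Rightarrow> (real \<Rightarrow> 'm) \<Rightarrow> real" where
  "hit_time \<Gamma> w = Inf {t. 0 \<le> t \<and> w t \<in> \<Gamma>}"

text \<open>
  \<open>\<P> x\<close> is the law of the diffusion started at \<open>x\<close>, absorbed at \<open>\<Gamma>\<close>. The generator enters through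
  the martingale problem: for every smooth \<open>f\<close> with compact support off \<open>\<Gamma>\<close>, the process
  \<open>f(X\<^sub>t) - \<integral>\<^sub>0\<^sup>t \<G> f(X\<^sub>u) du\<close> is a martingale. Here \<open>A\<close> runs through the events determined by the
  path up to time \<open>s\<close>.
\<close>

definition diffusion ::
    "('m::{t2_space, second_countable_topology}, 'd::finite) chart set \<Rightarrow> 'm set \<Rightarrow>
     (('m \<Rightarrow> real) \<Rightarrow> 'm \<Rightarrow> real) \<Rightarrow> ('m \<Rightarrow> (real \<Rightarrow> 'm) measure) \<Rightarrow> bool" where
  "diffusion \<A> \<Gamma> \<G> \<P> \<longleftrightarrow>
     \<P> \<in> borel \<rightarrow>\<^sub>M prob_algebra (path_space \<Gamma>) \<and>
     (\<forall>x. AE w in \<P> x. w 0 = x) \<and>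
     (\<forall>x f s t. smooth_fun_on \<A> UNIV f \<and>
        (\<exists>C. compact C \<and> C \<subseteq> - \<Gamma> \<and> (\<forall>y. y \<notin> C \<longrightarrow> f y = 0)) \<and> 0 \<le> s \<and> s \<le> t \<longrightarrow>
        (\<forall>A\<in>sets (PiM {0..s} (\<lambda>_. borel)).
           (LINT w:{w\<in>space (\<P> x). restrict w {0..s} \<in> A}|\<P> x.
              f (w t) - f (w s)
              - (LINT u:{s..t}|lborel. indicator (- \<Gamma>) (w u) * \<G> f (w u))) = 0))"

definition accessible :: "'m set \<Rightarrow> ('m \<Rightarrow> (real \<Rightarrow> 'm) measure) \<Rightarrow> bool" where
  "accessible \<Gamma> \<P> \<longleftrightarrow> (\<forall>x\<in>- \<Gamma>. 0 < measure (\<P> x) {w\<in>space (\<P> x). hits \<Gamma> w})"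


section \<open>A single branching particle\<close>

text \<open>
  A particle carries a path and an independent standard exponential clock \<open>e\<close>; it branches when
  the accumulated rate \<open>\<integral>\<^sub>0\<^sup>t n(X\<^sub>s) ds\<close> reaches \<open>e\<close>, provided this happens before \<open>\<Gamma>\<close> is reached.
  Since \<open>n\<close> is continuous and positive off \<open>\<Gamma>\<close>, \<open>branch_times\<close> has at most one element for \<open>e \<ge> 0\<close>.
\<close>

type_synonym 'm particle = "(real \<Rightarrow> 'm) \<times> real"

definition particle_space :: "'m::topological_space set \<Rightarrow> 'm particle measure" where
  "particle_space \<Gamma> = path_space \<Gamma> \<Otimes>\<^sub>M borel"

definition particle_law :: "('m \<Rightarrow> (real \<Rightarrow> 'm) measure) \<Rightarrow> 'm \<Rightarrow> 'm particle measure" where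
  "particle_law \<P> x = \<P> x \<Otimes>\<^sub>M density lborel (\<lambda>s. ennreal (exponential_density 1 s))"

definition branch_times :: "'m set \<Rightarrow> ('m \<Rightarrow> real) \<Rightarrow> 'm particle \<Rightarrow> real set" where
  "branch_times \<Gamma> n \<xi> = {t. 0 \<le> t \<and> fst \<xi> t \<notin> \<Gamma> \<and>
     (\<integral>\<^sup>+s\<in>{0..t}. ennreal (n (fst \<xi> s)) \<partial>lborel) = ennreal (snd \<xi>)}"

definition branches :: "'m set \<Rightarrow> ('m \<Rightarrow> real) \<Rightarrow> 'm particle \<Rightarrow> bool" where
  "branches \<Gamma> n \<xi> \<longleftrightarrow> branch_times \<Gamma> n \<xi> \<noteq> {}"

definition branch_time :: "'m set \<Rightarrow> ('m \<Rightarrow> real) \<Rightarrow> 'm particle \<Rightarrow> real" where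
  "branch_time \<Gamma> n \<xi> = Inf (branch_times \<Gamma> n \<xi>)"

definition branch_point :: "'m set \<Rightarrow> ('m \<Rightarrow> real) \<Rightarrow> 'm particle \<Rightarrow> 'm" where
  "branch_point \<Gamma> n \<xi> = fst \<xi> (branch_time \<Gamma> n \<xi>)"

definition absorbed :: "'m set \<Rightarrow> ('m \<Rightarrow> real) \<Rightarrow> 'm particle \<Rightarrow> bool" where
  "absorbed \<Gamma> n \<xi> \<longleftrightarrow> hits \<Gamma> (fst \<xi>) \<and> \<not> branches \<Gamma> n \<xi>"

definition absorption_prob ::
    "'m set \<Rightarrow> ('m \<Rightarrow> real) \<Rightarrow> ('m \<Rightarrow> (real \<Rightarrow> 'm) measure) \<Rightarrow> 'm \<Rightarrow> real" where
  "absorption_prob \<Gamma> n \<P> x =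
     measure (particle_law \<P> x) {\<xi>\<in>space (particle_law \<P> x). absorbed \<Gamma> n \<xi>}"

definition first_branching_density ::
    "'m::topological_space set \<Rightarrow> ('m \<Rightarrow> real) \<Rightarrow> ('m \<Rightarrow> (real \<Rightarrow> 'm) measure) \<Rightarrow> 'm measure \<Rightarrow>
     ('m \<Rightarrow> 'm \<Rightarrow> real) \<Rightarrow> bool" where
  "first_branching_density \<Gamma> n \<P> vol K \<longleftrightarrow>
     (\<forall>x\<in>- \<Gamma>. set_borel_measurable vol (- \<Gamma>) (K x) \<and> (\<forall>y\<in>- \<Gamma>. 0 \<le> K x y) \<and>
        (\<forall>B\<in>sets borel. B \<subseteq> - \<Gamma> \<longrightarrow>
           emeasure (particle_law \<P> x)
             {\<xi>\<in>space (particle_law \<P> x). branches \<Gamma> n \<xi> \<and> branch_point \<Gamma> n \<xi> \<in> B} =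
           (\<integral>\<^sup>+y\<in>B. ennreal (K x y) \<partial>vol)))"


section \<open>The branching diffusion of one unit cube\<close>

text \<open>
  Particles are labelled by lists of cells, most recent first: \<open>c # v\<close> is the offspring of \<open>v\<close> that
  corresponds to the cell \<open>c\<close> of the cube of \<open>v\<close>. The particle \<open>T v\<close> is meaningful only if \<open>v\<close> is
  born. The space of cubes is \<open>real ^ 'D\<close>, with \<open>CARD('D)\<close> the dimension \<open>D\<close>.
\<close>

type_synonym 'D label = "(int ^ 'D) list"

definition cells :: "nat \<Rightarrow> (int ^ 'D::finite) set" where
  "cells k = {c. \<forall>i. 0 \<le> c $ i \<and> c $ i < int k}"

primrec born ::
    "nat \<Rightarrow> 'm set \<Rightarrow> ('m \<Rightarrow> real) \<Rightarrow> ('D::finite label \<Rightarrow> 'm particle) \<Rightarrow> 'D label \<Rightarrow> bool" where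
  "born k \<Gamma> n T [] \<longleftrightarrow> True"
| "born k \<Gamma> n T (c # v) \<longleftrightarrow> c \<in> cells k \<and> born k \<Gamma> n T v \<and> branches \<Gamma> n (T v)"

primrec birth_place ::
    "'m set \<Rightarrow> ('m \<Rightarrow> real) \<Rightarrow> 'm \<Rightarrow> ('D label \<Rightarrow> 'm particle) \<Rightarrow> 'D label \<Rightarrow> 'm" where
  "birth_place \<Gamma> n x T [] = x"
| "birth_place \<Gamma> n x T (c # v) = branch_point \<Gamma> n (T v)"

primrec birth_time ::
    "'m set \<Rightarrow> ('m \<Rightarrow> real) \<Rightarrow> ('D label \<Rightarrow> 'm particle) \<Rightarrow> 'D label \<Rightarrow> real" where
  "birth_time \<Gamma> n T [] = 0"
| "birth_time \<Gamma> n T (c # v) = birth_time \<Gamma> n T v + branch_time \<Gamma> n (T v)"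

definition history_space :: "'m::topological_space set \<Rightarrow> nat \<Rightarrow>
    ('m \<times> ('D label \<Rightarrow> 'm particle)) measure" where
  "history_space \<Gamma> g = borel \<Otimes>\<^sub>M PiM {v. length v < g} (\<lambda>_. particle_space \<Gamma>)"

definition history :: "('w \<Rightarrow> 'm) \<Rightarrow> ('D label \<Rightarrow> 'w \<Rightarrow> 'm particle) \<Rightarrow> nat \<Rightarrow> 'w \<Rightarrow>
    'm \<times> ('D label \<Rightarrow> 'm particle)" where
  "history X0 T g \<omega> = (X0 \<omega>, \<lambda>v\<in>{v. length v < g}. T v \<omega>)"

text \<open>
  The branching property: given the starting point and all generations before \<open>g\<close>, the particles
  of generation \<open>g\<close> that are born are independent single particles started at their birth places.
  It is stated for every finite set \<open>S\<close> of labels of generation \<open>g\<close> and every event of the past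
  on which all of \<open>S\<close> is born.
\<close>

definition branching_diffusion ::
    "'w measure \<Rightarrow> nat \<Rightarrow> 'm::topological_space set \<Rightarrow> ('m \<Rightarrow> real) \<Rightarrow>
     ('m \<Rightarrow> (real \<Rightarrow> 'm) measure) \<Rightarrow> ('w \<Rightarrow> 'm) \<Rightarrow> ('D::finite label \<Rightarrow> 'w \<Rightarrow> 'm particle) \<Rightarrow> bool"
  where
  "branching_diffusion \<Omega> k \<Gamma> n \<P> X0 T \<longleftrightarrow>
     X0 \<in> \<Omega> \<rightarrow>\<^sub>M borel \<and> (\<forall>v. T v \<in> \<Omega> \<rightarrow>\<^sub>M particle_space \<Gamma>) \<and>
     (\<forall>g. \<forall>H\<in>sets (history_space \<Gamma> g). \<forall>S. \<forall>A.
        finite S \<and> S \<subseteq> {v. length v = g} \<and> (\<forall>v\<in>S. A v \<in> sets (particle_space \<Gamma>)) \<and>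
        (\<forall>\<omega>\<in>space \<Omega>. history X0 T g \<omega> \<in> H \<longrightarrow> (\<forall>v\<in>S. born k \<Gamma> n (\<lambda>u. T u \<omega>) v)) \<longrightarrow>
        measure \<Omega> {\<omega>\<in>space \<Omega>. history X0 T g \<omega> \<in> H \<and> (\<forall>v\<in>S. T v \<omega> \<in> A v)} =
        (LINT \<omega>:{\<omega>\<in>space \<Omega>. history X0 T g \<omega> \<in> H}|\<Omega>.
           (\<Prod>v\<in>S. measure (particle_law \<P> (birth_place \<Gamma> n (X0 \<omega>) (\<lambda>u. T u \<omega>) v)) (A v))))"

text \<open>
  One branching diffusion for each unit cube \<open>z + [0,1]\<^sup>D\<close>, all of them independent, with starting
  points of density \<open>\<gamma>\<close>.
\<close>

definition cube_branching ::
    "'w measure \<Rightarrow> nat \<Rightarrow> 'm::topological_space set \<Rightarrow> ('m \<Rightarrow> real) \<Rightarrow>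
     ('m \<Rightarrow> (real \<Rightarrow> 'm) measure) \<Rightarrow> 'm measure \<Rightarrow> ('m \<Rightarrow> real) \<Rightarrow>
     (int ^ 'D::finite \<Rightarrow> 'w \<Rightarrow> 'm) \<Rightarrow> (int ^ 'D \<Rightarrow> 'D label \<Rightarrow> 'w \<Rightarrow> 'm particle) \<Rightarrow> bool" where
  "cube_branching \<Omega> k \<Gamma> n \<P> vol \<gamma> X0 T \<longleftrightarrow>
     (\<forall>z. distributed \<Omega> vol (X0 z) (\<lambda>x. ennreal (\<gamma> x))) \<and>
     (\<forall>z. branching_diffusion \<Omega> k \<Gamma> n \<P> (X0 z) (T z)) \<and>
     prob_space.indep_vars \<Omega> (\<lambda>_. borel \<Otimes>\<^sub>M PiM UNIV (\<lambda>_. particle_space \<Gamma>))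
       (\<lambda>z \<omega>. (X0 z \<omega>, \<lambda>v. T z v \<omega>)) UNIV"


section \<open>Cubes and percolation\<close>

text \<open>A cube is given by its lowest corner and its side length.\<close>

type_synonym 'D cube = "(real ^ 'D) \<times> real"

definition cube_set :: "'D::finite cube \<Rightarrow> (real ^ 'D) set" where
  "cube_set q = {x. \<forall>i. fst q $ i \<le> x $ i \<and> x $ i \<le> fst q $ i + snd q}"

definition cube_faces :: "'D::finite cube \<Rightarrow> (real ^ 'D) set set" where
  "cube_faces q = (\<Union>i. {{x\<in>cube_set q. x $ i = fst q $ i},
                          {x\<in>cube_set q. x $ i = fst q $ i + snd q}})"

definition cubes_connected :: "'D::finite cube \<Rightarrow> 'D cube \<Rightarrow> bool" where
  "cubes_connected q q' \<longleftrightarrow>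
     interior (cube_set q) \<inter> interior (cube_set q') = {} \<and>
     (\<exists>f\<in>cube_faces q. \<exists>f'\<in>cube_faces q'. f \<subseteq> f' \<or> f' \<subseteq> f)"

primrec cube_corner :: "nat \<Rightarrow> int ^ 'D::finite \<Rightarrow> 'D label \<Rightarrow> real ^ 'D" where
  "cube_corner k z [] = (\<chi> i. real_of_int (z $ i))"
| "cube_corner k z (c # v) =
     cube_corner k z v + (1 / real k ^ Suc (length v)) *\<^sub>R (\<chi> i. real_of_int (c $ i))"

definition particle_cube :: "nat \<Rightarrow> int ^ 'D::finite \<Rightarrow> 'D label \<Rightarrow> 'D cube" where
  "particle_cube k z v = (cube_corner k z v, 1 / real k ^ length v)"

definition black_cubes ::
    "nat \<Rightarrow> 'm set \<Rightarrow> ('m \<Rightarrow> real) \<Rightarrow> (int ^ 'D::finite \<Rightarrow> 'D label \<Rightarrow> 'm particle) \<Rightarrow>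
     real \<Rightarrow> 'D cube set" where
  "black_cubes k \<Gamma> n T t = {particle_cube k z v | z v.
     born k \<Gamma> n (T z) v \<and> absorbed \<Gamma> n (T z v) \<and>
     birth_time \<Gamma> n (T z) v + hit_time \<Gamma> (fst (T z v)) \<le> t}"

definition final_black_cubes ::
    "nat \<Rightarrow> 'm set \<Rightarrow> ('m \<Rightarrow> real) \<Rightarrow> (int ^ 'D::finite \<Rightarrow> 'D label \<Rightarrow> 'm particle) \<Rightarrow>
     'D cube set" where
  "final_black_cubes k \<Gamma> n T = (\<Union>t\<in>{0..}. black_cubes k \<Gamma> n T t)"

text \<open>
  Since cubes can be arbitrarily small, an infinite path need not leave bounded sets; this is
  required explicitly.
\<close>

definition has_path_to_infinity :: "'D::finite cube set \<Rightarrow> bool" where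
  "has_path_to_infinity B \<longleftrightarrow>
     (\<exists>\<pi> :: nat \<Rightarrow> 'D cube. inj \<pi> \<and> (\<forall>j. \<pi> j \<in> B) \<and>
        (\<forall>j. cubes_connected (\<pi> j) (\<pi> (Suc j))) \<and>
        filterlim (\<lambda>j. fst (\<pi> j)) at_infinity sequentially)"

definition percolates :: "'w measure \<Rightarrow> ('w \<Rightarrow> 'D::finite cube set) \<Rightarrow> bool" where
  "percolates \<Omega> B \<longleftrightarrow> (AE \<omega> in \<Omega>. has_path_to_infinity (B \<omega>))"


section \<open>Site percolation and the polynomial\<close>

definition adjacent :: "int ^ 'D::finite \<Rightarrow> int ^ 'D \<Rightarrow> bool" where
  "adjacent x y \<longleftrightarrow> (\<Sum>i\<in>UNIV. \<bar>x $ i - y $ i\<bar>) = 1"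

definition connected_sites :: "(int ^ 'D::finite) set \<Rightarrow> bool" where
  "connected_sites C \<longleftrightarrow>
     (\<forall>x\<in>C. \<forall>y\<in>C. (x, y) \<in> {(a, b). a \<in> C \<and> b \<in> C \<and> adjacent a b}\<^sup>*)"

definition site_measure :: "real \<Rightarrow> (int ^ 'D::finite \<Rightarrow> bool) measure" where
  "site_measure p = PiM UNIV (\<lambda>_. measure_pmf (bernoulli_pmf p))"

definition site_threshold :: "'D::finite itself \<Rightarrow> real" where
  "site_threshold _ = Inf {p\<in>{0..1}. AE \<omega> in site_measure p.
     \<exists>C :: (int ^ 'D) set. infinite C \<and> connected_sites C \<and> (\<forall>x\<in>C. \<omega> x)}"

text \<open>
  The large cube is scaled to \<open>[0,1]\<^sup>D\<close>, with cells of side \<open>1/k\<close>. Its faces are given by a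
  coordinate \<open>i\<close> and an extreme value \<open>a\<close> of the cell index; a cell at this face covers the area
  \<open>(1/k)^(D-1)\<close> of it.
\<close>

definition spanning :: "nat \<Rightarrow> (int ^ 'D::finite) set \<Rightarrow> bool" where
  "spanning k S \<longleftrightarrow>
     (\<exists>C\<subseteq>S. connected_sites C \<and>
        (\<forall>i. \<forall>a\<in>{0, int k - 1}. {c\<in>C. c $ i = a} \<noteq> {} \<and>
           real (card {c\<in>C. c $ i = a}) * (1 / real k) ^ (CARD('D) - 1) > 1/2))"

definition Q_poly :: "'D::finite itself \<Rightarrow> nat \<Rightarrow> real \<Rightarrow> real" where
  "Q_poly _ k p =
     measure_pmf.prob (Pi_pmf (cells k :: (int ^ 'D) set) False (\<lambda>_. bernoulli_pmf p))
       {\<omega>. spanning k {c\<in>cells k. \<omega> c}}"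

definition F_op ::
    "'D::finite itself \<Rightarrow> nat \<Rightarrow> 'm set \<Rightarrow> 'm measure \<Rightarrow> ('m \<Rightarrow> real) \<Rightarrow> ('m \<Rightarrow> 'm \<Rightarrow> real) \<Rightarrow>
     ('m \<Rightarrow> real) \<Rightarrow> 'm \<Rightarrow> real" where
  "F_op D k \<Gamma> vol \<rho> K \<phi> x =
     \<rho> x + (1 - \<rho> x) * (LINT y:- \<Gamma>|vol. K x y * Q_poly D k (\<phi> y))"

definition P_lim ::
    "'D::finite itself \<Rightarrow> nat \<Rightarrow> 'm set \<Rightarrow> 'm measure \<Rightarrow> ('m \<Rightarrow> real) \<Rightarrow> ('m \<Rightarrow> 'm \<Rightarrow> real) \<Rightarrow>
     'm \<Rightarrow> real" where
  "P_lim D k \<Gamma> vol \<rho> K x = lim (\<lambda>j. (F_op D k \<Gamma> vol \<rho> K ^^ j) \<rho> x)"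

definition p_star ::
    "'D::finite itself \<Rightarrow> nat \<Rightarrow> 'm set \<Rightarrow> 'm measure \<Rightarrow> ('m \<Rightarrow> real) \<Rightarrow> ('m \<Rightarrow> 'm \<Rightarrow> real) \<Rightarrow>
     ('m \<Rightarrow> real) \<Rightarrow> real" where
  "p_star D k \<Gamma> vol \<rho> K \<gamma> = (LINT x:- \<Gamma>|vol. \<gamma> x * P_lim D k \<Gamma> vol \<rho> K x)"

end

theory Submission
  imports Defs
begin

text \<open>
  Call a cube good at depth \<open>0\<close> if its particle is absorbed, and good at depth \<open>i + 1\<close> if its particle is
  absorbed or it is divided and its cells that are good at depth \<open>i\<close> contain a spanning cluster in the
  sense of \<open>Q\<close>. Inside a good cube there is a finite connected family of black cubes, and the families of
  two adjacent good cubes of equal size are connected: since each occupies more than half of the cells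
  of the common face, two good cells face each other, and one descends until one of the two cubes
  is black. An infinite cluster of good unit cubes thus contains an infinite connected graph of black
  cubes with finitely many vertices in every bounded region, and Koenig's lemma yields the path.

  By the branching property, the probability of being good at depth \<open>i\<close> satisfies the recursion of
  \<open>F\<close> without the factor \<open>1 - \<rho>\<close>, so it is at least the \<open>i\<close>-th iterate of \<open>F\<close>. Hence for some fixed depth
  the good unit cubes form an independent site process of density above the threshold.
\<close>

section \<open>Infinite paths in locally finite graphs\<close>

text \<open>The branching property is available only for finitely many labels of one generation and
  for past events on which all of them are born. Goodness depends on a whole finite subtree, so its
  law cannot be read off by restarting the process at the first branching.
  \<open>good_outcomes\<close> therefore prescribes arbitrary outcomes, good or not good, on a
  finite set of labels of one generation. This form is stable under passing to the offspring. The
  branching point is a path evaluated at a random time, in a space given only as Hausdorff and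
  second countable. Its measurability needs pointwise limits of measurable maps, and regularity,
  taken from the charts, does the work of a metric there. \<open>site_threshold\<close> is an
  infimum: it only yields some percolating density below \<open>p_star\<close>, not percolation at
  every higher density. Thinning carries the almost sure statement from that density to the denser
  field of good unit cubes. Clusters are handled as sets of labels with integer corners, and only at
  the end turned into cubes. Comparing cubes of different sizes is then integer arithmetic with
  powers of \<open>k\<close>.\<close>

definition connected_in :: "('a \<times> 'a) set \<Rightarrow> 'a set \<Rightarrow> bool" where
  "connected_in E X \<longleftrightarrow> (\<forall>a\<in>X. \<forall>b\<in>X. (a, b) \<in> (E \<inter> X \<times> X)\<^sup>*)"

lemma connected_sites_iff: "connected_sites C \<longleftrightarrow> connected_in {(a, b). adjacent a b} C"
proof -
  have "{(a, b). a \<in> C \<and> b \<in> C \<and> adjacent a b} = {(a, b). adjacent a b} \<inter> C \<times> C" by auto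
  then show ?thesis by (simp add: connected_sites_def connected_in_def)
qed

text \<open>A walk through the index set \<open>C\<close> lifts to the union: inside each
  \<open>X c\<close> one walks from the entry point to the endpoint of the next link. It is used
  twice, for the cells of one cube and for the unit cubes of an infinite cluster.\<close>

lemma connected_in_UN:
  assumes X: "\<And>c. c \<in> C \<Longrightarrow> connected_in E (X c)" and ne: "\<And>c. c \<in> C \<Longrightarrow> X c \<noteq> {}"
    and C: "connected_in R C"
    and link: "\<And>c d. c \<in> C \<Longrightarrow> d \<in> C \<Longrightarrow> (c, d) \<in> R \<Longrightarrow> \<exists>a\<in>X c. \<exists>b\<in>X d. (a, b) \<in> E"
  shows "connected_in E (\<Union>c\<in>C. X c)"
proof -
  let ?U = "\<Union>c\<in>C. X c"
  have inside: "(a, b) \<in> (E \<inter> ?U \<times> ?U)\<^sup>*" if "c \<in> C" "a \<in> X c" "b \<in> X c" for a b c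
  proof -
    have "(a, b) \<in> (E \<inter> X c \<times> X c)\<^sup>*" using X[OF that(1)] that by (auto simp: connected_in_def)
    moreover have "E \<inter> X c \<times> X c \<subseteq> E \<inter> ?U \<times> ?U" using that by auto
    ultimately show ?thesis using rtrancl_mono by blast
  qed
  have main: "\<forall>a\<in>X c. \<forall>b\<in>X d. (a, b) \<in> (E \<inter> ?U \<times> ?U)\<^sup>*"
    if "(c, d) \<in> (R \<inter> C \<times> C)\<^sup>*" "c \<in> C" for c d
    using that
  proof (induction rule: rtrancl_induct)
    case base
    then show ?case using inside by blast
  next
    case (step d d')
    then obtain a b where ab: "a \<in> X d" "b \<in> X d'" "(a, b) \<in> E" "d \<in> C" "d' \<in> C"
      using link[of d d'] by auto
    have e: "(a, b) \<in> E \<inter> ?U \<times> ?U" using ab by auto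
    show ?case
    proof (intro ballI)
      fix x y assume x: "x \<in> X c" and y: "y \<in> X d'"
      have "(x, a) \<in> (E \<inter> ?U \<times> ?U)\<^sup>*" using step x ab by blast
      also note r_into_rtrancl[OF e]
      also have "(b, y) \<in> (E \<inter> ?U \<times> ?U)\<^sup>*" using inside ab y by blast
      finally show "(x, y) \<in> (E \<inter> ?U \<times> ?U)\<^sup>*" .
    qed
  qed
  show ?thesis
    unfolding connected_in_def
  proof (intro ballI)
    fix a b assume "a \<in> ?U" "b \<in> ?U"
    then obtain c d where "c \<in> C" "a \<in> X c" "d \<in> C" "b \<in> X d" by blast
    moreover from this have "(c, d) \<in> (R \<inter> C \<times> C)\<^sup>*" using C by (auto simp: connected_in_def)
    ultimately show "(a, b) \<in> (E \<inter> ?U \<times> ?U)\<^sup>*" using main by blast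
  qed
qed

text \<open>Koenig's lemma on a breadth-first tree. Apart from the vertex itself, the descendants of
  a vertex are those of its finitely many children, so a vertex with infinitely many descendants has
  a child with the same property. The distance \<open>d\<close> from the root grows by one at each
  step, which makes the path injective.\<close>

theorem infinite_path_in_locally_finite:
  assumes conn: "connected_in E V" and inf: "infinite V"
    and lf: "\<And>x. x \<in> V \<Longrightarrow> finite {y \<in> V. (x, y) \<in> E}"
  shows "\<exists>\<pi> :: nat \<Rightarrow> 'a. inj \<pi> \<and> (\<forall>j. \<pi> j \<in> V \<and> (\<pi> j, \<pi> (Suc j)) \<in> E)"
proof -
  define R where "R = E \<inter> V \<times> V"
  obtain r where r: "r \<in> V" using inf by fastforce
  define d where "d x = (LEAST m. (r, x) \<in> R ^^ m)" for x
  have dR: "(r, x) \<in> R ^^ d x" if "x \<in> V" for x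
  proof -
    have "(r, x) \<in> R\<^sup>*" using conn r that by (auto simp: connected_in_def R_def)
    then have "\<exists>m. (r, x) \<in> R ^^ m" by (simp add: rtrancl_power)
    then show ?thesis unfolding d_def by (rule LeastI_ex)
  qed
  have d0: "x = r" if "x \<in> V" "d x = 0" for x using dR[OF that(1)] that(2) by simp
  \<comment> \<open>predecessors on shortest walks from \<open>r\<close>: they form a spanning tree, and one descends in it\<close>
  have "\<exists>y. y \<in> V \<and> (y, x) \<in> E \<and> d x = Suc (d y)" if x: "x \<in> V" and xr: "x \<noteq> r" for x
  proof -
    obtain m where m: "d x = Suc m" using d0 x xr by (cases "d x") auto
    obtain y where y: "(r, y) \<in> R ^^ m" "(y, x) \<in> R" using dR[OF x] m by auto
    have yV: "y \<in> V" using y by (auto simp: R_def)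
    have "d y \<le> m" using y(1) unfolding d_def by (rule Least_le)
    moreover have "(r, x) \<in> R ^^ Suc (d y)" using dR[OF yV] y by auto
    then have "d x \<le> Suc (d y)" unfolding d_def[of x] by (rule Least_le)
    ultimately show ?thesis using m y yV by (auto simp: R_def)
  qed
  then obtain p where p: "\<And>x. x \<in> V \<Longrightarrow> x \<noteq> r \<Longrightarrow> p x \<in> V \<and> (p x, x) \<in> E \<and> d x = Suc (d (p x))"
    by metis
  \<comment> \<open>The descendants of \<open>x\<close> in the tree. Iterating \<open>p\<close> must
    stop at the root, where \<open>p\<close> is unspecified; the last clause ensures this.\<close>
  define D where "D x = {y \<in> V. \<exists>m. (p ^^ m) y = x \<and> (\<forall>l<m. (p ^^ l) y \<noteq> r)}" for x
  have Dr: "V \<subseteq> D r"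
  proof
    fix x assume "x \<in> V"
    then show "x \<in> D r"
    proof (induction "d x" arbitrary: x)
      case 0
      then have "x = r" using d0 by simp
      then show ?case using r by (auto simp: D_def intro!: exI[of _ 0])
    next
      case (Suc m)
      show ?case
      proof (cases "x = r")
        case True
        then show ?thesis using r by (auto simp: D_def intro!: exI[of _ 0])
      next
        case False
        then have "p x \<in> D r" using Suc p[of x] by auto
        then obtain l where "(p ^^ l) (p x) = r" "\<forall>i<l. (p ^^ i) (p x) \<noteq> r" by (auto simp: D_def)
        then have "(p ^^ Suc l) x = r \<and> (\<forall>i<Suc l. (p ^^ i) x \<noteq> r)"
          using False by (auto simp: funpow_swap1 less_Suc_eq_0_disj simp del: funpow.simps(2))
            (auto simp: funpow_swap1)
        then show ?thesis using Suc(3) unfolding D_def by blast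
      qed
    qed
  qed
  have child: "\<exists>y. y \<in> V \<and> (x, y) \<in> E \<and> d y = Suc (d x) \<and> infinite (D y)"
    if x: "x \<in> V" and iD: "infinite (D x)" for x
  proof -
    let ?Y = "{y \<in> V. y \<noteq> r \<and> p y = x}"
    have "D x \<subseteq> insert x (\<Union>y\<in>?Y. D y)"
    proof
      fix u assume "u \<in> D x"
      then obtain m where m: "u \<in> V" "(p ^^ m) u = x" "\<forall>l<m. (p ^^ l) u \<noteq> r" by (auto simp: D_def)
      show "u \<in> insert x (\<Union>y\<in>?Y. D y)"
      proof (cases m)
        case 0
        then show ?thesis using m by simp
      next
        case (Suc l)
        have "(p ^^ i) u \<in> V" if "i \<le> l" for i
          using that
        proof (induction i)
          case 0
          then show ?case using m by simp
        next
          case (Suc i)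
          then show ?case using p[of "(p ^^ i) u"] m \<open>m = Suc l\<close> by auto
        qed
        then have "(p ^^ l) u \<in> ?Y" using m Suc by auto
        moreover have "u \<in> D ((p ^^ l) u)" using m Suc unfolding D_def by (auto intro!: exI[of _ l] dest: less_SucI)
        ultimately show ?thesis by blast
      qed
    qed
    then have inf': "infinite (insert x (\<Union>y\<in>?Y. D y))" using iD infinite_super by blast
    have "?Y \<subseteq> {y \<in> V. (x, y) \<in> E}" using p by auto
    then have "finite ?Y" using lf[OF x] finite_subset by blast
    then obtain y where "y \<in> ?Y" "infinite (D y)" using inf' by auto
    then show ?thesis using p[of y] by auto
  qed
  define good where "good x \<longleftrightarrow> x \<in> V \<and> infinite (D x)" for x
  have "\<exists>f. \<forall>j::nat. good (f j) \<and> ((f j, f (Suc j)) \<in> E \<and> d (f (Suc j)) = Suc (d (f j)))"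
  proof (rule dependent_nat_choice)
    show "\<exists>x. good x" using r Dr inf infinite_super unfolding good_def by blast
    show "\<exists>y. good y \<and> (x, y) \<in> E \<and> d y = Suc (d x)" if "good x" for x
      using child that unfolding good_def by blast
  qed
  then obtain f where f: "\<And>j. good (f j)" "\<And>j. (f j, f (Suc j)) \<in> E" "\<And>j. d (f (Suc j)) = Suc (d (f j))"
    by blast
  have "strict_mono (\<lambda>j. d (f j))" using f(3) by (simp add: strict_mono_Suc_iff)
  then have "inj (\<lambda>j. d (f j))" by (rule strict_mono_imp_inj_on)
  then have "inj f" by (auto simp: inj_def)
  then show ?thesis using f by (auto simp: good_def)
qed

section \<open>Linking clusters of cubes\<close>

text \<open>The corner of a cube in units of its own side, so that the position is an integer vector
  whose base-\<open>k\<close> digits are the cells of the label.\<close>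

primrec lattice_corner :: "nat \<Rightarrow> int ^ 'D::finite \<Rightarrow> 'D label \<Rightarrow> int ^ 'D" where
  "lattice_corner k z [] = z"
| "lattice_corner k z (c # v) = (\<chi> i. int k * lattice_corner k z v $ i + c $ i)"

definition lattice_cube :: "nat \<Rightarrow> nat \<Rightarrow> int ^ 'D::finite \<Rightarrow> 'D cube" where
  "lattice_cube k m N = (\<chi> i. of_int (N $ i) / real k ^ m, 1 / real k ^ m)"

lemma particle_cube_eq:
  assumes "k > 0"
  shows "particle_cube k z v = lattice_cube k (length v) (lattice_corner k z v)"
proof -
  have "cube_corner k z v $ i = of_int (lattice_corner k z v $ i) / real k ^ length v" for i
    using assms by (induction v) (auto simp: field_simps)
  then show ?thesis by (simp add: particle_cube_def lattice_cube_def vec_eq_iff)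
qed

lemma cubes_connected_sym: "cubes_connected q q' \<longleftrightarrow> cubes_connected q' q"
  unfolding cubes_connected_def by (auto simp: Int_commute)

lemma interior_slab_disjoint:
  fixes i :: "'D::finite"
  assumes "A \<subseteq> {x :: real ^ 'D. x $ i \<le> t}" "B \<subseteq> {x. t \<le> x $ i}"
  shows "interior A \<inter> interior B = {}"
proof -
  have "interior A \<subseteq> {x. x $ i < t}" using interior_mono[OF assms(1)] by simp
  moreover have "interior B \<subseteq> {x. t < x $ i}"
    using interior_mono[OF assms(2)] interior_halfspace_component_ge by simp
  ultimately show ?thesis by fastforce
qed

text \<open>Containment in a single coordinate, with \<open>M\<close> measured in units
  \<open>s\<close> times smaller than \<open>N\<close>. It is kept coordinatewise because a smaller
  cube touching \<open>N\<close> from outside satisfies it in every direction except the one across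
  the common face.\<close>

definition within_cell :: "nat \<Rightarrow> int ^ 'D::finite \<Rightarrow> int ^ 'D \<Rightarrow> 'D \<Rightarrow> bool" where
  "within_cell s N M j \<longleftrightarrow> int s * N $ j \<le> M $ j \<and> M $ j < int s * (N $ j + 1)"

text \<open>All bounds are rewritten over the finer denominator \<open>k ^ l\<close>, so that
  containment of the small face in the large one becomes an inequality between integers. The two
  cases are the two sides of the large cube on which the small one may lie; the hyperplane of the
  common face separates the interiors.\<close>

lemma lattice_cubes_connected:
  fixes N M :: "int ^ 'D::finite"
  assumes k: "k > 0" and ml: "m \<le> l"
    and i: "M $ i = int (k ^ (l - m)) * (N $ i + 1) \<or> M $ i + 1 = int (k ^ (l - m)) * N $ i"
    and j: "\<And>j. j \<noteq> i \<Longrightarrow> within_cell (k ^ (l - m)) N M j"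
  shows "cubes_connected (lattice_cube k m N) (lattice_cube k l M)"
proof -
  define s where "s = k ^ (l - m)"
  have s: "real s * real k ^ m = real k ^ l" "real k ^ m > 0" "real s > 0" "real k ^ l > 0"
    using k ml by (auto simp: s_def simp flip: power_add)
  have scale: "of_int x / real k ^ m = of_int (int s * x) / real k ^ l" for x :: int
    using s by (simp add: field_simps)
  let ?q = "lattice_cube k m N" and ?q' = "lattice_cube k l M"
  have side: "of_int x / real k ^ m + 1 / real k ^ m = of_int (int s * (x + 1)) / real k ^ l" for x :: int
    using scale[of "x + 1"] by (simp add: add_divide_distrib)
  have side': "of_int x / real k ^ l + 1 / real k ^ l = of_int (x + 1) / real k ^ l" for x :: int
    by (simp add: add_divide_distrib)
  have q: "cube_set ?q = {x. \<forall>i. of_int (int s * N $ i) / real k ^ l \<le> x $ i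
      \<and> x $ i \<le> of_int (int s * (N $ i + 1)) / real k ^ l}"
    unfolding cube_set_def lattice_cube_def fst_conv snd_conv vec_lambda_beta side unfolding scale ..
  have q': "cube_set ?q' = {x. \<forall>i. of_int (M $ i) / real k ^ l \<le> x $ i
      \<and> x $ i \<le> of_int (M $ i + 1) / real k ^ l}"
    unfolding cube_set_def lattice_cube_def fst_conv snd_conv vec_lambda_beta side' ..
  have f: "fst ?q $ i = of_int (int s * N $ i) / real k ^ l"
    "fst ?q $ i + snd ?q = of_int (int s * (N $ i + 1)) / real k ^ l"
    "fst ?q' $ i = of_int (M $ i) / real k ^ l" "fst ?q' $ i + snd ?q' = of_int (M $ i + 1) / real k ^ l"
    unfolding lattice_cube_def fst_conv snd_conv vec_lambda_beta by (fact scale side refl side')+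
  have F: "{x \<in> cube_set ?q. x $ i = of_int (int s * N $ i) / real k ^ l} \<in> cube_faces ?q"
    "{x \<in> cube_set ?q. x $ i = of_int (int s * (N $ i + 1)) / real k ^ l} \<in> cube_faces ?q"
    "{x \<in> cube_set ?q'. x $ i = of_int (M $ i) / real k ^ l} \<in> cube_faces ?q'"
    "{x \<in> cube_set ?q'. x $ i = of_int (M $ i + 1) / real k ^ l} \<in> cube_faces ?q'"
    unfolding cube_faces_def f[symmetric] by blast+
  have mono: "of_int x / real k ^ l \<le> (of_int y / real k ^ l :: real)" if "x \<le> y" for x y :: int
    using s that by (simp add: divide_right_mono)
  have sub: "of_int (int s * N $ j) / real k ^ l \<le> x $ j \<and> x $ j \<le> of_int (int s * (N $ j + 1)) / real k ^ l"
    if "x \<in> cube_set ?q'" "j \<noteq> i" for x j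
  proof -
    have "int s * N $ j \<le> M $ j" "M $ j + 1 \<le> int s * (N $ j + 1)"
      using j[OF that(2)] by (auto simp: within_cell_def s_def)
    note b = mono[OF this(1)] mono[OF this(2)]
    have "of_int (M $ j) / real k ^ l \<le> x $ j" "x $ j \<le> of_int (M $ j + 1) / real k ^ l"
      using that(1) unfolding q' by auto
    then show ?thesis using b by (meson order_trans)
  qed
  have inside: "x \<in> cube_set ?q" if "x \<in> cube_set ?q'"
    "of_int (int s * N $ i) / real k ^ l \<le> x $ i" "x $ i \<le> of_int (int s * (N $ i + 1)) / real k ^ l" for x
    unfolding q mem_Collect_eq
  proof
    fix j
    show "of_int (int s * N $ j) / real k ^ l \<le> x $ j \<and> x $ j \<le> of_int (int s * (N $ j + 1)) / real k ^ l"
      using sub[OF that(1), of j] that(2,3) by (cases "j = i") simp_all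
  qed
  from i show ?thesis
  proof
    assume a: "M $ i = int (k ^ (l - m)) * (N $ i + 1)"
    then have a: "M $ i = int s * (N $ i + 1)" by (simp add: s_def)
    have "int s * N $ i \<le> M $ i" using a s by (simp add: algebra_simps)
    then have face: "{x \<in> cube_set ?q'. x $ i = of_int (M $ i) / real k ^ l}
        \<subseteq> {x \<in> cube_set ?q. x $ i = of_int (int s * (N $ i + 1)) / real k ^ l}"
      using inside mono[of "int s * N $ i" "M $ i"] unfolding a by auto
    moreover have "cube_set ?q \<subseteq> {x. x $ i \<le> of_int (M $ i) / real k ^ l}" unfolding q a by auto
    moreover have "cube_set ?q' \<subseteq> {x. of_int (M $ i) / real k ^ l \<le> x $ i}" unfolding q' by auto
    ultimately have "interior (cube_set ?q) \<inter> interior (cube_set ?q') = {}"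
      by (intro interior_slab_disjoint)
    moreover note face
    ultimately show ?thesis using F unfolding cubes_connected_def by blast
  next
    assume a: "M $ i + 1 = int (k ^ (l - m)) * N $ i"
    then have a: "M $ i + 1 = int s * N $ i" by (simp add: s_def)
    have "M $ i + 1 \<le> int s * (N $ i + 1)" using a s by (simp add: algebra_simps)
    then have face: "{x \<in> cube_set ?q'. x $ i = of_int (M $ i + 1) / real k ^ l}
        \<subseteq> {x \<in> cube_set ?q. x $ i = of_int (int s * N $ i) / real k ^ l}"
      using inside mono[of "M $ i + 1" "int s * (N $ i + 1)"] unfolding a by auto
    moreover have "cube_set ?q' \<subseteq> {x. x $ i \<le> of_int (M $ i + 1) / real k ^ l}" unfolding q' by auto
    moreover have "cube_set ?q \<subseteq> {x. of_int (M $ i + 1) / real k ^ l \<le> x $ i}" unfolding q a by auto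
    ultimately have "interior (cube_set ?q') \<inter> interior (cube_set ?q) = {}"
      by (intro interior_slab_disjoint)
    then have "interior (cube_set ?q) \<inter> interior (cube_set ?q') = {}" by blast
    then show ?thesis using F face unfolding cubes_connected_def by blast
  qed
qed


text \<open>The certificate behind goodness: a tree of spanning clusters, of any finite and possibly
  uneven depth, together with the set of its leaves. Unlike \<open>good_label\<close> it mentions no
  depth, which allows a simultaneous descent in two clusters of different shapes.\<close>

inductive spanning_cluster ::
    "nat \<Rightarrow> ('D::finite label \<Rightarrow> bool) \<Rightarrow> ('D label \<Rightarrow> bool) \<Rightarrow> 'D label \<Rightarrow> 'D label set \<Rightarrow> bool"
  for k blk br where
  leaf: "blk v \<Longrightarrow> spanning_cluster k blk br v {v}"
| node: "br v \<Longrightarrow> C \<subseteq> cells k \<Longrightarrow> connected_sites C \<Longrightarrow>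
    (\<And>i a. a \<in> {0, int k - 1} \<Longrightarrow>
       real (card {c \<in> C. c $ i = a}) * (1 / real k) ^ (CARD('D) - 1) > 1/2) \<Longrightarrow>
    (\<And>c. c \<in> C \<Longrightarrow> spanning_cluster k blk br (c # v) (X c)) \<Longrightarrow>
    spanning_cluster k blk br v (\<Union>c\<in>C. X c)"

primrec good_label ::
    "nat \<Rightarrow> ('D::finite label \<Rightarrow> bool) \<Rightarrow> ('D label \<Rightarrow> bool) \<Rightarrow> nat \<Rightarrow> 'D label \<Rightarrow> bool" where
  "good_label k blk br 0 v \<longleftrightarrow> blk v"
| "good_label k blk br (Suc i) v \<longleftrightarrow>
     blk v \<or> br v \<and> spanning k {c \<in> cells k. good_label k blk br i (c # v)}"

lemma good_label_cluster:
  "good_label k blk br i v \<Longrightarrow> \<exists>X. spanning_cluster k blk br v X"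
proof (induction i arbitrary: v)
  case 0
  then show ?case using leaf by fastforce
next
  case (Suc i)
  show ?case
  proof (cases "blk v")
    case True
    then show ?thesis using leaf by fastforce
  next
    case False
    then have br: "br v" and "spanning k {c \<in> cells k. good_label k blk br i (c # v)}"
      using Suc.prems by auto
    then obtain C where C: "C \<subseteq> {c \<in> cells k. good_label k blk br i (c # v)}" "connected_sites C"
      "\<forall>i. \<forall>a\<in>{0, int k - 1}. {c\<in>C. c $ i = a} \<noteq> {} \<and>
         real (card {c \<in> C. c $ i = a}) * (1 / real k) ^ (CARD('a) - 1) > 1/2"
      unfolding spanning_def by blast
    then have "\<forall>c\<in>C. \<exists>X. spanning_cluster k blk br (c # v) X" using Suc.IH by blast
    then obtain X where X: "\<forall>c\<in>C. spanning_cluster k blk br (c # v) (X c)" by metis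
    have "spanning_cluster k blk br v (\<Union>c\<in>C. X c)"
      using C X br by (intro spanning_cluster.node) auto
    then show ?thesis by blast
  qed
qed

lemma finite_cells [simp, intro]: "finite (cells k :: (int ^ 'D::finite) set)"
proof -
  have "cells k \<subseteq> (\<lambda>f. vec_lambda f) ` (PiE (UNIV :: 'D set) (\<lambda>_. {0..<int k}))"
  proof
    fix c :: "int ^ 'D" assume "c \<in> cells k"
    then have "vec_nth c \<in> PiE UNIV (\<lambda>_. {0..<int k})" by (auto simp: cells_def)
    then show "c \<in> (\<lambda>f. vec_lambda f) ` (PiE (UNIV :: 'D set) (\<lambda>_. {0..<int k}))"
      by (intro image_eqI[where x = "vec_nth c"]) auto
  qed
  then show ?thesis by (rule finite_subset) (auto intro!: finite_PiE)
qed

lemma card_cell_face: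
  fixes i :: "'D::finite"
  shows "card {c \<in> cells k. c $ i = 0} \<le> k ^ (CARD('D) - 1)"
proof -
  let ?P = "PiE (UNIV - {i}) (\<lambda>_. {0..<int k})"
  let ?g = "\<lambda>c :: int ^ 'D. restrict (vec_nth c) (UNIV - {i})"
  have "inj_on ?g {c \<in> cells k. c $ i = 0}"
  proof (rule inj_onI)
    fix c d :: "int ^ 'D"
    assume "c \<in> {c \<in> cells k. c $ i = 0}" "d \<in> {c \<in> cells k. c $ i = 0}" and e: "?g c = ?g d"
    then have "c $ i = d $ i" by simp
    moreover have "c $ j = d $ j" if "j \<noteq> i" for j using fun_cong[OF e, of j] that by simp
    ultimately show "c = d" by (metis vec_eq_iff)
  qed
  moreover have "?g ` {c \<in> cells k. c $ i = 0} \<subseteq> ?P" by (auto simp: cells_def split: if_splits)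
  moreover have "finite ?P" by (auto intro!: finite_PiE)
  ultimately have "card {c \<in> cells k. c $ i = 0} \<le> card ?P" by (rule card_inj_on_le)
  also have "card ?P = k ^ (CARD('D) - 1)" by (subst card_PiE) (auto simp: card_Diff_singleton)
  finally show ?thesis .
qed

lemma facing_cells:
  fixes C C' :: "(int ^ 'D::finite) set" and i :: 'D
  assumes k: "k > 0" and C: "C \<subseteq> cells k" "C' \<subseteq> cells k"
    and half: "real (card {c \<in> C. c $ i = int k - 1}) * (1 / real k) ^ (CARD('D) - 1) > 1/2"
    and half': "real (card {c \<in> C'. c $ i = 0}) * (1 / real k) ^ (CARD('D) - 1) > 1/2"
  obtains c c' where "c \<in> C" "c' \<in> C'" "c $ i = int k - 1" "c' $ i = 0" "\<And>j. j \<noteq> i \<Longrightarrow> c' $ j = c $ j"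
proof -
  \<comment> \<open>Slides the upper layer of \<open>C\<close> onto the lower one. Both layers then
    lie in one face of at most k^(D-1) cells, and two sets each exceeding half of that number must
    meet.\<close>
  let ?h = "\<lambda>c :: int ^ 'D. \<chi> j. if j = i then 0 else c $ j"
  let ?A = "?h ` {c \<in> C. c $ i = int k - 1}" and ?B = "{c \<in> C'. c $ i = 0}"
  let ?F = "{c \<in> cells k. c $ i = 0} :: (int ^ 'D) set"
  have "inj_on ?h {c \<in> C. c $ i = int k - 1}"
    by (rule inj_onI) (auto simp: vec_eq_iff, metis)
  then have cA: "card ?A = card {c \<in> C. c $ i = int k - 1}" by (rule card_image)
  have sub: "?A \<subseteq> ?F" "?B \<subseteq> ?F" using C k by (auto simp: cells_def)
  have "?A \<inter> ?B \<noteq> {}"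
  proof
    assume dis: "?A \<inter> ?B = {}"
    have fin: "finite ?A" "finite ?B" using finite_subset[OF sub(1)] finite_subset[OF sub(2)] by auto
    have "card ?A + card ?B = card (?A \<union> ?B)" using card_Un_disjoint[OF fin dis] by simp
    also have "\<dots> \<le> card ?F" by (rule card_mono) (use sub in auto)
    also have "\<dots> \<le> k ^ (CARD('D) - 1)" by (rule card_cell_face)
    finally have "real (card ?A) + real (card ?B) \<le> real k ^ (CARD('D) - 1)"
      by (simp only: flip: of_nat_add of_nat_power of_nat_le_iff)
    then have "(real (card ?A) + real (card ?B)) * (1 / real k) ^ (CARD('D) - 1) \<le> 1"
      using k by (simp add: power_one_over field_simps)
    then show False using half half' unfolding cA by (simp add: algebra_simps)
  qed
  then obtain c where c: "c \<in> C" "c $ i = int k - 1" "?h c \<in> C'" by auto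
  show thesis by (rule that[OF c(1) c(3) c(2)]) auto
qed

context
  fixes k :: nat
  assumes k: "k \<ge> 2"
begin

lemma within_cell_step:
  fixes c :: "int ^ 'D::finite"
  assumes "c \<in> cells k" "within_cell s (\<chi> i. int k * N $ i + c $ i) M j"
  shows "within_cell (k * s) N M j"
proof -
  have c: "0 \<le> c $ j" "c $ j + 1 \<le> int k" using assms(1) by (auto simp: cells_def dest!: spec[of _ j])
  have "int s * (c $ j) \<ge> 0" "int s * (c $ j + 1) \<le> int s * int k"
    using c by (auto intro: mult_left_mono)
  then show ?thesis using assms(2) by (simp add: within_cell_def algebra_simps)
qed

text \<open>Each further letter of a label selects a cell of the current cube, so every leaf lies
  inside the cube of the root.\<close>

lemma spanning_cluster_desc:
  assumes "spanning_cluster k blk br v X" "u \<in> X"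
  shows "length v \<le> length u \<and>
    within_cell (k ^ (length u - length v)) (lattice_corner k z v) (lattice_corner k z u) j"
  using assms
proof (induction arbitrary: u)
  case (leaf v)
  then show ?case by (simp add: within_cell_def)
next
  case (node v C X)
  then obtain c where c: "c \<in> C" "u \<in> X c" by blast
  with node.IH[OF c] have IH: "Suc (length v) \<le> length u"
    "within_cell (k ^ (length u - Suc (length v)))
      (\<chi> i. int k * lattice_corner k z v $ i + c $ i) (lattice_corner k z u) j"
    by auto
  have "within_cell (k * k ^ (length u - Suc (length v))) (lattice_corner k z v) (lattice_corner k z u) j"
    by (rule within_cell_step[OF _ IH(2)]) (use c node in auto)
  moreover have "k * k ^ (length u - Suc (length v)) = k ^ (length u - length v)"
    using IH(1) by (simp add: Suc_diff_Suc flip: power_Suc)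
  ultimately show ?case using IH(1) by simp
qed

lemma spanning_cluster_leaves:
  assumes "spanning_cluster k blk br v X"
  shows "finite X \<and> X \<noteq> {} \<and> (\<forall>u\<in>X. blk u)"
  using assms
proof induction
  case (leaf v)
  then show ?case by simp
next
  case (node v C X)
  have "finite C" using node.hyps(2) finite_subset by blast
  \<comment> \<open>Any direction serves: a layer covering more than half of a face cannot be
    empty.\<close>
  moreover have "C \<noteq> {}" using node.hyps(4)[of 0 undefined] by fastforce
  ultimately show ?case using node.IH by auto
qed

text \<open>Rule induction on \<open>spanning_cluster\<close> passes information from the cells to
  the cube. This form goes the other way and carries a property of the root, such as being born, to
  the leaves.\<close>

lemma spanning_cluster_induct_down:
  assumes "spanning_cluster k blk br v X" "u \<in> X" "P v"
    and "\<And>c v. c \<in> cells k \<Longrightarrow> br v \<Longrightarrow> P v \<Longrightarrow> P (c # v)"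
  shows "P u"
  using assms(1-3)
proof (induction arbitrary: u)
  case (leaf v)
  then show ?case by simp
next
  case (node v C X)
  then show ?case using assms(4) by blast
qed

text \<open>Choosing a cell of the extreme layer at every level leads to a leaf on the given face.
  This is what linking needs when the other cube is itself black: one leaf on the common face is
  then enough.\<close>

lemma spanning_cluster_touches:
  assumes "spanning_cluster k blk br v X"
  shows "\<exists>u\<in>X. lattice_corner k z u $ i = int (k ^ (length u - length v)) * lattice_corner k z v $ i"
    and "\<exists>u\<in>X. lattice_corner k z u $ i + 1 =
      int (k ^ (length u - length v)) * (lattice_corner k z v $ i + 1)"
  using assms
proof (induction rule: spanning_cluster.induct)
  case (leaf v)
  { case 1 then show ?case by simp }
  { case 2 then show ?case by simp }
next
  case (node v C X)
  have ne: "\<exists>c\<in>C. c $ i = a" if "a \<in> {0, int k - 1}" for a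
  proof (rule ccontr)
    assume "\<not> ?thesis"
    then have "card {c \<in> C. c $ i = a} = 0" by (metis (mono_tags, lifting) card.empty empty_Collect_eq)
    then show False using node.hyps(4)[OF that, of i] by simp
  qed
  have len: "int (k ^ (length u - length v)) = int (k ^ (length u - Suc (length v))) * int k"
    if "u \<in> X c" "c \<in> C" for u c
  proof -
    have "Suc (length v) \<le> length u" using spanning_cluster_desc[OF node.hyps(5)] that by fastforce
    then show ?thesis by (simp add: Suc_diff_Suc flip: power_Suc2)
  qed
  { case 1
    obtain c where c: "c \<in> C" "c $ i = 0" using ne[of 0] by auto
    obtain u where "u \<in> X c" "lattice_corner k z u $ i =
       int (k ^ (length u - Suc (length v))) * (int k * lattice_corner k z v $ i)"
      using node.IH(1)[OF c(1)] c by auto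
    with c len[OF _ c(1)] show ?case
      by (intro bexI[of _ u]) (auto simp: algebra_simps) }
  { case 2
    obtain c where c: "c \<in> C" "c $ i = int k - 1" using ne[of "int k - 1"] by auto
    obtain u where "u \<in> X c" "lattice_corner k z u $ i + 1 =
       int (k ^ (length u - Suc (length v))) * (int k * lattice_corner k z v $ i + int k)"
      using node.IH(2)[OF c(1)] c by auto
    with c len[OF _ c(1)] show ?case
      by (intro bexI[of _ u]) (auto simp: algebra_simps) }
qed

text \<open>The colourings and the unit cubes are independent parameters for the two clusters, so
  that the same induction covers neighbouring cells of one unit cube and neighbouring unit
  cubes.\<close>

lemma spanning_clusters_linked:
  fixes z z' :: "int ^ 'D::finite"
  assumes "spanning_cluster k blk br v X" "spanning_cluster k blk' br' v' X'"
    and "length v = length v'"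
    and "lattice_corner k z' v' $ i = lattice_corner k z v $ i + 1"
    and "\<And>j. j \<noteq> i \<Longrightarrow> lattice_corner k z' v' $ j = lattice_corner k z v $ j"
  shows "\<exists>u\<in>X. \<exists>u'\<in>X'. cubes_connected (particle_cube k z u) (particle_cube k z' u')"
  using assms
proof (induction arbitrary: v' X')
  case (leaf v)
  \<comment> \<open>The first cube is black. A leaf of the other cluster on its lower face in
    direction \<open>i\<close> lies against this cube and projects into it in the other
    coordinates.\<close>
  obtain u where u: "u \<in> X'" "lattice_corner k z' u $ i =
      int (k ^ (length u - length v')) * lattice_corner k z' v' $ i"
    using spanning_cluster_touches(1)[OF leaf.prems(1)] by blast
  note d = spanning_cluster_desc[OF leaf.prems(1) u(1), where z = z']
  have r: "within_cell (k ^ (length u - length v)) (lattice_corner k z v) (lattice_corner k z' u) j" if "j \<noteq> i" for j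
    using d[of j] leaf.prems(2) leaf.prems(4)[OF that] by (simp add: within_cell_def)
  have "cubes_connected (lattice_cube k (length v) (lattice_corner k z v))
    (lattice_cube k (length u) (lattice_corner k z' u))"
    using k d u leaf.prems(2,3) by (intro lattice_cubes_connected[where i = i] r) auto
  then show ?case using u k by (auto simp: particle_cube_eq)
next
  case (node v C X)
  from node.prems(1) show ?case
  proof cases
    case leaf
    have cl: "spanning_cluster k blk br v (\<Union>c\<in>C. X c)"
      using node.hyps by (intro spanning_cluster.node)
    obtain u where u: "u \<in> (\<Union>c\<in>C. X c)" "lattice_corner k z u $ i + 1 =
        int (k ^ (length u - length v)) * (lattice_corner k z v $ i + 1)"
      using spanning_cluster_touches(2)[OF cl] by blast
    note d = spanning_cluster_desc[OF cl u(1), where z = z]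
    have r: "within_cell (k ^ (length u - length v')) (lattice_corner k z' v') (lattice_corner k z u) j" if "j \<noteq> i" for j
      using d[of j] node.prems(2) node.prems(4)[OF that] by (simp add: within_cell_def)
    have "cubes_connected (lattice_cube k (length v') (lattice_corner k z' v'))
      (lattice_cube k (length u) (lattice_corner k z u))"
      using k d u node.prems(2,3) by (intro lattice_cubes_connected[where i = i] r) auto
    then show ?thesis using u k leaf by (auto simp: particle_cube_eq cubes_connected_sym)
  next
    case n': (node C' Y)
    \<comment> \<open>The facing cells are again neighbours of equal size in direction
      \<open>i\<close>, because k * (N + 1) + 0 = (k * N + (k - 1)) + 1, so the hypotheses hold one
      level down.\<close>
    obtain c c' where c: "c \<in> C" "c' \<in> C'" "c $ i = int k - 1" "c' $ i = 0"
      "\<And>j. j \<noteq> i \<Longrightarrow> c' $ j = c $ j"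
      using facing_cells[of k C C' i] k node.hyps(2) n'(3) node.hyps(4)[of "int k - 1" i] n'(5)[of 0 i]
      by auto
    have "\<exists>u\<in>X c. \<exists>u'\<in>Y c'. cubes_connected (particle_cube k z u) (particle_cube k z' u')"
      by (rule node.IH[OF c(1) n'(6)[OF c(2)]])
        (use node.prems c in \<open>auto simp: algebra_simps\<close>)
    then show ?thesis using c n'(1) by blast
  qed
qed

lemma adjacentE:
  assumes "adjacent x y"
  obtains i where "y $ i = x $ i + 1 \<or> x $ i = y $ i + 1" "\<And>j. j \<noteq> i \<Longrightarrow> y $ j = x $ j"
proof -
  have s: "(\<Sum>i\<in>UNIV. \<bar>x $ i - y $ i\<bar>) = 1" using assms by (simp add: adjacent_def)
  have "\<exists>i. \<bar>x $ i - y $ i\<bar> \<noteq> 0"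
  proof (rule ccontr)
    assume "\<not> ?thesis"
    then show False using s by simp
  qed
  then obtain i where i: "\<bar>x $ i - y $ i\<bar> \<noteq> 0" by blast
  have e: "(\<Sum>i\<in>UNIV. \<bar>x $ i - y $ i\<bar>) = \<bar>x $ i - y $ i\<bar> + (\<Sum>j\<in>UNIV - {i}. \<bar>x $ j - y $ j\<bar>)"
    by (simp add: sum.remove)
  have "(\<Sum>j\<in>UNIV - {i}. \<bar>x $ j - y $ j\<bar>) \<ge> 0" by (simp add: sum_nonneg)
  then have i1: "\<bar>x $ i - y $ i\<bar> = 1" and z: "(\<Sum>j\<in>UNIV - {i}. \<bar>x $ j - y $ j\<bar>) = 0"
    using i s e by linarith+
  have "\<forall>j\<in>UNIV - {i}. \<bar>x $ j - y $ j\<bar> = 0" using z by (subst (asm) sum_nonneg_eq_0_iff) auto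
  then show thesis using i1 by (intro that[of i]) auto
qed

lemma adjacent_clusters_linked:
  assumes X: "spanning_cluster k blk br v X" "spanning_cluster k blk' br' v' X'"
    and "length v = length v'" "adjacent (lattice_corner k z v) (lattice_corner k z' v')"
  shows "\<exists>u\<in>X. \<exists>u'\<in>X'. cubes_connected (particle_cube k z u) (particle_cube k z' u')"
proof -
  obtain i where i: "lattice_corner k z' v' $ i = lattice_corner k z v $ i + 1 \<or>
      lattice_corner k z v $ i = lattice_corner k z' v' $ i + 1"
    "\<And>j. j \<noteq> i \<Longrightarrow> lattice_corner k z' v' $ j = lattice_corner k z v $ j"
    using adjacentE[OF assms(4)] by blast
  from i(1) show ?thesis
  proof
    assume "lattice_corner k z' v' $ i = lattice_corner k z v $ i + 1"
    then show ?thesis using spanning_clusters_linked[OF X assms(3) _ i(2)] by blast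
  next
    assume "lattice_corner k z v $ i = lattice_corner k z' v' $ i + 1"
    then show ?thesis
      using spanning_clusters_linked[OF X(2) X(1), where z = z' and z' = z and i = i] assms(3) i(2)
        cubes_connected_sym by fastforce
  qed
qed

text \<open>Already inside one cube the linking result is needed: adjacent cells of its spanning
  cluster are neighbouring cubes of equal size, each with its own family of leaves.\<close>

lemma spanning_cluster_connected:
  assumes "spanning_cluster k blk br v X"
  shows "connected_in {(u, u'). cubes_connected (particle_cube k z u) (particle_cube k z u')} X"
  using assms
proof induction
  case (leaf v)
  then show ?case by (simp add: connected_in_def)
next
  case (node v C X)
  show ?case
  proof (rule connected_in_UN)
    show "connected_in {(a, b). adjacent a b} C"
      using node.hyps(3) by (simp add: connected_sites_iff)
    show "\<And>c. c \<in> C \<Longrightarrow> X c \<noteq> {}" using spanning_cluster_leaves[OF node.hyps(5)] by blast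
    fix c d assume cd: "c \<in> C" "d \<in> C" "(c, d) \<in> {(a, b). adjacent a b}"
    then have "adjacent (lattice_corner k z (c # v)) (lattice_corner k z (d # v))"
      by (simp add: adjacent_def)
    then show "\<exists>a\<in>X c. \<exists>b\<in>X d.
        (a, b) \<in> {(u, u'). cubes_connected (particle_cube k z u) (particle_cube k z u')}"
      using adjacent_clusters_linked[OF node.hyps(5)[OF cd(1)] node.hyps(5)[OF cd(2)]] by auto
  qed (use node.IH in auto)
qed

text \<open>The cells of a label are digits in base \<open>k\<close>, coordinate by coordinate;
  division by \<open>k\<close> recovers the corner of the parent and then the last digit.\<close>

lemma lattice_corner_inj:
  assumes "lattice_corner k z v = lattice_corner k z' v'" "length v = length v'"
    "set v \<subseteq> cells k" "set v' \<subseteq> cells k"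
  shows "z = z' \<and> v = v'"
  using assms(2,1,3,4)
proof (induction v v' rule: list_induct2)
  case Nil
  then show ?case by simp
next
  case (Cons c v c' v')
  have e: "int k * lattice_corner k z v $ i + c $ i = int k * lattice_corner k z' v' $ i + c' $ i"
    and b: "0 \<le> c $ i" "c $ i < int k" "0 \<le> c' $ i" "c' $ i < int k" for i
    using Cons.prems by (auto simp: vec_eq_iff cells_def)
  have "lattice_corner k z v $ i = lattice_corner k z' v' $ i" "c $ i = c' $ i" for i
  proof -
    have "(int k * lattice_corner k z v $ i + c $ i) div int k = lattice_corner k z v $ i"
      "(int k * lattice_corner k z' v' $ i + c' $ i) div int k = lattice_corner k z' v' $ i"
      using b[of i] k by (subst div_mult_self4; simp)+
    then show "lattice_corner k z v $ i = lattice_corner k z' v' $ i" using e[of i] by simp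
    then show "c $ i = c' $ i" using e[of i] by simp
  qed
  then show ?case using Cons by (auto simp: vec_eq_iff)
qed

text \<open>The side length determines the level. This lets a path found among labels be read as a
  non-self-intersecting path of cubes.\<close>

lemma particle_cube_inj:
  assumes "particle_cube k z v = particle_cube k z' v'" "set v \<subseteq> cells k" "set v' \<subseteq> cells k"
  shows "z = z' \<and> v = v'"
proof -
  have "real k ^ length v = real k ^ length v'"
    using assms(1) k by (simp add: particle_cube_def)
  then have l: "length v = length v'" using k by (simp add: power_inject_exp)
  have "lattice_corner k z v = lattice_corner k z' v'"
    using assms(1) k by (simp add: particle_cube_eq lattice_cube_def vec_eq_iff l)
  then show ?thesis using lattice_corner_inj l assms by blast
qed

lemma cube_corner_bounds:
  assumes "set v \<subseteq> cells k"
  shows "of_int (z $ i) \<le> cube_corner k z v $ i \<and> cube_corner k z v $ i + 1 / real k ^ length v \<le> of_int (z $ i) + 1"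
  using assms
proof (induction v)
  case Nil
  then show ?case by simp
next
  case (Cons c v)
  have c: "0 \<le> c $ i" "c $ i + 1 \<le> int k"
    using Cons.prems by (auto simp: cells_def dest!: spec[of _ i])
  then have c': "0 \<le> real_of_int (c $ i)" "real_of_int (c $ i) + 1 \<le> real k" by linarith+
  have "(real_of_int (c $ i) + 1) / real k ^ Suc (length v) \<le> real k / real k ^ Suc (length v)"
    using c' by (intro divide_right_mono) auto
  also have "\<dots> = 1 / real k ^ length v" using k by simp
  finally have "real_of_int (c $ i) / real k ^ Suc (length v) + 1 / real k ^ Suc (length v)
      \<le> 1 / real k ^ length v"
    by (simp add: add_divide_distrib)
  moreover have "0 \<le> real_of_int (c $ i) / real k ^ Suc (length v)" using c' by simp
  ultimately show ?case using Cons by (auto simp del: power_Suc)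
qed

end

theorem has_path_to_infinity_if_infinite_cluster:
  fixes C :: "(int ^ 'D::finite) set"
  assumes k: "k \<ge> 2" and inf: "infinite C" and conn: "connected_sites C"
    and X: "\<And>z. z \<in> C \<Longrightarrow> spanning_cluster k (blk z) (br z) [] (X z)"
    and cells: "\<And>z v. z \<in> C \<Longrightarrow> v \<in> X z \<Longrightarrow> set v \<subseteq> cells k"
    and B: "\<And>z v. z \<in> C \<Longrightarrow> v \<in> X z \<Longrightarrow> particle_cube k z v \<in> B"
  shows "has_path_to_infinity B"
proof -
  define pc :: "(int ^ 'D) \<times> 'D label \<Rightarrow> 'D cube" where "pc = (\<lambda>(z, v). particle_cube k z v)"
  define E where "E = {(p, q). cubes_connected (pc p) (pc q) \<and> (fst p = fst q \<or> adjacent (fst p) (fst q))}"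
  define Y where "Y z = Pair z ` X z" for z
  let ?V = "\<Union>z\<in>C. Y z"
  have fin: "finite (Y z)" and ne: "Y z \<noteq> {}" if "z \<in> C" for z
    using spanning_cluster_leaves[OF k X[OF that]] by (auto simp: Y_def)
  have cV: "connected_in E ?V"
  proof (rule connected_in_UN)
    show "connected_in {(a, b). adjacent a b} C" using conn by (simp add: connected_sites_iff)
    show "connected_in E (Y z)" if "z \<in> C" for z
    proof -
      let ?R = "{(u, u'). cubes_connected (particle_cube k z u) (particle_cube k z u')} \<inter> X z \<times> X z"
      have "(Pair z a, Pair z b) \<in> (E \<inter> Y z \<times> Y z)\<^sup>*" if "(a, b) \<in> ?R\<^sup>*" for a b
        using that
      proof (induction rule: rtrancl_induct)
        case (step b c)
        then have "(Pair z b, Pair z c) \<in> E \<inter> Y z \<times> Y z" by (auto simp: E_def Y_def pc_def)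
        with step.IH show ?case by (rule rtrancl_into_rtrancl)
      qed simp
      then show ?thesis
        using spanning_cluster_connected[OF k X[OF that], of z]
        unfolding connected_in_def by (fastforce simp: Y_def)
    qed
    fix c d assume cd: "c \<in> C" "d \<in> C" "(c, d) \<in> {(a, b). adjacent a b}"
    then show "\<exists>a\<in>Y c. \<exists>b\<in>Y d. (a, b) \<in> E"
      using adjacent_clusters_linked[OF k X[OF cd(1)] X[OF cd(2)], of c d]
      by (auto simp: Y_def E_def pc_def)
  qed (use ne in auto)
  have iV: "infinite ?V"
  proof
    assume "finite ?V"
    moreover have "C \<subseteq> fst ` ?V" using ne by (force simp: Y_def)
    ultimately show False using inf finite_surj by blast
  qed
  have nb: "finite {y \<in> ?V. (x, y) \<in> E}" if "x \<in> ?V" for x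
  proof -
    let ?N = "vec_lambda ` PiE UNIV (\<lambda>i. {fst x $ i - 1..fst x $ i + 1})"
    have "finite (?N \<inter> C)" by (intro finite_Int disjI1 finite_imageI finite_PiE) auto
    then have "finite (\<Union>z\<in>?N \<inter> C. Y z)" using fin by blast
    moreover have "{y \<in> ?V. (x, y) \<in> E} \<subseteq> (\<Union>z\<in>?N \<inter> C. Y z)"
    proof
      fix y assume y: "y \<in> {y \<in> ?V. (x, y) \<in> E}"
      then have y1: "fst y \<in> C" "y \<in> Y (fst y)" by (auto simp: Y_def)
      have "fst x $ i - 1 \<le> fst y $ i \<and> fst y $ i \<le> fst x $ i + 1" for i
      proof -
        have "fst x = fst y \<or> adjacent (fst x) (fst y)" using y by (auto simp: E_def)
        then show ?thesis
        proof
          assume "adjacent (fst x) (fst y)"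
          from adjacentE[OF k this] obtain j where j: "fst y $ j = fst x $ j + 1 \<or> fst x $ j = fst y $ j + 1"
            "\<And>l. l \<noteq> j \<Longrightarrow> fst y $ l = fst x $ l" by blast
          then show ?thesis by (cases "i = j") auto
        qed simp
      qed
      then have "fst y \<in> ?N" by (intro image_eqI[where x = "vec_nth (fst y)"]) auto
      then show "y \<in> (\<Union>z\<in>?N \<inter> C. Y z)" using y1 by blast
    qed
    ultimately show ?thesis by (rule finite_subset[rotated])
  qed
  obtain \<pi> where \<pi>: "inj \<pi>" "\<And>j::nat. \<pi> j \<in> ?V" "\<And>j. (\<pi> j, \<pi> (Suc j)) \<in> E"
    using infinite_path_in_locally_finite[OF cV iV nb] by blast
  have inj: "inj_on pc ?V"
    by (rule inj_onI) (use particle_cube_inj[OF k] cells in \<open>fastforce simp: pc_def Y_def\<close>)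
  show ?thesis
    unfolding has_path_to_infinity_def
  proof (intro exI[of _ "pc \<circ> \<pi>"] conjI allI)
    show "inj (pc \<circ> \<pi>)"
      using comp_inj_on[OF \<pi>(1) inj_on_subset[OF inj]] \<pi>(2) by blast
    show "(pc \<circ> \<pi>) j \<in> B" for j using \<pi>(2)[of j] B by (auto simp: pc_def Y_def)
    show "cubes_connected ((pc \<circ> \<pi>) j) ((pc \<circ> \<pi>) (Suc j))" for j
      using \<pi>(3)[of j] by (simp add: E_def)
    show "filterlim (\<lambda>j. fst ((pc \<circ> \<pi>) j)) at_infinity sequentially"
      unfolding filterlim_at_infinity[OF order_refl]
    proof (intro allI impI)
      fix r :: real assume "0 < r"
      \<comment> \<open>The corner of a cube exceeds that of its unit cube by at most 1 in each
        coordinate, hence the extra unit in the box. An injective path visits the finitely many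
        vertices over the box only finitely often.\<close>
      let ?N = "vec_lambda ` PiE (UNIV :: 'D set) (\<lambda>i. {- \<lceil>r\<rceil> - 1..\<lceil>r\<rceil> + 1})"
      have "{j. \<not> r \<le> norm (fst ((pc \<circ> \<pi>) j))} \<subseteq> \<pi> -` (\<Union>z\<in>?N \<inter> C. Y z)"
      proof
        fix j assume "j \<in> {j. \<not> r \<le> norm (fst ((pc \<circ> \<pi>) j))}"
        then have n: "norm (fst (pc (\<pi> j))) < r" by simp
        obtain z v where zv: "\<pi> j = (z, v)" "z \<in> C" "v \<in> X z" using \<pi>(2)[of j] by (auto simp: Y_def)
        have "- \<lceil>r\<rceil> - 1 \<le> z $ i \<and> z $ i \<le> \<lceil>r\<rceil> + 1" for i
        proof -
          have "\<bar>cube_corner k z v $ i\<bar> < r"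
            using n component_le_norm_cart[of "cube_corner k z v" i] zv
            by (simp add: pc_def particle_cube_def)
          moreover have "1 / real k ^ length v \<ge> 0" by simp
          ultimately have "of_int (z $ i) < r" "- r < of_int (z $ i) + 1"
            using cube_corner_bounds[OF k cells[OF zv(2,3)], of z i] by linarith+
          then show ?thesis by linarith
        qed
        then have "z \<in> ?N" by (intro image_eqI[where x = "vec_nth z"]) auto
        then show "j \<in> \<pi> -` (\<Union>z\<in>?N \<inter> C. Y z)" using zv by (auto simp: Y_def)
      qed
      moreover have "finite (?N \<inter> C)" by (intro finite_Int disjI1 finite_imageI finite_PiE) auto
      then have "finite (\<Union>z\<in>?N \<inter> C. Y z)" using fin by blast
      then have "finite (\<pi> -` (\<Union>z\<in>?N \<inter> C. Y z))" by (rule finite_vimageI[OF _ \<pi>(1)])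
      ultimately have "finite {j. \<not> r \<le> norm (fst ((pc \<circ> \<pi>) j))}" by (rule finite_subset)
      then show "\<forall>\<^sub>F j in sequentially. r \<le> norm (fst ((pc \<circ> \<pi>) j))"
        by (simp add: eventually_cofinite flip: cofinite_eq_sequentially)
    qed
  qed
qed

section \<open>Monotonicity of site percolation\<close>

lemma emeasure_bernoulli_pmf:
  assumes "0 \<le> p" "p \<le> 1"
  shows "emeasure (measure_pmf (bernoulli_pmf p)) F = ennreal (p * of_bool (True \<in> F) + (1 - p) * of_bool (False \<in> F))"
proof -
  have "emeasure (measure_pmf (bernoulli_pmf p)) F = ennreal (\<Sum>x\<in>F. pmf (bernoulli_pmf p) x)"
    by (simp add: measure_pmf.emeasure_eq_measure measure_measure_pmf_finite)
  also have "(\<Sum>x\<in>F. pmf (bernoulli_pmf p) x) = (\<Sum>x\<in>UNIV. pmf (bernoulli_pmf p) x * of_bool (x \<in> F))"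
    by (rule sum.mono_neutral_cong_left) auto
  also have "\<dots> = p * of_bool (True \<in> F) + (1 - p) * of_bool (False \<in> F)"
    using assms by (simp add: UNIV_bool)
  finally show ?thesis .
qed

text \<open>Thinning \<open>Z\<close> by an independent Bernoulli field of density \<open>p / q\<close> produces density \<open>p\<close>.\<close>

lemma (in prob_space) AE_increasing_event_of_indep:
  fixes Z :: "'i \<Rightarrow> 'a \<Rightarrow> bool"
  assumes indep: "indep_vars (\<lambda>_. count_space UNIV) Z UNIV"
    and q: "\<And>z. prob {\<omega>\<in>space M. Z z \<omega>} = q"
    and p: "0 \<le> p" "p \<le> q" "0 < q"
    and E: "AE f in PiM UNIV (\<lambda>_::'i. measure_pmf (bernoulli_pmf p)). E f"
    and mono: "\<And>f g. E f \<Longrightarrow> (\<And>z. f z \<Longrightarrow> g z) \<Longrightarrow> E g"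
  shows "AE \<omega> in M. E (\<lambda>z. Z z \<omega>)"
proof -
  have q1: "q \<le> 1" using q by (metis prob_le_1)
  define r where "r = p / q"
  have r: "0 \<le> r" "r \<le> 1" "r * q = p" using p by (auto simp: r_def)
  let ?N = "PiM UNIV (\<lambda>_::'i. measure_pmf (bernoulli_pmf r))"
  let ?P = "PiM UNIV (\<lambda>_::'i. measure_pmf (bernoulli_pmf p))"
  let ?T = "\<lambda>(\<omega>, f) z. Z z \<omega> \<and> f z"
  interpret N: product_prob_space "\<lambda>_::'i. measure_pmf (bernoulli_pmf r)" UNIV
    by unfold_locales
  interpret P: product_prob_space "\<lambda>_::'i. measure_pmf (bernoulli_pmf p)" UNIV
    by unfold_locales
  interpret PP: pair_prob_space M ?N ..
  have Zm[measurable]: "Z z \<in> M \<rightarrow>\<^sub>M count_space UNIV" for z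
    using indep unfolding indep_vars_def by auto
  have comp[measurable]: "(\<lambda>f. f z) \<in> ?N \<rightarrow>\<^sub>M count_space UNIV" for z
    using measurable_component_singleton[of z UNIV "\<lambda>_. measure_pmf (bernoulli_pmf r)"]
    by (simp cong: measurable_cong_sets)
  have Tz: "(\<lambda>x. Z z (fst x) \<and> snd x z) \<in> M \<Otimes>\<^sub>M ?N \<rightarrow>\<^sub>M count_space UNIV" for z
    by measurable
  have Tm: "?T \<in> M \<Otimes>\<^sub>M ?N \<rightarrow>\<^sub>M ?P"
    by (rule measurable_PiM_single')
      (use Tz in \<open>simp_all add: case_prod_beta' cong: measurable_cong_sets\<close>)
  have "distr (M \<Otimes>\<^sub>M ?N) ?P ?T = ?P"
  proof (rule P.PiM_eq)
    fix J :: "'i set" and F :: "'i \<Rightarrow> bool set"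
    assume J: "finite J" and "\<And>j. j \<in> J \<Longrightarrow> F j \<in> sets (measure_pmf (bernoulli_pmf p))"
    \<comment> \<open>The probability over the thinning variable that the thinned site lies in
      \<open>F j\<close>, given that \<open>Z j\<close> has the value \<open>b\<close>: with
      probability \<open>r\<close> the value is kept, otherwise it becomes False.\<close>
    define e where "e j b = r * of_bool (b \<in> F j) + (1 - r) * of_bool (False \<in> F j)" for j b
    have e0: "0 \<le> e j b" for j b using r by (simp add: e_def)
    let ?X = "prod_emb UNIV (\<lambda>_. measure_pmf (bernoulli_pmf p)) J (PiE J F)"
    have Xs: "?X \<in> sets ?P" using J by (intro sets_PiM_I) auto
    let ?S = "?T -` ?X \<inter> space (M \<Otimes>\<^sub>M ?N)"
    have S: "?S \<in> sets (M \<Otimes>\<^sub>M ?N)" using Tm Xs by (rule measurable_sets)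
    have "emeasure (distr (M \<Otimes>\<^sub>M ?N) ?P ?T) ?X = emeasure (M \<Otimes>\<^sub>M ?N) ?S"
      using Tm Xs by (rule emeasure_distr)
    also have "\<dots> = (\<integral>\<^sup>+\<omega>. emeasure ?N (Pair \<omega> -` ?S) \<partial>M)"
      using S by (rule N.emeasure_pair_measure_alt)
    also have "\<dots> = (\<integral>\<^sup>+\<omega>. (\<Prod>j\<in>J. ennreal (e j (Z j \<omega>))) \<partial>M)"
    proof (rule nn_integral_cong)
      fix \<omega> assume \<omega>: "\<omega> \<in> space M"
      have "Pair \<omega> -` ?S = {f \<in> space ?N. \<forall>j\<in>J. f j \<in> {b. (Z j \<omega> \<and> b) \<in> F j}}"
        using \<omega> by (auto simp: prod_emb_def space_pair_measure space_PiM PiE_iff)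
      then have "emeasure ?N (Pair \<omega> -` ?S) =
          (\<Prod>j\<in>J. emeasure (measure_pmf (bernoulli_pmf r)) {b. (Z j \<omega> \<and> b) \<in> F j})"
        using N.emeasure_PiM_Collect[of J "\<lambda>j. {b. (Z j \<omega> \<and> b) \<in> F j}"] J by simp
      also have "\<dots> = (\<Prod>j\<in>J. ennreal (e j (Z j \<omega>)))"
        using r by (intro prod.cong) (auto simp: emeasure_bernoulli_pmf e_def)
      finally show "emeasure ?N (Pair \<omega> -` ?S) = (\<Prod>j\<in>J. ennreal (e j (Z j \<omega>)))" .
    qed
    also have "\<dots> = (\<Prod>j\<in>J. \<integral>\<^sup>+\<omega>. ennreal (e j (Z j \<omega>)) \<partial>M)"
    proof (rule indep_vars_nn_integral[OF J])
      show "indep_vars (\<lambda>_. borel) (\<lambda>j \<omega>. ennreal (e j (Z j \<omega>))) J"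
        using indep_vars_compose2[OF indep_vars_subset[OF indep subset_UNIV], of J "\<lambda>j b. ennreal (e j b)" "\<lambda>_. borel"]
        by simp
    qed simp
    also have "\<dots> = (\<Prod>j\<in>J. emeasure (measure_pmf (bernoulli_pmf p)) (F j))"
    proof (rule prod.cong[OF refl])
      fix j
      have neg: "prob {\<omega>\<in>space M. \<not> Z j \<omega>} = 1 - q" using prob_neg[of "Z j"] q[of j] by simp
      have "(\<integral>\<^sup>+\<omega>. ennreal (e j (Z j \<omega>)) \<partial>M) = (\<integral>\<^sup>+\<omega>. ennreal (e j True) * indicator {\<omega>\<in>space M. Z j \<omega>} \<omega>
          + ennreal (e j False) * indicator {\<omega>\<in>space M. \<not> Z j \<omega>} \<omega> \<partial>M)"
        by (intro nn_integral_cong) (auto simp: indicator_def)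
      also have "\<dots> = ennreal (e j True) * emeasure M {\<omega>\<in>space M. Z j \<omega>}
          + ennreal (e j False) * emeasure M {\<omega>\<in>space M. \<not> Z j \<omega>}"
        by (subst nn_integral_add) (auto simp: nn_integral_cmult_indicator)
      also have "\<dots> = ennreal (e j True * q + e j False * (1 - q))"
        using p q1 e0 by (simp add: emeasure_eq_measure q neg ennreal_mult ennreal_plus)
      also have "e j True * q + e j False * (1 - q) = p * of_bool (True \<in> F j) + (1 - p) * of_bool (False \<in> F j)"
        using r(3) by (auto simp: e_def algebra_simps of_bool_def)
      finally show "(\<integral>\<^sup>+\<omega>. ennreal (e j (Z j \<omega>)) \<partial>M) = emeasure (measure_pmf (bernoulli_pmf p)) (F j)"
        using p q1 by (simp add: emeasure_bernoulli_pmf)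
    qed
    finally show "emeasure (distr (M \<Otimes>\<^sub>M ?N) ?P ?T) ?X =
        (\<Prod>j\<in>J. emeasure (measure_pmf (bernoulli_pmf p)) (F j))" .
  qed simp
  then have "AE x in distr (M \<Otimes>\<^sub>M ?N) ?P ?T. E x" using E by (simp only:)
  then have "AE x in M \<Otimes>\<^sub>M ?N. E (?T x)" by (rule AE_distrD[OF Tm])
  then have "AE \<omega> in M. AE f in ?N. E (?T (\<omega>, f))" by (rule PP.AE_pair)
  then show ?thesis
  proof (rule AE_mp, intro AE_I2 impI)
    \<comment> \<open>The thinned configuration is below \<open>Z\<close>, so the increasing event
      holds for \<open>Z\<close> itself; the dependence on \<open>f\<close> disappears and so does
      the inner almost sure quantifier.\<close>
    fix \<omega> assume "AE f in ?N. E (?T (\<omega>, f))"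
    then have "AE f in ?N. E (\<lambda>z. Z z \<omega>)" 
    proof (rule eventually_mono)
      fix f assume "E (?T (\<omega>, f))"
      then show "E (\<lambda>z. Z z \<omega>)" by (rule mono) simp
    qed
    then show "E (\<lambda>z. Z z \<omega>)" by simp
  qed
qed

text \<open>An infimum yields an element below \<open>q\<close> only if the set is nonempty. Density
  1 belongs to it: there all sites are open almost surely, and a coordinate ray is an infinite
  connected set.\<close>

lemma site_threshold_lessE:
  assumes "site_threshold TYPE('D::finite) < q"
  obtains p where "0 \<le> p" "p < q" "AE \<omega> in site_measure p.
     \<exists>C :: (int ^ 'D) set. infinite C \<and> connected_sites C \<and> (\<forall>x\<in>C. \<omega> x)"
proof -
  let ?perc = "\<lambda>p. AE \<omega> in site_measure p.
     \<exists>C :: (int ^ 'D) set. infinite C \<and> connected_sites C \<and> (\<forall>x\<in>C. \<omega> x)"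
  let ?S = "{p \<in> {0..1}. ?perc p}"
  have one: "1 \<in> ?S"
  proof -
    obtain i :: 'D where True by simp
    define l :: "nat \<Rightarrow> int ^ 'D" where "l m = axis i (int m)" for m
    have adj: "adjacent (l m) (l (Suc m)) \<and> adjacent (l (Suc m)) (l m)" for m
    proof -
      have "\<bar>l m $ j - l (Suc m) $ j\<bar> = (if j = i then 1 else 0)"
        "\<bar>l (Suc m) $ j - l m $ j\<bar> = (if j = i then 1 else 0)" for j
        by (auto simp: l_def axis_def)
      then show ?thesis by (simp add: adjacent_def)
    qed
    let ?E = "{(a, b). a \<in> range l \<and> b \<in> range l \<and> adjacent a b}"
    have st: "(l m, l (Suc m)) \<in> ?E" "(l (Suc m), l m) \<in> ?E" for m using adj by auto
    have "(l 0, l m) \<in> ?E\<^sup>* \<and> (l m, l 0) \<in> ?E\<^sup>*" for m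
      by (induction m) (use st in \<open>auto intro: rtrancl_into_rtrancl converse_rtrancl_into_rtrancl\<close>)
    then have "connected_sites (range l)"
      unfolding connected_sites_def by (blast intro: rtrancl_trans)
    moreover have "inj l"
    proof (rule injI)
      fix m m' assume "l m = l m'"
      then have "l m $ i = l m' $ i" by simp
      then show "m = m'" by (simp add: l_def)
    qed
    then have "infinite (range l)" using finite_imageD infinite_UNIV_nat by blast
    moreover have "AE \<omega> in site_measure 1. \<forall>m. \<omega> (l m)"
      unfolding AE_all_countable site_measure_def
    proof (intro allI AE_PiM_component)
      show "AE b in measure_pmf (bernoulli_pmf 1). b"
        unfolding AE_measure_pmf_iff by (auto simp: set_pmf_iff split: if_splits) (metis diff_self order_refl pmf_bernoulli_False zero_le_one)
    qed (auto simp: measure_pmf.prob_space_axioms)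
    then have "?perc 1"
      by (rule AE_mp) (use calculation in \<open>auto intro!: AE_I2 exI[of _ "range l"]\<close>)
    then show ?thesis by simp
  qed
  obtain p where "p \<in> ?S" "p < q"
    using cInf_lessD[of ?S q] one assms unfolding site_threshold_def by blast
  then show thesis by (intro that[of p]) auto
qed

section \<open>Measurability of branching\<close>

text \<open>Local compactness supplies regularity: the image of a small closed ball of a chart is
  compact, hence closed because the space is Hausdorff, and it contains the open image of the open
  ball.\<close>

lemma smooth_atlas_regular:
  fixes \<A> :: "('m::{t2_space, second_countable_topology}, 'd::finite) chart set" and x :: 'm
  assumes "smooth_atlas \<A>" "open U" "x \<in> U"
  shows "\<exists>V. open V \<and> x \<in> V \<and> closure V \<subseteq> U"
proof -
  have "x \<in> (\<Union>c\<in>\<A>. fst c)" using assms(1) by (simp add: smooth_atlas_def)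
  then obtain c where c: "c \<in> \<A>" "x \<in> fst c" by blast
  then have dom: "open (fst c)" "open (snd c ` fst c)"
    and hom: "homeomorphism (fst c) (snd c ` fst c) (snd c) (chart_inv c)"
    using assms(1) by (auto simp: smooth_atlas_def)
  let ?\<phi> = "snd c" and ?\<psi> = "chart_inv c" and ?O = "snd c ` fst c"
  have "openin (top_of_set (fst c)) (U \<inter> fst c)"
    using openin_open_Int[OF assms(2), of "fst c"] by (simp add: Int_commute)
  then have "openin (top_of_set ?O) (?\<phi> ` (U \<inter> fst c))"
    by (rule homeomorphism_imp_open_map[OF hom])
  then have "open (?\<phi> ` (U \<inter> fst c))" using dom(2) by (simp add: openin_open_eq)
  then obtain e where e: "e > 0" "cball (?\<phi> x) e \<subseteq> ?\<phi> ` (U \<inter> fst c)"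
    using c assms(3) open_contains_cball by (metis IntI image_eqI)
  have cO: "cball (?\<phi> x) e \<subseteq> ?O" using e by blast
  have inv: "?\<psi> (?\<phi> y) = y" if "y \<in> fst c" for y using hom that by (auto simp: homeomorphism_def)
  have K: "?\<psi> ` cball (?\<phi> x) e \<subseteq> U"
  proof
    fix y assume "y \<in> ?\<psi> ` cball (?\<phi> x) e"
    then obtain u where "u \<in> U \<inter> fst c" "y = ?\<psi> (?\<phi> u)" using e(2) by blast
    then show "y \<in> U" using inv by simp
  qed
  have "continuous_on (cball (?\<phi> x) e) ?\<psi>"
    using hom cO by (auto simp: homeomorphism_def intro: continuous_on_subset)
  then have "compact (?\<psi> ` cball (?\<phi> x) e)" by (rule compact_continuous_image) simp
  then have clK: "closed (?\<psi> ` cball (?\<phi> x) e)" by (rule compact_imp_closed)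
  have "openin (top_of_set ?O) (ball (?\<phi> x) e)"
    using cO ball_subset_cball by (metis dom(2) dual_order.trans open_ball openin_open_eq)
  then have "openin (top_of_set (fst c)) (?\<psi> ` ball (?\<phi> x) e)"
    using homeomorphism_imp_open_map[OF homeomorphism_symD[OF hom]] by simp
  then have "open (?\<psi> ` ball (?\<phi> x) e)" using dom(1) by (simp add: openin_open_eq)
  moreover have "x \<in> ?\<psi> ` ball (?\<phi> x) e" using e(1) inv[OF c(2)] by (metis centre_in_ball image_eqI)
  moreover have "closure (?\<psi> ` ball (?\<phi> x) e) \<subseteq> U"
    using closure_minimal[OF image_mono[OF ball_subset_cball] clK] K by blast
  ultimately show ?thesis by blast
qed

lemma smooth_fun_on_continuous:
  assumes "smooth_atlas \<A>" "smooth_fun_on \<A> S f" "open S"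
  shows "continuous_on S f"
proof -
  have c: "continuous_on (fst c \<inter> S) f" and o: "open (fst c \<inter> S)" if "c \<in> \<A>" for c
  proof -
    have hom: "homeomorphism (fst c) (snd c ` fst c) (snd c) (chart_inv c)" and "open (fst c)"
      using assms(1) that by (auto simp: smooth_atlas_def)
    then show "open (fst c \<inter> S)" using assms(3) by blast
    have "Ck_on 0 (snd c ` (fst c \<inter> S)) (f \<circ> chart_inv c)"
      using assms(2) that unfolding smooth_fun_on_def smooth_on_def by blast
    then have "continuous_on (snd c ` (fst c \<inter> S)) (f \<circ> chart_inv c)" by simp
    moreover have "continuous_on (fst c \<inter> S) (snd c)"
      using hom by (auto simp: homeomorphism_def intro: continuous_on_subset)
    ultimately have "continuous_on (fst c \<inter> S) ((f \<circ> chart_inv c) \<circ> snd c)"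
      by (rule continuous_on_compose[rotated])
    then show "continuous_on (fst c \<inter> S) f"
      by (rule continuous_on_eq) (use hom in \<open>auto simp: homeomorphism_def\<close>)
  qed
  have "continuous_on (\<Union>c\<in>\<A>. fst c \<inter> S) f"
    by (rule continuous_on_open_UN) (use c o in auto)
  moreover have "(\<Union>c\<in>\<A>. fst c \<inter> S) = S" using assms(1) by (auto simp: smooth_atlas_def)
  ultimately show ?thesis by simp
qed

text \<open>The limit lies in an open \<open>U\<close> iff the sequence is eventually in some basic
  open set whose closure is contained in \<open>U\<close>. Regularity gives one direction,
  closedness of the closure the other, and a countable base makes the union countable.\<close>

lemma borel_measurable_LIMSEQ_regular:
  fixes f :: "nat \<Rightarrow> 'a \<Rightarrow> 'b::second_countable_topology"
  assumes regular: "\<And>U x::'b. open U \<Longrightarrow> x \<in> U \<Longrightarrow> \<exists>V. open V \<and> x \<in> V \<and> closure V \<subseteq> U"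
    and f: "\<And>i. f i \<in> borel_measurable M"
    and lim: "\<And>x. x \<in> space M \<Longrightarrow> (\<lambda>i. f i x) \<longlonglongrightarrow> g x"
  shows "g \<in> borel_measurable M"
proof (rule borel_measurableI)
  fix U :: "'b set" assume U: "open U"
  obtain B :: "'b set set" where B: "countable B" "topological_basis B" using ex_countable_basis by blast
  let ?B = "{V \<in> B. closure V \<subseteq> U}"
  have "g -` U \<inter> space M = (\<Union>V\<in>?B. {x\<in>space M. \<exists>i0. \<forall>i\<ge>i0. f i x \<in> V})"
  proof (intro equalityI subsetI)
    fix x assume x: "x \<in> g -` U \<inter> space M"
    then obtain V where V: "open V" "g x \<in> V" "closure V \<subseteq> U" using regular[OF U] by auto
    then obtain W where W: "W \<in> B" "g x \<in> W" "W \<subseteq> V"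
      using B(2) topological_basisE by metis
    have "closure W \<subseteq> U" using W V closure_mono by blast
    moreover have "\<forall>\<^sub>F i in sequentially. f i x \<in> W"
      using lim[of x] x W(2) topological_basis_open[OF B(2) W(1)] by (auto dest: topological_tendstoD)
    ultimately show "x \<in> (\<Union>V\<in>?B. {x\<in>space M. \<exists>i0. \<forall>i\<ge>i0. f i x \<in> V})"
      using x W by (auto simp: eventually_sequentially)
  next
    fix x assume "x \<in> (\<Union>V\<in>?B. {x\<in>space M. \<exists>i0. \<forall>i\<ge>i0. f i x \<in> V})"
    then obtain V where V: "x \<in> space M" "closure V \<subseteq> U" "\<forall>\<^sub>F i in sequentially. f i x \<in> V"
      by (auto simp: eventually_sequentially)
    have "g x \<in> closure V"
      by (rule Lim_in_closed_set[OF closed_closure _ _ lim[OF V(1)]])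
        (use V(3) closure_subset in \<open>auto elim!: eventually_mono\<close>)
    then show "x \<in> g -` U \<inter> space M" using V by auto
  qed
  also have "\<dots> \<in> sets M"
  proof (rule sets.countable_UN'')
    show "countable ?B" using B(1) by (rule countable_subset[rotated]) auto
    fix V assume "V \<in> ?B"
    then have [measurable]: "V \<in> sets borel" using topological_basis_open[OF B(2)] by auto
    note f[measurable]
    show "{x\<in>space M. \<exists>i0. \<forall>i\<ge>i0. f i x \<in> V} \<in> sets M" by measurable
  qed
  finally show "g -` U \<inter> space M \<in> sets M" .
qed

locale killed_paths =
  fixes \<Gamma> :: "'m::{t2_space, second_countable_topology} set" and n :: "'m \<Rightarrow> real"
  assumes closed: "closed \<Gamma>"
    and regular: "\<And>U x::'m. open U \<Longrightarrow> x \<in> U \<Longrightarrow> \<exists>V. open V \<and> x \<in> V \<and> closure V \<subseteq> U"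
    and rate_continuous: "continuous_on (- \<Gamma>) n"
    and rate_pos: "\<And>x. x \<notin> \<Gamma> \<Longrightarrow> 0 < n x"
begin

lemma space_path_space:
  "w \<in> space (path_space \<Gamma>) \<longleftrightarrow> w \<in> extensional {0..} \<and> continuous_on {0..} w \<and>
     (\<forall>s t. 0 \<le> s \<and> s \<le> t \<and> w s \<in> \<Gamma> \<longrightarrow> w t = w s)"
  by (auto simp: path_space_def space_restrict_space space_PiM PiE_def)

lemma path_continuous: "w \<in> space (path_space \<Gamma>) \<Longrightarrow> continuous_on {0..} w"
  by (simp add: space_path_space)

lemma path_absorbed: "w \<in> space (path_space \<Gamma>) \<Longrightarrow> 0 \<le> s \<Longrightarrow> s \<le> t \<Longrightarrow> w s \<in> \<Gamma> \<Longrightarrow> w t \<in> \<Gamma>"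
  by (fastforce simp: space_path_space)

lemma measurable_path_at [measurable (raw)]:
  assumes "0 \<le> t" shows "(\<lambda>w. w t) \<in> path_space \<Gamma> \<rightarrow>\<^sub>M borel"
  unfolding path_space_def using assms
  by (intro measurable_restrict_space1 measurable_component_singleton) simp

text \<open>Rounding the time up to the grid of mesh 1 / \<open>Suc i\<close> leaves countably many
  evaluations; path continuity then lets the mesh tend to 0. The \<open>max\<close> keeps the time
  in the half-line on which paths live.\<close>

lemma measurable_path_eval [measurable]:
  "(\<lambda>(w, t). w (max 0 t)) \<in> path_space \<Gamma> \<Otimes>\<^sub>M borel \<rightarrow>\<^sub>M borel"
proof (rule borel_measurable_LIMSEQ_regular[OF regular])
  fix i :: nat
  show "(\<lambda>(w, t). w (real (nat \<lceil>max 0 t * real (Suc i)\<rceil>) / real (Suc i))) \<in> path_space \<Gamma> \<Otimes>\<^sub>M borel \<rightarrow>\<^sub>M borel"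
    unfolding case_prod_beta'
  proof (rule measurable_compose_countable[where g = "\<lambda>x. nat \<lceil>max 0 (snd x) * real (Suc i)\<rceil>"])
    fix j :: nat
    show "(\<lambda>x. fst x (real j / real (Suc i))) \<in> path_space \<Gamma> \<Otimes>\<^sub>M borel \<rightarrow>\<^sub>M borel"
      by (rule measurable_compose[OF measurable_fst measurable_path_at]) simp
  qed measurable
next
  fix x assume "x \<in> space (path_space \<Gamma> \<Otimes>\<^sub>M (borel :: real measure))"
  then obtain w t where x: "x = (w, t)" "w \<in> space (path_space \<Gamma>)" by (auto simp: space_pair_measure)
  define u where "u = max 0 t"
  let ?a = "\<lambda>i. real (nat \<lceil>u * real (Suc i)\<rceil>) / real (Suc i)"
  have u: "u \<ge> 0" by (simp add: u_def)
  have bound: "u \<le> ?a i \<and> ?a i \<le> u + 1 / real (Suc i)" for i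
  proof -
    have "real (nat \<lceil>u * real (Suc i)\<rceil>) = of_int \<lceil>u * real (Suc i)\<rceil>" using u by simp
    then have "u * real (Suc i) \<le> real (nat \<lceil>u * real (Suc i)\<rceil>)"
      "real (nat \<lceil>u * real (Suc i)\<rceil>) \<le> u * real (Suc i) + 1"
      by linarith+
    then show ?thesis by (simp add: field_simps del: of_nat_Suc)
  qed
  have "(\<lambda>i. u + 1 / real (Suc i)) \<longlonglongrightarrow> u + 0"
    by (intro tendsto_intros LIMSEQ_inverse_real_of_nat[unfolded inverse_eq_divide])
  then have "?a \<longlonglongrightarrow> u"
    using bound by (intro real_tendsto_sandwich[of "\<lambda>_. u" ?a _ "\<lambda>i. u + 1 / real (Suc i)"]) auto
  moreover have "\<forall>i. ?a i \<in> {0..}" by simp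
  ultimately have "(\<lambda>i. w (?a i)) \<longlonglongrightarrow> w u"
    using path_continuous[OF x(2)] u unfolding continuous_on_sequentially
    by (simp add: comp_def del: of_nat_Suc)
  then show "(\<lambda>i. (\<lambda>(w, t). w (real (nat \<lceil>max 0 t * real (Suc i)\<rceil>) / real (Suc i))) x)
      \<longlonglongrightarrow> (\<lambda>(w, t). w (max 0 t)) x"
    by (simp add: x(1) u_def)
qed

section \<open>The accumulated rate along a path and the branching time\<close>

definition clock :: "(real \<Rightarrow> 'm) \<Rightarrow> real \<Rightarrow> ennreal" where
  "clock w t = (\<integral>\<^sup>+s\<in>{0..t}. ennreal (n (w s)) \<partial>lborel)"

lemma branch_times_eq:
  "branch_times \<Gamma> n \<xi> = {t. 0 \<le> t \<and> fst \<xi> t \<notin> \<Gamma> \<and> clock (fst \<xi>) t = ennreal (snd \<xi>)}"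
  by (simp add: branch_times_def clock_def)

lemma rate_along_path:
  assumes w: "w \<in> space (path_space \<Gamma>)" and t: "w t \<notin> \<Gamma>"
  shows "continuous_on {0..t} (\<lambda>s. n (w s))" and "\<And>s. s \<in> {0..t} \<Longrightarrow> 0 < n (w s)"
proof -
  have free: "w s \<notin> \<Gamma>" if "s \<in> {0..t}" for s using path_absorbed[OF w, of s t] that t by auto
  then show "\<And>s. s \<in> {0..t} \<Longrightarrow> 0 < n (w s)" using rate_pos by blast
  have "continuous_on {0..t} (n \<circ> w)"
    by (intro continuous_on_compose continuous_on_subset[OF path_continuous[OF w]]
        continuous_on_subset[OF rate_continuous]) (use free in auto)
  then show "continuous_on {0..t} (\<lambda>s. n (w s))" by (simp add: comp_def)
qed

text \<open>Up to a time at which the path is still off \<open>\<Gamma>\<close> the rate is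
  continuous, so the clock is finite and calculus applies. On \<open>\<Gamma>\<close> the values of
  \<open>n\<close> are arbitrary, hence the restriction.\<close>

lemma clock_eq_integral:
  assumes w: "w \<in> space (path_space \<Gamma>)" and t: "w t \<notin> \<Gamma>" and s: "s \<le> t"
  shows "clock w s = ennreal (integral {0..s} (\<lambda>s. n (w s)))" "0 \<le> integral {0..s} (\<lambda>s. n (w s))"
proof -
  have "continuous_on {0..s} (\<lambda>s. n (w s))"
    using rate_along_path(1)[OF w t] by (rule continuous_on_subset) (use s in auto)
  then have int: "(\<lambda>s. n (w s)) integrable_on {0..s}" by (rule integrable_continuous_real)
  then have "((\<lambda>s. n (w s)) has_integral integral {0..s} (\<lambda>s. n (w s))) {0..s}"
    by (rule integrable_integral)
  then show "clock w s = ennreal (integral {0..s} (\<lambda>s. n (w s)))"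
    unfolding clock_def by (rule nn_integral_has_integral_lebesgue'[rotated])
      (use rate_along_path(2)[OF w t] s in \<open>auto intro: less_imp_le\<close>)
  show "0 \<le> integral {0..s} (\<lambda>s. n (w s))"
    by (rule integral_nonneg[OF int]) (use rate_along_path(2)[OF w t] s in \<open>auto intro: less_imp_le\<close>)
qed

lemma clock_strict_mono:
  assumes w: "w \<in> space (path_space \<Gamma>)" and t: "w t \<notin> \<Gamma>" and s: "0 \<le> s" "s < t"
  shows "clock w s < clock w t"
proof -
  note r = rate_along_path[OF w t]
  let ?f = "\<lambda>s. n (w s)"
  have "integral {0..s} ?f + integral {s..t} ?f = integral {0..t} ?f"
    using s r(1) by (intro Henstock_Kurzweil_Integration.integral_combine integrable_continuous_real) auto
  moreover have "continuous_on {s..t} ?f" using r(1) by (rule continuous_on_subset) (use s in auto)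
  then have "integral {s..t} (\<lambda>_. 0) < integral {s..t} ?f"
    using s r(2) by (intro integral_less_real) auto
  ultimately have "integral {0..s} ?f < integral {0..t} ?f" by simp
  then show ?thesis using clock_eq_integral[OF w t] s by (simp add: ennreal_less_iff)
qed

lemma clock_attains:
  assumes w: "w \<in> space (path_space \<Gamma>)" and t: "w t \<notin> \<Gamma>" "0 \<le> t" and e: "ennreal e \<le> clock w t"
  shows "\<exists>s\<in>{0..t}. w s \<notin> \<Gamma> \<and> clock w s = ennreal e"
proof -
  let ?f = "\<lambda>s. n (w s)"
  have c: "continuous_on {0..t} (\<lambda>x. integral {0..x} ?f)"
    by (intro indefinite_integral_continuous_1 integrable_continuous_real rate_along_path(1)[OF w t(1)])
  \<comment> \<open>Negative thresholds are sent to 0 by \<open>ennreal\<close>; the intermediate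
    value theorem is applied to the truncated level.\<close>
  have "ennreal (max 0 e) = ennreal e" by (cases "0 \<le> e") (simp_all add: max_def ennreal_neg)
  then have "ennreal (max 0 e) \<le> ennreal (integral {0..t} ?f)"
    using e clock_eq_integral(1)[OF w t(1), of t] by simp
  then have "max 0 e \<le> integral {0..t} ?f"
    using clock_eq_integral(2)[OF w t(1), of t] by (subst (asm) ennreal_le_iff) auto
  then obtain s where s: "0 \<le> s" "s \<le> t" "integral {0..s} ?f = max 0 e"
    using IVT'[of "\<lambda>x. integral {0..x} ?f" 0 "max 0 e" t] c t(2) by auto
  then have "clock w s = ennreal (max 0 e)" using clock_eq_integral(1)[OF w t(1) s(2)] by simp
  moreover have "w s \<notin> \<Gamma>" using path_absorbed[OF w s(1,2)] t by blast
  ultimately show ?thesis using s(1,2) \<open>ennreal (max 0 e) = ennreal e\<close> by auto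
qed

lemma clock_mono: "s \<le> t \<Longrightarrow> clock w s \<le> clock w t"
  unfolding clock_def by (intro nn_integral_mono) (auto simp: indicator_def)

lemma branch_times_unique:
  assumes w: "fst \<xi> \<in> space (path_space \<Gamma>)" and "s \<in> branch_times \<Gamma> n \<xi>" "t \<in> branch_times \<Gamma> n \<xi>"
  shows "s = t"
proof (rule ccontr)
  assume "s \<noteq> t"
  then consider "s < t" | "t < s" by linarith
  then show False
    using clock_strict_mono[OF w, of t s] clock_strict_mono[OF w, of s t] assms(2,3)
    by cases (auto simp: branch_times_eq)
qed

lemma branch_time_eqI:
  assumes "fst \<xi> \<in> space (path_space \<Gamma>)" "t \<in> branch_times \<Gamma> n \<xi>"
  shows "branch_time \<Gamma> n \<xi> = t"
proof -
  have "branch_times \<Gamma> n \<xi> = {t}" using branch_times_unique[OF assms(1)] assms(2) by blast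
  then show ?thesis by (simp add: branch_time_def)
qed

lemma branch_time_in:
  assumes "fst \<xi> \<in> space (path_space \<Gamma>)" "branches \<Gamma> n \<xi>"
  shows "branch_time \<Gamma> n \<xi> \<in> branch_times \<Gamma> n \<xi>"
  using assms branch_time_eqI unfolding branches_def by fastforce

lemma branch_point_notin:
  assumes "fst \<xi> \<in> space (path_space \<Gamma>)" "branches \<Gamma> n \<xi>"
  shows "branch_point \<Gamma> n \<xi> \<notin> \<Gamma>"
  using branch_time_in[OF assms] by (simp add: branch_point_def branch_times_eq)

text \<open>Reduces the existence of a branching time to countably many times. Being off
  \<open>\<Gamma>\<close> is an open condition along the path, so it persists at some rational time
  just after branching; conversely a clock that has passed the threshold off \<open>\<Gamma>\<close>
  attained it earlier.\<close>

lemma branches_iff: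
  assumes w: "fst \<xi> \<in> space (path_space \<Gamma>)"
  shows "branches \<Gamma> n \<xi> \<longleftrightarrow>
    (\<exists>i::nat. \<exists>j::nat. fst \<xi> (real i / real (Suc j)) \<notin> \<Gamma> \<and> ennreal (snd \<xi>) \<le> clock (fst \<xi>) (real i / real (Suc j)))"
proof
  assume "branches \<Gamma> n \<xi>"
  then obtain t where t: "0 \<le> t" "fst \<xi> t \<notin> \<Gamma>" "clock (fst \<xi>) t = ennreal (snd \<xi>)"
    by (auto simp: branches_def branch_times_eq)
  obtain A where A: "open A" "A \<inter> {0..} = fst \<xi> -` (- \<Gamma>) \<inter> {0..}"
    using path_continuous[OF w] closed unfolding continuous_on_open_invariant
    by (metis open_Compl)
  then have "t \<in> A" using t by blast
  then obtain d where d: "d > 0" "\<And>u. \<bar>u - t\<bar> < d \<Longrightarrow> u \<in> A"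
    using A(1) by (metis open_real)
  obtain j :: nat where j: "inverse (real (Suc j)) < d" using reals_Archimedean d(1) by blast
  define i where "i = nat \<lceil>t * real (Suc j)\<rceil>"
  have "real i = of_int \<lceil>t * real (Suc j)\<rceil>" using t(1) unfolding i_def by (simp del: of_nat_Suc)
  then have b: "t * real (Suc j) \<le> real i" "real i < t * real (Suc j) + 1" by linarith+
  have "t * real (Suc j) / real (Suc j) \<le> real i / real (Suc j)"
    using b(1) by (rule divide_right_mono) simp
  moreover have "real i / real (Suc j) < (t * real (Suc j) + 1) / real (Suc j)"
    using b(2) by (rule divide_strict_right_mono) simp
  ultimately have u: "t \<le> real i / real (Suc j)" "real i / real (Suc j) - t < inverse (real (Suc j))"
    by (simp_all add: add_divide_distrib inverse_eq_divide del: of_nat_Suc)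
  then have "real i / real (Suc j) \<in> A" using j by (intro d) linarith
  then have "fst \<xi> (real i / real (Suc j)) \<notin> \<Gamma>" using A(2) by (auto simp del: of_nat_Suc)
  moreover have "ennreal (snd \<xi>) \<le> clock (fst \<xi>) (real i / real (Suc j))"
    using clock_mono[OF u(1)] t(3) by metis
  ultimately show "\<exists>i::nat. \<exists>j::nat. fst \<xi> (real i / real (Suc j)) \<notin> \<Gamma> \<and>
      ennreal (snd \<xi>) \<le> clock (fst \<xi>) (real i / real (Suc j))" by blast
next
  assume "\<exists>i::nat. \<exists>j::nat. fst \<xi> (real i / real (Suc j)) \<notin> \<Gamma> \<and>
      ennreal (snd \<xi>) \<le> clock (fst \<xi>) (real i / real (Suc j))"
  then obtain i j :: nat where "fst \<xi> (real i / real (Suc j)) \<notin> \<Gamma>"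
    "ennreal (snd \<xi>) \<le> clock (fst \<xi>) (real i / real (Suc j))" by blast
  then show "branches \<Gamma> n \<xi>"
    using clock_attains[OF w, of "real i / real (Suc j)" "snd \<xi>"]
    by (auto simp: branches_def branch_times_eq simp del: of_nat_Suc)
qed

text \<open>The path goes on after branching and may be in \<open>\<Gamma>\<close> at time
  \<open>q\<close>. Branching, if it occurs at all, must then have preceded, since it takes place
  off \<open>\<Gamma>\<close> and \<open>\<Gamma>\<close> is never left.\<close>

lemma branch_time_le_iff:
  assumes w: "fst \<xi> \<in> space (path_space \<Gamma>)" and br: "branches \<Gamma> n \<xi>" and q: "0 \<le> q"
  shows "branch_time \<Gamma> n \<xi> \<le> q \<longleftrightarrow> fst \<xi> q \<in> \<Gamma> \<or> ennreal (snd \<xi>) \<le> clock (fst \<xi>) q"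
proof -
  define t where "t = branch_time \<Gamma> n \<xi>"
  have t: "0 \<le> t" "fst \<xi> t \<notin> \<Gamma>" "clock (fst \<xi>) t = ennreal (snd \<xi>)"
    using branch_time_in[OF w br] by (auto simp: t_def branch_times_eq)
  show ?thesis
    unfolding t_def[symmetric]
  proof
    assume "t \<le> q"
    then show "fst \<xi> q \<in> \<Gamma> \<or> ennreal (snd \<xi>) \<le> clock (fst \<xi>) q" using clock_mono t(3) by metis
  next
    assume h: "fst \<xi> q \<in> \<Gamma> \<or> ennreal (snd \<xi>) \<le> clock (fst \<xi>) q"
    show "t \<le> q"
    proof (cases "fst \<xi> q \<in> \<Gamma>")
      case True
      then show ?thesis using path_absorbed[OF w q, of t] t(2) by fastforce
    next
      case False
      then obtain s where s: "s \<in> {0..q}" "fst \<xi> s \<notin> \<Gamma>" "clock (fst \<xi>) s = ennreal (snd \<xi>)"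
        using clock_attains[OF w False q] h by blast
      then have "s \<in> branch_times \<Gamma> n \<xi>" by (simp add: branch_times_eq)
      then show ?thesis using branch_time_eqI[OF w] s by (simp add: t_def)
    qed
  qed
qed

lemma borel_sets [measurable]: "\<Gamma> \<in> sets borel" "- \<Gamma> \<in> sets borel"
  using closed by auto

lemma measurable_clock_event [measurable]:
  assumes q: "0 \<le> q"
  shows "{\<xi> \<in> space (particle_space \<Gamma>). fst \<xi> q \<notin> \<Gamma> \<and> ennreal (snd \<xi>) \<le> clock (fst \<xi>) q} \<in> sets (particle_space \<Gamma>)"
proof -
  \<comment> \<open>The rate is controlled only off \<open>\<Gamma>\<close>; cutting it off makes it
    Borel on the whole manifold and changes nothing on paths that have not yet hit
    \<open>\<Gamma>\<close>.\<close>
  define r where "r x = indicator (- \<Gamma>) x * n x" for x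
  have [measurable]: "r \<in> borel_measurable borel"
    unfolding r_def using borel_measurable_continuous_on_indicator[OF _ rate_continuous] closed by simp
  define c where "c w = (\<integral>\<^sup>+s. ennreal (r (w (max 0 s))) * indicator {0..q} s \<partial>lborel)" for w
  have [measurable]: "(\<lambda>(w, s). r (w (max 0 s))) \<in> borel_measurable (path_space \<Gamma> \<Otimes>\<^sub>M lborel)"
    using measurable_compose[OF measurable_path_eval, of r borel] by (simp add: case_prod_beta')
  have [measurable]: "c \<in> borel_measurable (path_space \<Gamma>)"
    unfolding c_def by measurable
  note measurable_path_at[OF q, measurable]
  have c: "clock w q = c w" if "w \<in> space (path_space \<Gamma>)" "w q \<notin> \<Gamma>" for w
    unfolding clock_def c_def
    using path_absorbed[OF that(1), of _ q] that(2)
    by (intro nn_integral_cong) (auto simp: indicator_def r_def)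
  have "{\<xi> \<in> space (particle_space \<Gamma>). fst \<xi> q \<notin> \<Gamma> \<and> ennreal (snd \<xi>) \<le> clock (fst \<xi>) q} =
      {\<xi> \<in> space (particle_space \<Gamma>). fst \<xi> q \<notin> \<Gamma> \<and> ennreal (snd \<xi>) \<le> c (fst \<xi>)}"
    using c by (auto simp: particle_space_def space_pair_measure)
  also have "\<dots> \<in> sets (particle_space \<Gamma>)" unfolding particle_space_def by measurable
  finally show ?thesis .
qed

lemma particle_path: "\<xi> \<in> space (particle_space \<Gamma>) \<Longrightarrow> fst \<xi> \<in> space (path_space \<Gamma>)"
  by (auto simp: particle_space_def space_pair_measure)

lemma measurable_branches [measurable]: "Measurable.pred (particle_space \<Gamma>) (branches \<Gamma> n)"
proof -
  have "{\<xi> \<in> space (particle_space \<Gamma>). branches \<Gamma> n \<xi>} = (\<Union>i. \<Union>j. {\<xi> \<in> space (particle_space \<Gamma>).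
     fst \<xi> (real i / real (Suc j)) \<notin> \<Gamma> \<and> ennreal (snd \<xi>) \<le> clock (fst \<xi>) (real i / real (Suc j))})"
    using branches_iff particle_path by (auto simp del: of_nat_Suc)
  also have "\<dots> \<in> sets (particle_space \<Gamma>)"
    by (intro sets.countable_UN measurable_clock_event) auto
  finally show ?thesis by (simp add: pred_def)
qed

text \<open>Absorption is permanent, so integer times detect it.\<close>

lemma hits_iff:
  assumes "w \<in> space (path_space \<Gamma>)"
  shows "hits \<Gamma> w \<longleftrightarrow> (\<exists>i::nat. w (real i) \<in> \<Gamma>)"
proof
  assume "hits \<Gamma> w"
  then obtain t where "0 \<le> t" "w t \<in> \<Gamma>" by (auto simp: hits_def)
  then show "\<exists>i::nat. w (real i) \<in> \<Gamma>"
    using path_absorbed[OF assms, of t] real_arch_simple[of t] by blast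
next
  assume "\<exists>i::nat. w (real i) \<in> \<Gamma>"
  then show "hits \<Gamma> w" unfolding hits_def by (meson of_nat_0_le_iff)
qed

lemma measurable_absorbed [measurable]: "Measurable.pred (particle_space \<Gamma>) (absorbed \<Gamma> n)"
proof -
  have *: "(\<lambda>\<xi>. fst \<xi> (real i)) \<in> particle_space \<Gamma> \<rightarrow>\<^sub>M borel" for i :: nat
    unfolding particle_space_def by (rule measurable_compose[OF measurable_fst measurable_path_at]) simp
  note this[measurable]
  have "Measurable.pred (particle_space \<Gamma>) (\<lambda>\<xi>. (\<exists>i::nat. fst \<xi> (real i) \<in> \<Gamma>) \<and> \<not> branches \<Gamma> n \<xi>)"
    by measurable
  then show ?thesis
    by (rule measurable_cong[THEN iffD1, rotated])
      (auto simp: absorbed_def hits_iff[OF particle_path])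
qed

text \<open>The value \<open>fst \<xi> 0\<close> is a dummy that makes the map total and measurable.\<close>

definition offspring_place :: "'m particle \<Rightarrow> 'm" where
  "offspring_place \<xi> = (if branches \<Gamma> n \<xi> then branch_point \<Gamma> n \<xi> else fst \<xi> 0)"

text \<open>This is the path evaluated at the random time \<open>\<tau>\<close>, set to 0 in the
  absence of branching. The sets where \<open>\<tau>\<close> is at most \<open>q\<close> are
  described by \<open>branch_time_le_iff\<close>, and joint measurability of evaluation does the
  rest.\<close>

lemma measurable_offspring_place [measurable]: "offspring_place \<in> particle_space \<Gamma> \<rightarrow>\<^sub>M borel"
proof -
  define \<tau> where "\<tau> \<xi> = (if branches \<Gamma> n \<xi> then branch_time \<Gamma> n \<xi> else 0)" for \<xi> :: "'m particle"
  have [measurable]: "\<tau> \<in> borel_measurable (particle_space \<Gamma>)"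
  proof (rule borel_measurableI_le)
    fix q :: real
    have "\<tau> \<xi> \<le> q \<longleftrightarrow> 0 \<le> q \<and> (\<not> branches \<Gamma> n \<xi> \<or> fst \<xi> q \<in> \<Gamma> \<or> ennreal (snd \<xi>) \<le> clock (fst \<xi>) q)"
      if \<xi>: "\<xi> \<in> space (particle_space \<Gamma>)" for \<xi>
    proof (cases "branches \<Gamma> n \<xi>")
      case True
      have "0 \<le> \<tau> \<xi>"
        using branch_time_in[OF particle_path[OF \<xi>] True] True by (simp add: \<tau>_def branch_times_eq)
      then show ?thesis
        using branch_time_le_iff[OF particle_path[OF \<xi>] True, of q] True by (cases "0 \<le> q") (auto simp: \<tau>_def)
    qed (simp add: \<tau>_def)
    then have "{\<xi> \<in> space (particle_space \<Gamma>). \<tau> \<xi> \<le> q} =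
      (if q < 0 then {} else {\<xi> \<in> space (particle_space \<Gamma>). \<not> branches \<Gamma> n \<xi>} \<union>
        (space (particle_space \<Gamma>) - {\<xi> \<in> space (particle_space \<Gamma>). fst \<xi> q \<notin> \<Gamma>}) \<union>
        {\<xi> \<in> space (particle_space \<Gamma>). fst \<xi> q \<notin> \<Gamma> \<and> ennreal (snd \<xi>) \<le> clock (fst \<xi>) q})"
      by auto
    also have "\<dots> \<in> sets (particle_space \<Gamma>)"
    proof (cases "q < 0")
      case False
      then have *: "(\<lambda>\<xi>. fst \<xi> q) \<in> particle_space \<Gamma> \<rightarrow>\<^sub>M borel"
        unfolding particle_space_def by (intro measurable_compose[OF measurable_fst measurable_path_at]) simp
      note this[measurable]
      have "{\<xi> \<in> space (particle_space \<Gamma>). fst \<xi> q \<notin> \<Gamma>} \<in> sets (particle_space \<Gamma>)" by measurable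
      moreover have "{\<xi> \<in> space (particle_space \<Gamma>). \<not> branches \<Gamma> n \<xi>} \<in> sets (particle_space \<Gamma>)"
        by measurable
      ultimately show ?thesis using False measurable_clock_event[of q] by auto
    qed simp
    finally show "{\<xi> \<in> space (particle_space \<Gamma>). \<tau> \<xi> \<le> q} \<in> sets (particle_space \<Gamma>)" .
  qed
  have "(\<lambda>\<xi>. (fst \<xi>, \<tau> \<xi>)) \<in> particle_space \<Gamma> \<rightarrow>\<^sub>M path_space \<Gamma> \<Otimes>\<^sub>M borel"
    by (rule measurable_Pair) (simp_all add: particle_space_def, simp flip: particle_space_def)
  from measurable_compose[OF this measurable_path_eval]
  have "(\<lambda>\<xi>. fst \<xi> (max 0 (\<tau> \<xi>))) \<in> particle_space \<Gamma> \<rightarrow>\<^sub>M borel" by simp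
  moreover have "fst \<xi> (max 0 (\<tau> \<xi>)) = offspring_place \<xi>" if "\<xi> \<in> space (particle_space \<Gamma>)" for \<xi>
    using branch_time_in[OF particle_path[OF that]]
    by (auto simp: \<tau>_def offspring_place_def branch_point_def branch_times_eq max_def)
  ultimately show ?thesis by (simp cong: measurable_cong)
qed

end

section \<open>The branching property for subtrees\<close>

lemma of_bool_ennreal_measurable [measurable (raw)]:
  "Measurable.pred M P \<Longrightarrow> (\<lambda>x. of_bool (P x) :: ennreal) \<in> borel_measurable M"
  unfolding of_bool_def by measurable

text \<open>A monotone class argument in one random variable, everything else being frozen in the
  weights. They differ between the sides because in the application the remaining particles enter as
  sampled values on the left and as averages on the right.\<close>

lemma nn_integral_kernel_eqI:
  assumes X: "X \<in> M \<rightarrow>\<^sub>M N" and \<kappa>: "\<kappa> \<in> M \<rightarrow>\<^sub>M subprob_algebra N"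
    and R: "R1 \<in> borel_measurable M" "R2 \<in> borel_measurable M"
    and sets: "\<And>A. A \<in> sets N \<Longrightarrow>
      (\<integral>\<^sup>+\<omega>. indicator A (X \<omega>) * R1 \<omega> \<partial>M) = (\<integral>\<^sup>+\<omega>. emeasure (\<kappa> \<omega>) A * R2 \<omega> \<partial>M)"
    and \<phi>: "\<phi> \<in> borel_measurable N"
  shows "(\<integral>\<^sup>+\<omega>. \<phi> (X \<omega>) * R1 \<omega> \<partial>M) = (\<integral>\<^sup>+\<omega>. (\<integral>\<^sup>+\<xi>. \<phi> \<xi> \<partial>\<kappa> \<omega>) * R2 \<omega> \<partial>M)"
  using \<phi>
proof (induction rule: borel_measurable_induct)
  have s: "sets (\<kappa> \<omega>) = sets N" if "\<omega> \<in> space M" for \<omega>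
    using measurable_space[OF \<kappa> that] by (simp add: space_subprob_algebra)
  note [measurable] = X \<kappa> R
  note m = nn_integral_measurable_subprob_algebra[THEN measurable_compose[OF \<kappa>]]
  have \<kappa>m: "f \<in> borel_measurable (\<kappa> \<omega>)" if "\<omega> \<in> space M" "f \<in> borel_measurable N"
    for \<omega> and f :: "_ \<Rightarrow> ennreal"
    using that(2) by (simp cong: measurable_cong_sets add: s[OF that(1)])
  {
    case (cong f g)
    have "(\<integral>\<^sup>+\<omega>. f (X \<omega>) * R1 \<omega> \<partial>M) = (\<integral>\<^sup>+\<omega>. g (X \<omega>) * R1 \<omega> \<partial>M)"
      using cong(3) measurable_space[OF X] by (intro nn_integral_cong) simp
    moreover have "(\<integral>\<^sup>+\<xi>. f \<xi> \<partial>\<kappa> \<omega>) = (\<integral>\<^sup>+\<xi>. g \<xi> \<partial>\<kappa> \<omega>)" if "\<omega> \<in> space M" for \<omega>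
      using cong(3) sets_eq_imp_space_eq[OF s[OF that]] by (intro nn_integral_cong) simp
    ultimately show ?case using cong(4) by (simp cong: nn_integral_cong)
  next
    case (set A)
    show ?case using sets[OF set] s set by (simp cong: nn_integral_cong)
  next
    case (mult u c)
    note [measurable] = mult(2)
    have "(\<integral>\<^sup>+\<omega>. c * u (X \<omega>) * R1 \<omega> \<partial>M) = c * (\<integral>\<^sup>+\<omega>. u (X \<omega>) * R1 \<omega> \<partial>M)"
      by (simp add: mult.assoc nn_integral_cmult)
    also have "\<dots> = (\<integral>\<^sup>+\<omega>. c * ((\<integral>\<^sup>+\<xi>. u \<xi> \<partial>\<kappa> \<omega>) * R2 \<omega>) \<partial>M)"
      using m[OF mult(2)] by (simp add: mult nn_integral_cmult)
    also have "\<dots> = (\<integral>\<^sup>+\<omega>. (\<integral>\<^sup>+\<xi>. c * u \<xi> \<partial>\<kappa> \<omega>) * R2 \<omega> \<partial>M)"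
      by (intro nn_integral_cong) (simp add: nn_integral_cmult \<kappa>m mult mult.assoc)
    finally show ?case .
  next
    case (add u v)
    note [measurable] = add(1,3)
    have "(\<integral>\<^sup>+\<omega>. (v (X \<omega>) + u (X \<omega>)) * R1 \<omega> \<partial>M)
        = (\<integral>\<^sup>+\<omega>. v (X \<omega>) * R1 \<omega> \<partial>M) + (\<integral>\<^sup>+\<omega>. u (X \<omega>) * R1 \<omega> \<partial>M)"
      by (simp add: distrib_right nn_integral_add)
    also have "\<dots> = (\<integral>\<^sup>+\<omega>. (\<integral>\<^sup>+\<xi>. v \<xi> \<partial>\<kappa> \<omega>) * R2 \<omega> + (\<integral>\<^sup>+\<xi>. u \<xi> \<partial>\<kappa> \<omega>) * R2 \<omega> \<partial>M)"
      using m[OF add(1)] m[OF add(3)] by (simp add: add nn_integral_add)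
    also have "\<dots> = (\<integral>\<^sup>+\<omega>. (\<integral>\<^sup>+\<xi>. v \<xi> + u \<xi> \<partial>\<kappa> \<omega>) * R2 \<omega> \<partial>M)"
      by (intro nn_integral_cong) (simp add: nn_integral_add \<kappa>m add distrib_right)
    finally show ?case .
  next
    case (seq U)
    note [measurable] = seq(1)
    have inc: "mono (\<lambda>i. U i x)" for x using seq(3) by (auto simp: incseq_def le_fun_def)
    have "(\<integral>\<^sup>+\<omega>. (SUP i. U i) (X \<omega>) * R1 \<omega> \<partial>M) = (\<integral>\<^sup>+\<omega>. (SUP i. U i (X \<omega>) * R1 \<omega>) \<partial>M)"
      by (simp add: SUP_apply SUP_mult_right_ennreal image_comp)
    also have "\<dots> = (SUP i. \<integral>\<^sup>+\<omega>. U i (X \<omega>) * R1 \<omega> \<partial>M)"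
      by (rule nn_integral_monotone_convergence_SUP)
        (use inc in \<open>auto simp: incseq_def le_fun_def mono_def intro!: mult_right_mono\<close>)
    also have "\<dots> = (SUP i. \<integral>\<^sup>+\<omega>. (\<integral>\<^sup>+\<xi>. U i \<xi> \<partial>\<kappa> \<omega>) * R2 \<omega> \<partial>M)" by (simp add: seq.IH)
    also have "\<dots> = (\<integral>\<^sup>+\<omega>. (SUP i. (\<integral>\<^sup>+\<xi>. U i \<xi> \<partial>\<kappa> \<omega>) * R2 \<omega>) \<partial>M)"
      by (rule nn_integral_monotone_convergence_SUP[symmetric])
        (use inc m[OF seq(1)] in \<open>auto simp: incseq_def le_fun_def mono_def intro!: mult_right_mono nn_integral_mono\<close>)
    also have "\<dots> = (\<integral>\<^sup>+\<omega>. (\<integral>\<^sup>+\<xi>. (SUP i. U i) \<xi> \<partial>\<kappa> \<omega>) * R2 \<omega> \<partial>M)"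
    proof (rule nn_integral_cong)
      fix \<omega> assume \<omega>: "\<omega> \<in> space M"
      have "(\<integral>\<^sup>+\<xi>. (SUP i. U i \<xi>) \<partial>\<kappa> \<omega>) = (SUP i. \<integral>\<^sup>+\<xi>. U i \<xi> \<partial>\<kappa> \<omega>)"
        by (rule nn_integral_monotone_convergence_SUP[OF seq(3)]) (simp add: \<kappa>m \<omega> seq(1))
      then show "(SUP i. (\<integral>\<^sup>+\<xi>. U i \<xi> \<partial>\<kappa> \<omega>) * R2 \<omega>) = (\<integral>\<^sup>+\<xi>. (SUP i. U i) \<xi> \<partial>\<kappa> \<omega>) * R2 \<omega>"
        by (simp add: SUP_apply SUP_mult_right_ennreal image_comp)
    qed
    finally show ?case .
  }
qed

locale branching_kernel = killed_paths \<Gamma> n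
  for \<Gamma> :: "'m::{t2_space, second_countable_topology} set" and n :: "'m \<Rightarrow> real" +
  fixes \<P> :: "'m \<Rightarrow> (real \<Rightarrow> 'm) measure"
  assumes path_kernel: "\<P> \<in> borel \<rightarrow>\<^sub>M prob_algebra (path_space \<Gamma>)"
begin

lemma particle_kernel: "particle_law \<P> \<in> borel \<rightarrow>\<^sub>M prob_algebra (particle_space \<Gamma>)"
proof -
  let ?E = "density lborel (\<lambda>s. ennreal (exponential_density 1 s))"
  have "prob_space ?E" by (rule prob_space_exponential_density) simp
  then have "?E \<in> space (prob_algebra borel)" by (simp add: space_prob_algebra)
  then have "(\<lambda>_. ?E) \<in> borel \<rightarrow>\<^sub>M prob_algebra borel" by (rule measurable_const)
  then have "(\<lambda>x. \<P> x \<Otimes>\<^sub>M ?E) \<in> borel \<rightarrow>\<^sub>M prob_algebra (path_space \<Gamma> \<Otimes>\<^sub>M borel)"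
    by (rule measurable_pair_prob[OF path_kernel])
  then show ?thesis by (simp add: particle_law_def[abs_def] particle_space_def)
qed

lemma sets_particle_law [simp]: "sets (particle_law \<P> x) = sets (particle_space \<Gamma>)"
  and prob_space_particle_law: "prob_space (particle_law \<P> x)"
  using measurable_space[OF particle_kernel, of x] by (auto simp: space_prob_algebra)

lemma space_particle_law [simp]: "space (particle_law \<P> x) = space (particle_space \<Gamma>)"
  by (rule sets_eq_imp_space_eq) simp

lemma measurable_particle_law [simp]:
  "measurable (particle_law \<P> x) N = measurable (particle_space \<Gamma>) N"
  by (rule measurable_cong_sets) auto

lemma particle_subkernel [measurable]:
  "particle_law \<P> \<in> borel \<rightarrow>\<^sub>M subprob_algebra (particle_space \<Gamma>)"
  by (rule measurable_prob_algebraD[OF particle_kernel])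

lemma nn_integral_particle_law_measurable [measurable (raw)]:
  assumes "f \<in> borel_measurable (particle_space \<Gamma>)" "X \<in> M \<rightarrow>\<^sub>M borel"
  shows "(\<lambda>\<omega>. \<integral>\<^sup>+\<xi>. f \<xi> \<partial>particle_law \<P> (X \<omega>)) \<in> borel_measurable M"
  by (rule measurable_compose[OF assms(2)
      measurable_compose[OF particle_subkernel nn_integral_measurable_subprob_algebra[OF assms(1)]]])

text \<open>For a cube that is not divided the outcome is decided by absorption alone; a particle
  that neither branches nor is absorbed counts as outcome False.\<close>

definition unbranched :: "bool \<Rightarrow> 'm particle \<Rightarrow> bool" where
  "unbranched b \<xi> \<longleftrightarrow> \<not> branches \<Gamma> n \<xi> \<and> (absorbed \<Gamma> n \<xi> \<longleftrightarrow> b)"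

lemma measurable_unbranched [measurable]: "Measurable.pred (particle_space \<Gamma>) (unbranched b)"
  unfolding unbranched_def[abs_def] by measurable

end

locale branching_cells = branching_kernel \<Gamma> n \<P>
  for \<Gamma> :: "'m::{t2_space, second_countable_topology} set" and n :: "'m \<Rightarrow> real"
    and \<P> :: "'m \<Rightarrow> (real \<Rightarrow> 'm) measure" +
  fixes k :: nat and D :: "'D::finite itself"
begin

abbreviation configs :: "bool \<Rightarrow> (int ^ 'D) set set" where
  "configs b \<equiv> {W. W \<subseteq> cells k \<and> (spanning k W \<longleftrightarrow> b)}"

lemma finite_configs [simp]: "finite (configs b)"
  by (rule finite_subset[of _ "Pow (cells k)"]) auto

text \<open>Carrying the probabilities of both outcomes \<open>b\<close> avoids subtraction in \<open>ennreal\<close>.\<close>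

primrec outcome_prob :: "nat \<Rightarrow> bool \<Rightarrow> 'm \<Rightarrow> ennreal" where
  "outcome_prob 0 b x = (\<integral>\<^sup>+\<xi>. of_bool (absorbed \<Gamma> n \<xi> \<longleftrightarrow> b) \<partial>particle_law \<P> x)"
| "outcome_prob (Suc i) b x = (\<integral>\<^sup>+\<xi>. of_bool (unbranched b \<xi>) + (\<Sum>W\<in>configs b. of_bool (branches \<Gamma> n \<xi>) *
     (\<Prod>c\<in>cells k. outcome_prob i (c \<in> W) (offspring_place \<xi>))) \<partial>particle_law \<P> x)"

lemma measurable_outcome_prob [measurable]: "outcome_prob i b \<in> borel_measurable borel"
proof (induction i arbitrary: b)
  case 0
  have "(\<lambda>x. \<integral>\<^sup>+\<xi>. of_bool (absorbed \<Gamma> n \<xi> \<longleftrightarrow> b) \<partial>particle_law \<P> x) \<in> borel_measurable borel"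
    by measurable
  then show ?case by simp
next
  case (Suc i)
  note [measurable] = Suc
  have "(\<lambda>x. \<integral>\<^sup>+\<xi>. of_bool (unbranched b \<xi>) + (\<Sum>W\<in>configs b. of_bool (branches \<Gamma> n \<xi>) *
     (\<Prod>c\<in>cells k. outcome_prob i (c \<in> W) (offspring_place \<xi>))) \<partial>particle_law \<P> x) \<in> borel_measurable borel"
    by measurable
  then show ?case by simp
qed

abbreviation good :: "('D label \<Rightarrow> 'm particle) \<Rightarrow> nat \<Rightarrow> 'D label \<Rightarrow> bool" where
  "good \<tau> \<equiv> good_label k (\<lambda>v. absorbed \<Gamma> n (\<tau> v)) (\<lambda>v. branches \<Gamma> n (\<tau> v))"

text \<open>Exactly one \<open>W\<close> is the set of good cells, so at most one summand survives.
  The spanning event thus becomes a polynomial in the indicators of single cells, which can be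
  averaged factor by factor.\<close>

lemma good_Suc_eq_sum:
  "(of_bool (good \<tau> (Suc i) v \<longleftrightarrow> b) :: ennreal) = of_bool (unbranched b (\<tau> v)) +
     (\<Sum>W\<in>configs b. of_bool (branches \<Gamma> n (\<tau> v)) * (\<Prod>c\<in>cells k. of_bool (good \<tau> i (c # v) \<longleftrightarrow> c \<in> W)))"
proof (cases "branches \<Gamma> n (\<tau> v)")
  case False
  then show ?thesis by (simp add: unbranched_def)
next
  case True
  let ?V = "{c \<in> cells k. good \<tau> i (c # v)}"
  have "(\<Prod>c\<in>cells k. of_bool (good \<tau> i (c # v) \<longleftrightarrow> c \<in> W)) = (of_bool (W = ?V) :: ennreal)"
    if "W \<subseteq> cells k" for W
  proof (cases "W = ?V")
    case False
    then have "\<exists>c\<in>cells k. \<not> (good \<tau> i (c # v) \<longleftrightarrow> c \<in> W)" using that by blast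
    then have "(\<Prod>c\<in>cells k. of_bool (good \<tau> i (c # v) \<longleftrightarrow> c \<in> W)) = (0 :: ennreal)"
      by (intro prod_zero) auto
    then show ?thesis using False by simp
  qed auto
  then have "(\<Sum>W\<in>configs b. of_bool (branches \<Gamma> n (\<tau> v)) * (\<Prod>c\<in>cells k. of_bool (good \<tau> i (c # v) \<longleftrightarrow> c \<in> W)))
      = (\<Sum>W\<in>configs b. (of_bool (W = ?V) :: ennreal))"
    using True by (intro sum.cong) auto
  also have "\<dots> = of_bool (spanning k ?V \<longleftrightarrow> b)"
    by (simp add: of_bool_def sum.delta)
  finally show ?thesis using True by (simp add: unbranched_def absorbed_def)
qed

lemma measurable_good:
  assumes [measurable]: "\<And>v. (\<lambda>x. \<tau> x v) \<in> M \<rightarrow>\<^sub>M particle_space \<Gamma>"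
  shows "Measurable.pred M (\<lambda>x. good (\<tau> x) i v)"
proof (induction i arbitrary: v)
  case 0
  show ?case by simp
next
  case (Suc i)
  note [measurable] = Suc
  have "Measurable.pred M (\<lambda>x. absorbed \<Gamma> n (\<tau> x v) \<or> branches \<Gamma> n (\<tau> x v) \<and>
    (\<exists>W\<in>configs True. \<forall>c\<in>cells k. good (\<tau> x) i (c # v) \<longleftrightarrow> c \<in> W))"
    by (intro pred_intros_logic pred_intros_finite) (auto intro: Suc)
  moreover have "(\<exists>W\<in>configs True. \<forall>c\<in>cells k. good (\<tau> x) i (c # v) \<longleftrightarrow> c \<in> W) \<longleftrightarrow>
      spanning k {c \<in> cells k. good (\<tau> x) i (c # v)}" for x
  proof
    assume "\<exists>W\<in>configs True. \<forall>c\<in>cells k. good (\<tau> x) i (c # v) \<longleftrightarrow> c \<in> W"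
    then obtain W where "W \<in> configs True" "W = {c \<in> cells k. good (\<tau> x) i (c # v)}" by blast
    then show "spanning k {c \<in> cells k. good (\<tau> x) i (c # v)}" by simp
  next
    assume "spanning k {c \<in> cells k. good (\<tau> x) i (c # v)}"
    then show "\<exists>W\<in>configs True. \<forall>c\<in>cells k. good (\<tau> x) i (c # v) \<longleftrightarrow> c \<in> W"
      by (intro bexI[of _ "{c \<in> cells k. good (\<tau> x) i (c # v)}"]) auto
  qed
  ultimately show ?case by simp
qed

end

locale branching_process = branching_cells \<Gamma> n \<P> k D + prob_space \<Omega>
  for \<Gamma> :: "'m::{t2_space, second_countable_topology} set" and n :: "'m \<Rightarrow> real"
    and \<P> :: "'m \<Rightarrow> (real \<Rightarrow> 'm) measure" and k :: nat and D :: "'D::finite itself"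
    and \<Omega> :: "'w measure" +
  fixes X0 :: "'w \<Rightarrow> 'm" and T :: "'D label \<Rightarrow> 'w \<Rightarrow> 'm particle"
  assumes branching: "branching_diffusion \<Omega> k \<Gamma> n \<P> X0 T"
begin

lemma measurable_start [measurable]: "X0 \<in> \<Omega> \<rightarrow>\<^sub>M borel"
  and measurable_particle [measurable]: "T v \<in> \<Omega> \<rightarrow>\<^sub>M particle_space \<Gamma>"
  using branching by (auto simp: branching_diffusion_def)

text \<open>A measurable stand-in for \<open>birth_place\<close>, defined for all labels and equal
  to it on born ones. Siblings share it.\<close>

definition place :: "'D label \<Rightarrow> 'w \<Rightarrow> 'm" where
  "place v \<omega> = (case v of [] \<Rightarrow> X0 \<omega> | c # u \<Rightarrow> offspring_place (T u \<omega>))"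

lemma measurable_place [measurable]: "place v \<in> \<Omega> \<rightarrow>\<^sub>M borel"
  unfolding place_def[abs_def] by (cases v) simp_all

lemma place_born: "born k \<Gamma> n (\<lambda>u. T u \<omega>) v \<Longrightarrow> birth_place \<Gamma> n (X0 \<omega>) (\<lambda>u. T u \<omega>) v = place v \<omega>"
  by (cases v) (auto simp: place_def offspring_place_def)

lemma measurable_history: "history X0 T g \<in> \<Omega> \<rightarrow>\<^sub>M history_space \<Gamma> g"
  unfolding history_def[abs_def] history_space_def by measurable

text \<open>Bundles the conditions under which the branching property is stated, so that an
  induction can hand them from one generation to the next.\<close>

definition past_event :: "nat \<Rightarrow> ('m \<times> ('D label \<Rightarrow> 'm particle)) set \<Rightarrow> 'D label set \<Rightarrow> bool" where
  "past_event g H S \<longleftrightarrow> H \<in> sets (history_space \<Gamma> g) \<and> finite S \<and> S \<subseteq> {v. length v = g} \<and>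
     (\<forall>\<omega>\<in>space \<Omega>. history X0 T g \<omega> \<in> H \<longrightarrow> (\<forall>v\<in>S. born k \<Gamma> n (\<lambda>u. T u \<omega>) v))"

lemma measurable_past_event:
  "past_event g H S \<Longrightarrow> Measurable.pred \<Omega> (\<lambda>\<omega>. history X0 T g \<omega> \<in> H)"
  by (rule pred_sets2[OF _ measurable_history]) (simp add: past_event_def)

lemma branching_sets:
  assumes H: "past_event g H S" and A: "\<And>v. v \<in> S \<Longrightarrow> A v \<in> sets (particle_space \<Gamma>)"
  shows "(\<integral>\<^sup>+\<omega>. of_bool (history X0 T g \<omega> \<in> H) * (\<Prod>v\<in>S. indicator (A v) (T v \<omega>)) \<partial>\<Omega>) =
    (\<integral>\<^sup>+\<omega>. of_bool (history X0 T g \<omega> \<in> H) * (\<Prod>v\<in>S. emeasure (particle_law \<P> (place v \<omega>)) (A v)) \<partial>\<Omega>)"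
proof -
  note [measurable] = measurable_past_event[OF H]
  have fin: "finite S" using H by (simp add: past_event_def)
  let ?E = "{\<omega>\<in>space \<Omega>. history X0 T g \<omega> \<in> H \<and> (\<forall>v\<in>S. T v \<omega> \<in> A v)}"
  have mT: "Measurable.pred \<Omega> (\<lambda>\<omega>. T v \<omega> \<in> A v)" if "v \<in> S" for v
    using pred_sets2[OF A[OF that] measurable_particle] .
  have "Measurable.pred \<Omega> (\<lambda>\<omega>. history X0 T g \<omega> \<in> H \<and> (\<forall>v\<in>S. T v \<omega> \<in> A v))"
    by (intro pred_intros_logic pred_intros_finite fin mT measurable_past_event[OF H])
  then have E: "?E \<in> sets \<Omega>" by (simp add: pred_def)
  let ?f = "\<lambda>\<omega>. \<Prod>v\<in>S. measure (particle_law \<P> (place v \<omega>)) (A v)"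
  have fm: "(\<lambda>\<omega>. measure (particle_law \<P> (place v \<omega>)) (A v)) \<in> borel_measurable \<Omega>" if "v \<in> S" for v
    using measurable_compose[OF measurable_place measurable_compose[OF particle_subkernel
        measurable_measure_subprob_algebra[OF A[OF that]]]] .
  have f01: "0 \<le> ?f \<omega>" "?f \<omega> \<le> 1" for \<omega>
    using prob_space.prob_le_1[OF prob_space_particle_law]
    by (auto intro!: prod_nonneg prod_le_1)
  let ?g = "\<lambda>\<omega>. indicator {\<omega>\<in>space \<Omega>. history X0 T g \<omega> \<in> H} \<omega> * ?f \<omega>"
  have gm: "?g \<in> borel_measurable \<Omega>"
    by (intro borel_measurable_times borel_measurable_prod fm) (use measurable_past_event[OF H] in \<open>simp add: pred_def\<close>)
  have gi: "integrable \<Omega> ?g"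
    by (rule integrable_const_bound[where B = 1, OF _ gm])
      (use f01 in \<open>auto simp: indicator_def abs_le_iff intro: order_trans[of "- ?f _" 0]\<close>)
  have "(\<integral>\<^sup>+\<omega>. of_bool (history X0 T g \<omega> \<in> H) * (\<Prod>v\<in>S. indicator (A v) (T v \<omega>)) \<partial>\<Omega>) = (\<integral>\<^sup>+\<omega>. indicator ?E \<omega> \<partial>\<Omega>)"
  proof (rule nn_integral_cong)
    fix \<omega> assume \<omega>: "\<omega> \<in> space \<Omega>"
    show "of_bool (history X0 T g \<omega> \<in> H) * (\<Prod>v\<in>S. indicator (A v) (T v \<omega>)) = (indicator ?E \<omega> :: ennreal)"
    proof (cases "\<forall>v\<in>S. T v \<omega> \<in> A v")
      case False
      then have "(\<Prod>v\<in>S. indicator (A v) (T v \<omega>)) = (0 :: ennreal)" using fin by (intro prod_zero) (auto simp: indicator_def)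
      then show ?thesis using False by auto
    qed (use \<omega> in auto)
  qed
  also have "\<dots> = ennreal (measure \<Omega> ?E)" using E by (simp add: emeasure_eq_measure)
  also have "measure \<Omega> ?E = (LINT \<omega>:{\<omega>\<in>space \<Omega>. history X0 T g \<omega> \<in> H}|\<Omega>.
      (\<Prod>v\<in>S. measure (particle_law \<P> (birth_place \<Gamma> n (X0 \<omega>) (\<lambda>u. T u \<omega>) v)) (A v)))"
    using branching H A unfolding branching_diffusion_def past_event_def by blast
  also have "\<dots> = (LINT \<omega>|\<Omega>. ?g \<omega>)"
    unfolding set_lebesgue_integral_def
    by (rule Bochner_Integration.integral_cong)
      (use H in \<open>auto simp: past_event_def place_born indicator_def intro!: prod.cong\<close>)
  also have "ennreal \<dots> = (\<integral>\<^sup>+\<omega>. ennreal (?g \<omega>) \<partial>\<Omega>)"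
    using f01 by (intro nn_integral_eq_integral[symmetric] gi) auto
  also have "\<dots> = (\<integral>\<^sup>+\<omega>. of_bool (history X0 T g \<omega> \<in> H) * (\<Prod>v\<in>S. emeasure (particle_law \<P> (place v \<omega>)) (A v)) \<partial>\<Omega>)"
  proof (rule nn_integral_cong)
    fix \<omega> assume "\<omega> \<in> space \<Omega>"
    then show "ennreal (?g \<omega>) = of_bool (history X0 T g \<omega> \<in> H) * (\<Prod>v\<in>S. emeasure (particle_law \<P> (place v \<omega>)) (A v))"
      by (simp add: indicator_def prod_ennreal
          finite_measure.emeasure_eq_measure[OF prob_space.axioms(1)[OF prob_space_particle_law]])
  qed
  finally show ?thesis .
qed

text \<open>Indicators are exchanged for functions one label at a time: \<open>S1\<close> contains
  the labels where an arbitrary function is already allowed, elsewhere indicators remain. Starting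
  from the empty set, where this is \<open>branching_sets\<close>, one arrives at all of
  \<open>S\<close>.\<close>

lemma branching_functions:
  assumes H: "past_event g H S" and f: "\<And>v. v \<in> S \<Longrightarrow> f v \<in> borel_measurable (particle_space \<Gamma>)"
  shows "(\<integral>\<^sup>+\<omega>. of_bool (history X0 T g \<omega> \<in> H) * (\<Prod>v\<in>S. f v (T v \<omega>)) \<partial>\<Omega>) =
    (\<integral>\<^sup>+\<omega>. of_bool (history X0 T g \<omega> \<in> H) * (\<Prod>v\<in>S. \<integral>\<^sup>+\<xi>. f v \<xi> \<partial>particle_law \<P> (place v \<omega>)) \<partial>\<Omega>)"
proof -
  have fin: "finite S" using H by (simp add: past_event_def)
  note [measurable] = measurable_past_event[OF H]
  let ?L = "\<lambda>f. \<integral>\<^sup>+\<omega>. of_bool (history X0 T g \<omega> \<in> H) * (\<Prod>v\<in>S. f v (T v \<omega>)) \<partial>\<Omega>"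
  let ?R = "\<lambda>f. \<integral>\<^sup>+\<omega>. of_bool (history X0 T g \<omega> \<in> H) * (\<Prod>v\<in>S. \<integral>\<^sup>+\<xi>. f v \<xi> \<partial>particle_law \<P> (place v \<omega>)) \<partial>\<Omega>"
  have "S1 \<subseteq> S \<Longrightarrow> (\<And>v. v \<in> S \<Longrightarrow> F v \<in> borel_measurable (particle_space \<Gamma>)) \<Longrightarrow>
    (\<And>v. v \<in> S - S1 \<Longrightarrow> \<exists>A\<in>sets (particle_space \<Gamma>). F v = indicator A) \<Longrightarrow> ?L F = ?R F" if "finite S1" for S1 and F :: "'D label \<Rightarrow> 'm particle \<Rightarrow> ennreal"
    using that
  proof (induction S1 arbitrary: F)
    case empty
    then obtain A where A: "\<And>v. v \<in> S \<Longrightarrow> A v \<in> sets (particle_space \<Gamma>) \<and> F v = indicator (A v)"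
      by (metis Diff_empty)
    have "(\<integral>\<^sup>+\<omega>. of_bool (history X0 T g \<omega> \<in> H) * (\<Prod>v\<in>S. F v (T v \<omega>)) \<partial>\<Omega>) =
      (\<integral>\<^sup>+\<omega>. of_bool (history X0 T g \<omega> \<in> H) * (\<Prod>v\<in>S. indicator (A v) (T v \<omega>)) \<partial>\<Omega>)"
      using A by simp
    also have "\<dots> = (\<integral>\<^sup>+\<omega>. of_bool (history X0 T g \<omega> \<in> H) * (\<Prod>v\<in>S. emeasure (particle_law \<P> (place v \<omega>)) (A v)) \<partial>\<Omega>)"
      using A by (intro branching_sets[OF H]) auto
    also have "\<dots> = (\<integral>\<^sup>+\<omega>. of_bool (history X0 T g \<omega> \<in> H) * (\<Prod>v\<in>S. \<integral>\<^sup>+\<xi>. F v \<xi> \<partial>particle_law \<P> (place v \<omega>)) \<partial>\<Omega>)"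
      using A by simp
    finally show ?case .
  next
    case (insert u S1)
    have u: "u \<in> S" using insert.prems by simp
    note fm = insert.prems(2)
    let ?h = "\<lambda>\<omega>. of_bool (history X0 T g \<omega> \<in> H) :: ennreal"
    let ?R1 = "\<lambda>\<omega>. ?h \<omega> * (\<Prod>v\<in>S - {u}. F v (T v \<omega>))"
    let ?R2 = "\<lambda>\<omega>. ?h \<omega> * (\<Prod>v\<in>S - {u}. \<integral>\<^sup>+\<xi>. F v \<xi> \<partial>particle_law \<P> (place v \<omega>))"
    have split1: "(\<Prod>v\<in>S. (F(u := \<phi>)) v (T v \<omega>)) = \<phi> (T u \<omega>) * (\<Prod>v\<in>S - {u}. F v (T v \<omega>))" for \<phi> \<omega>
      using fin u by (subst prod.remove[of S u]) auto
    have split2: "(\<Prod>v\<in>S. \<integral>\<^sup>+\<xi>. (F(u := \<phi>)) v \<xi> \<partial>particle_law \<P> (place v \<omega>)) =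
        (\<integral>\<^sup>+\<xi>. \<phi> \<xi> \<partial>particle_law \<P> (place u \<omega>)) * (\<Prod>v\<in>S - {u}. \<integral>\<^sup>+\<xi>. F v \<xi> \<partial>particle_law \<P> (place v \<omega>))" for \<phi> \<omega>
      using fin u by (subst prod.remove[of S u]) auto
    have "(\<integral>\<^sup>+\<omega>. F u (T u \<omega>) * ?R1 \<omega> \<partial>\<Omega>) = (\<integral>\<^sup>+\<omega>. (\<integral>\<^sup>+\<xi>. F u \<xi> \<partial>particle_law \<P> (place u \<omega>)) * ?R2 \<omega> \<partial>\<Omega>)"
    proof (rule nn_integral_kernel_eqI[where N = "particle_space \<Gamma>"])
      show "(\<lambda>\<omega>. particle_law \<P> (place u \<omega>)) \<in> \<Omega> \<rightarrow>\<^sub>M subprob_algebra (particle_space \<Gamma>)"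
        by measurable
      show "?R1 \<in> borel_measurable \<Omega>"
        by (intro borel_measurable_times_ennreal borel_measurable_prod_ennreal measurable_compose[OF measurable_particle] fm)
          (use measurable_past_event[OF H] in auto)
      show "?R2 \<in> borel_measurable \<Omega>"
        by (intro borel_measurable_times_ennreal borel_measurable_prod_ennreal
            nn_integral_particle_law_measurable fm measurable_place)
          (use measurable_past_event[OF H] in auto)
      fix A assume A: "A \<in> sets (particle_space \<Gamma>)"
      have "(\<integral>\<^sup>+\<omega>. ?h \<omega> * (\<Prod>v\<in>S. (F(u := indicator A)) v (T v \<omega>)) \<partial>\<Omega>) =
        (\<integral>\<^sup>+\<omega>. ?h \<omega> * (\<Prod>v\<in>S. \<integral>\<^sup>+\<xi>. (F(u := indicator A)) v \<xi> \<partial>particle_law \<P> (place v \<omega>)) \<partial>\<Omega>)"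
        by (rule insert.IH) (use insert.prems A in auto)
      then show "(\<integral>\<^sup>+\<omega>. indicator A (T u \<omega>) * ?R1 \<omega> \<partial>\<Omega>) =
        (\<integral>\<^sup>+\<omega>. emeasure (particle_law \<P> (place u \<omega>)) A * ?R2 \<omega> \<partial>\<Omega>)"
        unfolding split1 split2 using A by (simp add: mult.left_commute)
    qed (use fm u in auto)
    then show ?case
      using fin u by (simp add: prod.remove[of S u] mult.left_commute)
  qed
  from this[OF fin, of f] f show ?thesis by auto
qed


lemma prod_of_bool:
  "finite S \<Longrightarrow> (\<Prod>v\<in>S. of_bool (Q v)) = (of_bool (\<forall>v\<in>S. Q v) :: ennreal)"
  by (induction S rule: finite_induct) auto

lemma measurable_history_restrict:
  "(\<lambda>x. (fst x, restrict (snd x) {u. length u < g})) \<in>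
     history_space \<Gamma> (Suc g) \<rightarrow>\<^sub>M (history_space \<Gamma> g :: ('m \<times> ('D label \<Rightarrow> 'm particle)) measure)"
  unfolding history_space_def
  by (intro measurable_Pair measurable_fst measurable_compose[OF measurable_snd measurable_restrict_subset]) auto

lemma history_restrict:
  "(fst (history X0 T (Suc g) \<omega>), restrict (snd (history X0 T (Suc g) \<omega>)) {u. length u < g}) = history X0 T g \<omega>"
  by (auto simp: history_def restrict_def fun_eq_iff)

text \<open>One generation is integrated out at a time. Fixing for each particle of generation \<open>g\<close> whether it
  branches and which of its offspring are good turns the event on generation \<open>g\<close> into a past event of
  generation \<open>g + 1\<close>, to which the induction hypothesis applies.\<close>

lemma good_outcomes:
  assumes "past_event g H S"
  shows "(\<integral>\<^sup>+\<omega>. of_bool (history X0 T g \<omega> \<in> H) * (\<Prod>v\<in>S. of_bool (good (\<lambda>u. T u \<omega>) i v \<longleftrightarrow> e v)) \<partial>\<Omega>) =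
    (\<integral>\<^sup>+\<omega>. of_bool (history X0 T g \<omega> \<in> H) * (\<Prod>v\<in>S. outcome_prob i (e v) (place v \<omega>)) \<partial>\<Omega>)"
  using assms
proof (induction i arbitrary: g H S e)
  case 0
  show ?case
    using branching_functions[OF 0, of "\<lambda>v \<xi>. of_bool (absorbed \<Gamma> n \<xi> \<longleftrightarrow> e v)"] by simp
next
  case (Suc i)
  note H = Suc.prems
  have fin: "finite S" and len: "\<And>v. v \<in> S \<Longrightarrow> length v = g"
    using H by (auto simp: past_event_def)
  let ?h = "\<lambda>\<omega>. of_bool (history X0 T g \<omega> \<in> H) :: ennreal"
  \<comment> \<open>\<open>None\<close> stands for a particle that does not branch,
    \<open>Some W\<close> for one that branches with \<open>W\<close> as the exact set of its good
    cells. Expanding the product over \<open>S\<close> of sums over \<open>opts\<close> gives one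
    term for each assignment \<open>p\<close>.\<close>
  define opts where "opts v = insert None (Some ` configs (e v))" for v
  define t where "t v \<omega> w = ((case w of None \<Rightarrow> of_bool (unbranched (e v) (T v \<omega>))
    | Some W \<Rightarrow> of_bool (branches \<Gamma> n (T v \<omega>)) * (\<Prod>c\<in>cells k. of_bool (good (\<lambda>u. T u \<omega>) i (c # v) \<longleftrightarrow> c \<in> W))) :: ennreal)" for v \<omega> w
  define s where "s v \<xi> w = (case w of None \<Rightarrow> of_bool (unbranched (e v) \<xi>)
    | Some W \<Rightarrow> of_bool (branches \<Gamma> n \<xi>) * (\<Prod>c\<in>cells k. outcome_prob i (c \<in> W) (offspring_place \<xi>)))" for v \<xi> and w :: "(int ^ 'D) set option"
  have finopts: "finite (opts v)" for v by (simp add: opts_def)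
  have sum_opts: "(\<Sum>w\<in>opts v. F w) = F None + (\<Sum>W\<in>configs (e v). F (Some W))" for v and F :: "_ \<Rightarrow> ennreal"
  proof -
    have "(\<Sum>w\<in>opts v. F w) = F None + (\<Sum>w\<in>Some ` configs (e v). F w)"
      unfolding opts_def by (rule sum.insert) auto
    also have "(\<Sum>w\<in>Some ` configs (e v). F w) = (\<Sum>W\<in>configs (e v). F (Some W))"
      by (subst sum.reindex) auto
    finally show ?thesis .
  qed
  have hm: "?h \<in> borel_measurable \<Omega>"
    by (intro of_bool_ennreal_measurable measurable_past_event[OF H])
  have gm: "Measurable.pred \<Omega> (\<lambda>\<omega>. good (\<lambda>u. T u \<omega>) i v)" for v by (rule measurable_good) simp
  have tm: "(\<lambda>\<omega>. t v \<omega> w) \<in> borel_measurable \<Omega>" for v w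
  proof (cases w)
    case (Some W)
    note [measurable] = gm
    show ?thesis unfolding t_def Some option.case by measurable
  qed (simp add: t_def)
  have sm: "(\<lambda>\<xi>. s v \<xi> w) \<in> borel_measurable (particle_space \<Gamma>)" for v w
    by (cases w) (simp_all add: s_def)
  \<comment> \<open>For a fixed assignment the actual outcomes of the offspring (\<open>t\<close>)
    are replaced by their probabilities (\<open>s\<close>), while generation \<open>g\<close> stays
    sampled and is averaged only afterwards.\<close>
  have swap: "(\<integral>\<^sup>+\<omega>. ?h \<omega> * (\<Prod>v\<in>S. t v \<omega> (p v)) \<partial>\<Omega>) = (\<integral>\<^sup>+\<omega>. ?h \<omega> * (\<Prod>v\<in>S. s v (T v \<omega>) (p v)) \<partial>\<Omega>)"
    for p
  proof -
    define cond where "cond v \<xi> \<longleftrightarrow> (case p v of None \<Rightarrow> unbranched (e v) \<xi> | Some W \<Rightarrow> branches \<Gamma> n \<xi>)" for v \<xi>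
    \<comment> \<open>Whether the particles of \<open>S\<close> branch is visible in the history
      before generation \<open>Suc g\<close>. On this event all offspring collected in the sets
      \<open>A v\<close> are born, and \<open>e'\<close> prescribes their outcomes.\<close>
    define H' where "H' = {x \<in> space (history_space \<Gamma> (Suc g)).
      (fst x, restrict (snd x) {u. length u < g}) \<in> H \<and> (\<forall>v\<in>S. cond v (snd x v))}"
    define A where "A v = (case p v of None \<Rightarrow> {} | Some W \<Rightarrow> (\<lambda>c. c # v) ` cells k)" for v
    define e' where "e' u \<longleftrightarrow> hd u \<in> the (p (tl u))" for u
    have A: "finite (A v)" "u \<in> A v \<Longrightarrow> tl u = v \<and> hd u \<in> cells k \<and> u = hd u # v \<and> p v \<noteq> None" for v u
      by (auto simp: A_def split: option.splits)
    have cm: "Measurable.pred (particle_space \<Gamma>) (cond v)" for v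
      unfolding cond_def[abs_def] by (cases "p v") simp_all
    have comp: "(\<lambda>x. snd x v) \<in> history_space \<Gamma> (Suc g) \<rightarrow>\<^sub>M particle_space \<Gamma>" if "v \<in> S" for v
      unfolding history_space_def
      by (rule measurable_compose[OF measurable_snd measurable_component_singleton]) (use len[OF that] in simp)
    have "Measurable.pred (history_space \<Gamma> (Suc g))
       (\<lambda>x. (fst x, restrict (snd x) {u. length u < g}) \<in> H \<and> (\<forall>v\<in>S. cond v (snd x v)))"
      by (intro pred_intros_logic pred_intros_finite fin measurable_compose[OF comp cm]
          pred_sets2[OF _ measurable_history_restrict]) (use H in \<open>auto simp: past_event_def\<close>)
    then have Hs: "H' \<in> sets (history_space \<Gamma> (Suc g))" by (simp add: H'_def pred_def)
    have Hiff: "history X0 T (Suc g) \<omega> \<in> H' \<longleftrightarrow> history X0 T g \<omega> \<in> H \<and> (\<forall>v\<in>S. cond v (T v \<omega>))"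
      if "\<omega> \<in> space \<Omega>" for \<omega>
    proof -
      have "snd (history X0 T (Suc g) \<omega>) v = T v \<omega>" if "v \<in> S" for v
        using len[OF that] by (simp add: history_def)
      then show ?thesis
        using measurable_space[OF measurable_history that, of "Suc g"] by (simp add: H'_def history_restrict)
    qed
    have past: "past_event (Suc g) H' (\<Union>v\<in>S. A v)"
      unfolding past_event_def
    proof (intro conjI ballI impI Hs)
      show "finite (\<Union>v\<in>S. A v)" using fin A by blast
      show "(\<Union>v\<in>S. A v) \<subseteq> {v. length v = Suc g}"
        using len by (auto simp: A_def split: option.splits)
      fix \<omega> u assume \<omega>: "\<omega> \<in> space \<Omega>" "history X0 T (Suc g) \<omega> \<in> H'" and "u \<in> (\<Union>v\<in>S. A v)"
      then obtain v where v: "v \<in> S" "u \<in> A v" by blast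
      then have "born k \<Gamma> n (\<lambda>u. T u \<omega>) v" using \<omega> Hiff[OF \<omega>(1)] H by (auto simp: past_event_def)
      moreover have "branches \<Gamma> n (T v \<omega>)"
        using \<omega> Hiff[OF \<omega>(1)] v A(2)[OF v(2)] by (auto simp: cond_def)
      moreover obtain c where "u = c # v" "c \<in> cells k" using A(2)[OF v(2)] by blast
      ultimately show "born k \<Gamma> n (\<lambda>u. T u \<omega>) u" by simp
    qed
    have prods: "of_bool (history X0 T (Suc g) \<omega> \<in> H') * (\<Prod>u\<in>(\<Union>v\<in>S. A v). \<phi> u) =
      ?h \<omega> * (\<Prod>v\<in>S. of_bool (cond v (T v \<omega>)) * (case p v of None \<Rightarrow> 1 | Some W \<Rightarrow> \<Prod>c\<in>cells k. \<phi> (c # v)))"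
      if "\<omega> \<in> space \<Omega>" for \<omega> and \<phi> :: "'D label \<Rightarrow> ennreal"
    proof -
      have "(\<Prod>u\<in>(\<Union>v\<in>S. A v). \<phi> u) = (\<Prod>v\<in>S. \<Prod>u\<in>A v. \<phi> u)"
        using fin A by (intro prod.UNION_disjoint) blast+
      also have "\<dots> = (\<Prod>v\<in>S. case p v of None \<Rightarrow> 1 | Some W \<Rightarrow> \<Prod>c\<in>cells k. \<phi> (c # v))"
        by (intro prod.cong) (auto simp: A_def prod.reindex inj_on_def split: option.splits)
      finally show ?thesis
        using Hiff[OF that] fin by (simp add: prod.distrib prod_of_bool of_bool_conj mult.assoc)
    qed
    have "(\<integral>\<^sup>+\<omega>. ?h \<omega> * (\<Prod>v\<in>S. t v \<omega> (p v)) \<partial>\<Omega>) =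
      (\<integral>\<^sup>+\<omega>. of_bool (history X0 T (Suc g) \<omega> \<in> H') *
        (\<Prod>u\<in>(\<Union>v\<in>S. A v). of_bool (good (\<lambda>u. T u \<omega>) i u \<longleftrightarrow> e' u)) \<partial>\<Omega>)"
      by (intro nn_integral_cong, subst prods, assumption, intro arg_cong2[where f = "(*)"] refl prod.cong)
        (auto simp: t_def cond_def e'_def split: option.splits)
    also have "\<dots> = (\<integral>\<^sup>+\<omega>. of_bool (history X0 T (Suc g) \<omega> \<in> H') *
        (\<Prod>u\<in>(\<Union>v\<in>S. A v). outcome_prob i (e' u) (place u \<omega>)) \<partial>\<Omega>)"
      by (rule Suc.IH[OF past])
    also have "\<dots> = (\<integral>\<^sup>+\<omega>. ?h \<omega> * (\<Prod>v\<in>S. s v (T v \<omega>) (p v)) \<partial>\<Omega>)"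
      by (intro nn_integral_cong, subst prods, assumption, intro arg_cong2[where f = "(*)"] refl prod.cong)
        (auto simp: s_def cond_def e'_def place_def split: option.splits)
    finally show ?thesis .
  qed
  have "(\<integral>\<^sup>+\<omega>. ?h \<omega> * (\<Prod>v\<in>S. of_bool (good (\<lambda>u. T u \<omega>) (Suc i) v \<longleftrightarrow> e v)) \<partial>\<Omega>) =
    (\<integral>\<^sup>+\<omega>. ?h \<omega> * (\<Prod>v\<in>S. \<Sum>w\<in>opts v. t v \<omega> w) \<partial>\<Omega>)"
    unfolding good_Suc_eq_sum sum_opts by (simp add: t_def)
  also have "\<dots> = (\<integral>\<^sup>+\<omega>. (\<Sum>p\<in>PiE S opts. ?h \<omega> * (\<Prod>v\<in>S. t v \<omega> (p v))) \<partial>\<Omega>)"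
    using fin finopts by (simp only: prod_sum_PiE sum_distrib_left)
  also have "\<dots> = (\<Sum>p\<in>PiE S opts. \<integral>\<^sup>+\<omega>. ?h \<omega> * (\<Prod>v\<in>S. t v \<omega> (p v)) \<partial>\<Omega>)"
    by (intro nn_integral_sum borel_measurable_times_ennreal borel_measurable_prod_ennreal hm tm)
  also have "\<dots> = (\<Sum>p\<in>PiE S opts. \<integral>\<^sup>+\<omega>. ?h \<omega> * (\<Prod>v\<in>S. s v (T v \<omega>) (p v)) \<partial>\<Omega>)"
    by (simp only: swap)
  also have "\<dots> = (\<integral>\<^sup>+\<omega>. (\<Sum>p\<in>PiE S opts. ?h \<omega> * (\<Prod>v\<in>S. s v (T v \<omega>) (p v))) \<partial>\<Omega>)"
    by (intro nn_integral_sum[symmetric] borel_measurable_times_ennreal borel_measurable_prod_ennreal hm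
        measurable_compose[OF measurable_particle sm])
  also have "\<dots> = (\<integral>\<^sup>+\<omega>. ?h \<omega> * (\<Prod>v\<in>S. \<Sum>w\<in>opts v. s v (T v \<omega>) w) \<partial>\<Omega>)"
    using fin finopts by (simp only: prod_sum_PiE sum_distrib_left)
  also have "\<dots> = (\<integral>\<^sup>+\<omega>. ?h \<omega> * (\<Prod>v\<in>S. \<integral>\<^sup>+\<xi>. (\<Sum>w\<in>opts v. s v \<xi> w) \<partial>particle_law \<P> (place v \<omega>)) \<partial>\<Omega>)"
    by (rule branching_functions[OF H, of "\<lambda>v \<xi>. \<Sum>w\<in>opts v. s v \<xi> w"]) (intro borel_measurable_sum sm)
  also have "\<dots> = (\<integral>\<^sup>+\<omega>. ?h \<omega> * (\<Prod>v\<in>S. outcome_prob (Suc i) (e v) (place v \<omega>)) \<partial>\<Omega>)"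
    unfolding sum_opts by (simp add: s_def)
  finally show ?case .
qed

lemma emeasure_good:
  "emeasure \<Omega> {\<omega>\<in>space \<Omega>. good (\<lambda>u. T u \<omega>) i []} = (\<integral>\<^sup>+\<omega>. outcome_prob i True (X0 \<omega>) \<partial>\<Omega>)"
proof -
  let ?H = "space (history_space \<Gamma> 0) :: ('m \<times> ('D label \<Rightarrow> 'm particle)) set"
  have past: "past_event 0 ?H {[]}" by (auto simp: past_event_def)
  have H: "history X0 T 0 \<omega> \<in> ?H" if "\<omega> \<in> space \<Omega>" for \<omega>
    using measurable_space[OF measurable_history that] .
  have "{\<omega>\<in>space \<Omega>. good (\<lambda>u. T u \<omega>) i []} \<in> sets \<Omega>"
    using measurable_good[of "\<lambda>\<omega> u. T u \<omega>" \<Omega> i "[]"] by (simp add: pred_def)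
  then have "emeasure \<Omega> {\<omega>\<in>space \<Omega>. good (\<lambda>u. T u \<omega>) i []} =
      (\<integral>\<^sup>+\<omega>. indicator {\<omega>\<in>space \<Omega>. good (\<lambda>u. T u \<omega>) i []} \<omega> \<partial>\<Omega>)" by simp
  also have "\<dots> = (\<integral>\<^sup>+\<omega>. of_bool (history X0 T 0 \<omega> \<in> ?H) * (\<Prod>v\<in>{[]}. of_bool (good (\<lambda>u. T u \<omega>) i v \<longleftrightarrow> True)) \<partial>\<Omega>)"
    using H by (intro nn_integral_cong) auto
  also have "\<dots> = (\<integral>\<^sup>+\<omega>. of_bool (history X0 T 0 \<omega> \<in> ?H) * (\<Prod>v\<in>{[]}. outcome_prob i True (place v \<omega>)) \<partial>\<Omega>)"
    by (rule good_outcomes[OF past])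
  also have "\<dots> = (\<integral>\<^sup>+\<omega>. outcome_prob i True (X0 \<omega>) \<partial>\<Omega>)"
    using H by (intro nn_integral_cong) (auto simp: place_def)
  finally show ?thesis .
qed

end

section \<open>The recursion for good cubes\<close>

lemma Pi_pmf_spanning_configs:
  fixes D :: "'D::finite itself"
  shows "(\<Sum>W | W \<subseteq> (cells k :: (int ^ 'D) set) \<and> spanning k W = b. \<Prod>c\<in>cells k. pmf (bernoulli_pmf p) (c \<in> W)) =
    measure_pmf.prob (Pi_pmf (cells k :: (int ^ 'D) set) False (\<lambda>_. bernoulli_pmf p))
      {\<omega>. spanning k {c\<in>cells k. \<omega> c} = b}"
proof -
  let ?P = "Pi_pmf (cells k :: (int ^ 'D) set) False (\<lambda>_. bernoulli_pmf p)"
  let ?C = "{W. W \<subseteq> (cells k :: (int ^ 'D) set) \<and> spanning k W = b}"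
  let ?f = "\<lambda>W c. c \<in> (W :: (int ^ 'D) set)"
  have fin: "finite ?C" by (rule finite_subset[of _ "Pow (cells k)"]) auto
  have inj: "inj_on ?f ?C" by (rule inj_onI) (metis subsetI subset_antisym)
  have "measure_pmf.prob ?P {\<omega>. spanning k {c\<in>cells k. \<omega> c} = b} = measure_pmf.prob ?P (?f ` ?C)"
  \<comment> \<open>A spanning pattern that is not the indicator of a subset of the cells takes the
    value True outside them, against the default False, and has probability 0.\<close>
  proof (rule measure_prob_cong_0)
    fix \<omega> assume \<omega>: "\<omega> \<in> {\<omega>. spanning k {c\<in>cells k. \<omega> c} = b} - ?f ` ?C"
    then have "\<omega> \<noteq> ?f {c\<in>cells k. \<omega> c}" by blast
    then obtain c where "c \<notin> cells k" "\<omega> c" by (auto simp: fun_eq_iff)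
    then show "pmf ?P \<omega> = 0" by (auto simp: pmf_Pi)
  next
    fix \<omega> assume \<omega>: "\<omega> \<in> ?f ` ?C - {\<omega>. spanning k {c\<in>cells k. \<omega> c} = b}"
    then obtain W where W: "\<omega> = ?f W" "W \<subseteq> cells k" "spanning k W = b" by blast
    then have "{c \<in> cells k. \<omega> c} = W" by auto
    then show "pmf ?P \<omega> = 0" using \<omega> W by auto
  qed
  also have "\<dots> = (\<Sum>\<omega>\<in>?f ` ?C. pmf ?P \<omega>)" by (rule measure_measure_pmf_finite) (use fin in simp)
  also have "\<dots> = (\<Sum>W\<in>?C. pmf ?P (?f W))" by (simp add: sum.reindex[OF inj])
  also have "\<dots> = (\<Sum>W\<in>?C. \<Prod>c\<in>cells k. pmf (bernoulli_pmf p) (c \<in> W))"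
    by (intro sum.cong) (auto simp: pmf_Pi)
  finally show ?thesis by simp
qed

lemma Q_poly_eq_sum:
  "Q_poly (D :: 'D::finite itself) k p =
    (\<Sum>W | W \<subseteq> (cells k :: (int ^ 'D) set) \<and> spanning k W = True. \<Prod>c\<in>cells k. pmf (bernoulli_pmf p) (c \<in> W))"
  unfolding Pi_pmf_spanning_configs Q_poly_def by simp

lemma complement_Q_poly_eq_sum:
  "1 - Q_poly (D :: 'D::finite itself) k p =
    (\<Sum>W | W \<subseteq> (cells k :: (int ^ 'D) set) \<and> spanning k W = False. \<Prod>c\<in>cells k. pmf (bernoulli_pmf p) (c \<in> W))"
  unfolding Pi_pmf_spanning_configs Q_poly_def
  by (subst measure_pmf.prob_compl[symmetric]) (auto intro!: arg_cong2[where f = measure])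

lemma Q_poly_bounds: "0 \<le> Q_poly D k p" "Q_poly D k p \<le> 1"
  by (simp_all add: Q_poly_def)

lemma spanning_mono: "spanning k S \<Longrightarrow> S \<subseteq> S' \<Longrightarrow> spanning k S'"
  unfolding spanning_def by (meson order_trans)

text \<open>The coupling takes for the smaller variable the conjunction of the larger one with an
  independent Bernoulli variable of parameter p / q.\<close>

lemma rel_pmf_bernoulli_le:
  assumes "0 \<le> p" "p \<le> q" "q \<le> 1"
  shows "rel_pmf (\<le>) (bernoulli_pmf p) (bernoulli_pmf q)"
proof (cases "q = 0")
  case True
  then show ?thesis using assms by (auto intro!: rel_pmf_reflI)
next
  case False
  define r where "r = p / q"
  have r: "0 \<le> r" "r \<le> 1" "r * q = p" using assms False by (auto simp: r_def)
  let ?J = "bind_pmf (bernoulli_pmf q) (\<lambda>b. map_pmf (\<lambda>a. (a \<and> b, b)) (bernoulli_pmf r))"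
  have "map_pmf snd ?J = bernoulli_pmf q"
    by (simp add: map_bind_pmf pmf.map_comp comp_def map_pmf_const bind_return_pmf')
  moreover have "map_pmf fst ?J = bernoulli_pmf p"
  proof -
    have e: "map_pmf fst ?J = bind_pmf (bernoulli_pmf q) (\<lambda>b. map_pmf (\<lambda>a. a \<and> b) (bernoulli_pmf r))"
      by (simp add: map_bind_pmf pmf.map_comp comp_def)
    have "pmf (map_pmf fst ?J) True = p"
      unfolding e using assms r False
      by (simp add: pmf_bind map_pmf_const)
    then have "pmf (map_pmf fst ?J) b = pmf (bernoulli_pmf p) b" for b
      using assms pmf_False_conv_True[of "map_pmf fst ?J"] by (cases b) simp_all
    then show ?thesis by (rule pmf_eqI)
  qed
  ultimately show ?thesis
    by (intro rel_pmf.intros[of ?J]) auto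
qed


lemma rel_pmf_Pi_bernoulli_le:
  assumes "finite A" "0 \<le> p" "p \<le> q" "q \<le> 1"
  shows "rel_pmf (\<le>) (Pi_pmf A False (\<lambda>_. bernoulli_pmf p)) (Pi_pmf A False (\<lambda>_. bernoulli_pmf q))"
  using assms(1)
proof (induction A rule: finite_induct)
  case empty
  show ?case by (auto intro!: rel_pmf_reflI)
next
  case (insert x A)
  have "rel_pmf (rel_prod (\<le>) (\<le>))
     (pair_pmf (bernoulli_pmf p) (Pi_pmf A False (\<lambda>_. bernoulli_pmf p)))
     (pair_pmf (bernoulli_pmf q) (Pi_pmf A False (\<lambda>_. bernoulli_pmf q)))"
    using rel_pmf_bernoulli_le[OF assms(2-4)] insert.IH by (simp add: rel_pmf_rel_prod)
  then show ?case
    unfolding Pi_pmf_insert[OF insert.hyps] pmf.rel_map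
    by (rule pmf.rel_mono_strong) (auto simp: le_fun_def)
qed

text \<open>Spanning is an increasing event, so a monotone coupling of the two product measures
  suffices.\<close>

lemma Q_poly_mono:
  assumes "0 \<le> p" "p \<le> q" "q \<le> 1"
  shows "Q_poly (D :: 'D::finite itself) k p \<le> Q_poly D k q"
proof -
  let ?P = "\<lambda>p. Pi_pmf (cells k :: (int ^ 'D) set) False (\<lambda>_. bernoulli_pmf p)"
  let ?A = "{\<omega>. spanning k {c\<in>cells k. \<omega> c}} :: (int ^ 'D \<Rightarrow> bool) set"
  have "measure_pmf.prob (?P p) ?A \<le> measure_pmf.prob (?P q) {y. \<exists>x\<in>?A. x \<le> y}"
    by (rule rel_pmf_measureD[OF rel_pmf_Pi_bernoulli_le]) (use assms in auto)
  also have "\<dots> \<le> measure_pmf.prob (?P q) ?A"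
    by (rule measure_pmf.finite_measure_mono) (auto simp: le_fun_def elim!: spanning_mono)
  finally show ?thesis by (simp add: Q_poly_def)
qed

text \<open>The bounds on \<open>f\<close> matter: only for parameters in the unit interval are the
  Bernoulli weights \<open>f x\<close> and \<open>1 - f x\<close>, which makes \<open>Q_poly\<close>
  a polynomial in \<open>f x\<close>.\<close>

lemma measurable_Q_poly:
  assumes [measurable]: "f \<in> borel_measurable M" and f: "\<And>x. x \<in> space M \<Longrightarrow> 0 \<le> f x \<and> f x \<le> 1"
  shows "(\<lambda>x. Q_poly (D :: 'D::finite itself) k (f x)) \<in> borel_measurable M"
proof -
  have "(\<lambda>x. \<Sum>W | W \<subseteq> (cells k :: (int ^ 'D) set) \<and> spanning k W = True.
      \<Prod>c\<in>cells k. if c \<in> W then f x else 1 - f x) \<in> borel_measurable M"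
    by measurable
  then show ?thesis
  proof (rule measurable_cong[THEN iffD1, rotated])
    fix x assume "x \<in> space M"
    then show "(\<Sum>W | W \<subseteq> (cells k :: (int ^ 'D) set) \<and> spanning k W = True.
      \<Prod>c\<in>cells k. if c \<in> W then f x else 1 - f x) = Q_poly (D :: 'D::finite itself) k (f x)"
      unfolding Q_poly_eq_sum using f by (intro sum.cong prod.cong) auto
  qed
qed

section \<open>The probability of being good at a given depth\<close>

context branching_cells
begin

abbreviation Q :: "real \<Rightarrow> real" where "Q \<equiv> Q_poly D k"

definition good_prob :: "nat \<Rightarrow> 'm \<Rightarrow> real" where
  "good_prob i x = enn2real (outcome_prob i True x)"

lemma bernoulli_of_sum_1:
  fixes a :: "bool \<Rightarrow> ennreal"
  assumes "a True + a False = 1"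
  shows "a b = ennreal (pmf (bernoulli_pmf (enn2real (a True))) b)" "enn2real (a True) \<le> 1"
proof -
  have fin: "a True < \<top>" "a False < \<top>" using assms
    by (metis ennreal_add_eq_top ennreal_one_neq_top top.not_eq_extremum)+
  then obtain r s where rs: "a True = ennreal r" "a False = ennreal s" "0 \<le> r" "0 \<le> s"
    by (metis ennreal_cases less_irrefl infinity_ennreal_def)
  then have "r + s = 1" using assms by (simp flip: ennreal_plus)
  then have s: "s = 1 - r" by simp
  then show "enn2real (a True) \<le> 1" using rs by simp
  show "a b = ennreal (pmf (bernoulli_pmf (enn2real (a True))) b)"
    using rs s by (cases b) simp_all
qed

text \<open>By induction the two outcomes add up to 1: after branching, the offspring are Bernoulli
  with one common parameter \<open>p\<close>, and the spanning and non-spanning configurations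
  contribute \<open>Q p\<close> and \<open>1 - Q p\<close>.\<close>

lemma outcome_prob_eq:
  "outcome_prob i b x = ennreal (pmf (bernoulli_pmf (good_prob i x)) b)"
  and good_prob_bounds: "0 \<le> good_prob i x" "good_prob i x \<le> 1"
proof -
  have "outcome_prob i True x + outcome_prob i False x = 1"
  proof (induction i arbitrary: x)
    case 0
    interpret L: prob_space "particle_law \<P> x" by (rule prob_space_particle_law)
    have "outcome_prob 0 True x + outcome_prob 0 False x =
        (\<integral>\<^sup>+\<xi>. of_bool (absorbed \<Gamma> n \<xi> \<longleftrightarrow> True) + of_bool (absorbed \<Gamma> n \<xi> \<longleftrightarrow> False) \<partial>particle_law \<P> x)"
      unfolding outcome_prob.simps by (rule nn_integral_add[symmetric]) auto
    also have "\<dots> = (\<integral>\<^sup>+\<xi>. 1 \<partial>particle_law \<P> x)"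
      by (intro nn_integral_cong) (simp add: of_bool_def)
    finally show ?case by (simp add: L.emeasure_space_1[simplified])
  next
    case (Suc i)
    interpret L: prob_space "particle_law \<P> x" by (rule prob_space_particle_law)
    let ?f = "\<lambda>b \<xi>. of_bool (unbranched b \<xi>) + (\<Sum>W\<in>configs b. of_bool (branches \<Gamma> n \<xi>) *
     (\<Prod>c\<in>cells k. outcome_prob i (c \<in> W) (offspring_place \<xi>)))"
    have "?f True \<xi> + ?f False \<xi> = 1" for \<xi>
    proof -
      define p where "p = enn2real (outcome_prob i True (offspring_place \<xi>))"
      have e: "outcome_prob i b (offspring_place \<xi>) = ennreal (pmf (bernoulli_pmf p) b)" for b
        unfolding p_def by (rule bernoulli_of_sum_1(1)[OF Suc])
      have "(\<Sum>W\<in>configs True. \<Prod>c\<in>cells k. outcome_prob i (c \<in> W) (offspring_place \<xi>)) +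
        (\<Sum>W\<in>configs False. \<Prod>c\<in>cells k. outcome_prob i (c \<in> W) (offspring_place \<xi>)) =
        ennreal (Q p) + ennreal (1 - Q p)"
        unfolding e complement_Q_poly_eq_sum unfolding Q_poly_eq_sum
        by (simp add: prod_ennreal sum_ennreal prod_nonneg)
      also have "\<dots> = 1" using Q_poly_bounds[of D k p] by (simp flip: ennreal_plus)
      finally show ?thesis
        by (cases "branches \<Gamma> n \<xi>") (auto simp: unbranched_def)
    qed
    moreover have "outcome_prob (Suc i) True x + outcome_prob (Suc i) False x =
        (\<integral>\<^sup>+\<xi>. ?f True \<xi> + ?f False \<xi> \<partial>particle_law \<P> x)"
      unfolding outcome_prob.simps by (rule nn_integral_add[symmetric]) auto
    ultimately show ?case by (simp add: L.emeasure_space_1[simplified])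
  qed
  note bern = bernoulli_of_sum_1[of "\<lambda>b. outcome_prob i b x", OF this]
  show "outcome_prob i b x = ennreal (pmf (bernoulli_pmf (good_prob i x)) b)"
    unfolding good_prob_def by (rule bern(1))
  show "good_prob i x \<le> 1" unfolding good_prob_def by (rule bern(2))
qed (simp add: good_prob_def)

lemma measurable_good_prob [measurable]: "good_prob i \<in> borel_measurable borel"
  unfolding good_prob_def[abs_def] by measurable

text \<open>The integral term of \<open>F_op\<close>, written as an expectation under the particle
  law instead of through the density \<open>K\<close>.\<close>

definition branch_mean :: "('m \<Rightarrow> real) \<Rightarrow> 'm \<Rightarrow> ennreal" where
  "branch_mean \<phi> x = (\<integral>\<^sup>+\<xi>. of_bool (branches \<Gamma> n \<xi>) * ennreal (Q (\<phi> (offspring_place \<xi>))) \<partial>particle_law \<P> x)"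

lemma emeasure_absorbed:
  "ennreal (absorption_prob \<Gamma> n \<P> x) = (\<integral>\<^sup>+\<xi>. of_bool (absorbed \<Gamma> n \<xi>) \<partial>particle_law \<P> x)"
proof -
  interpret L: prob_space "particle_law \<P> x" by (rule prob_space_particle_law)
  let ?S = "{\<xi>\<in>space (particle_space \<Gamma>). absorbed \<Gamma> n \<xi>}"
  have S: "?S \<in> sets (particle_space \<Gamma>)" by measurable
  have "(\<integral>\<^sup>+\<xi>. of_bool (absorbed \<Gamma> n \<xi>) \<partial>particle_law \<P> x) = (\<integral>\<^sup>+\<xi>. indicator ?S \<xi> \<partial>particle_law \<P> x)"
    by (intro nn_integral_cong) (auto simp: indicator_def)
  also have "\<dots> = emeasure (particle_law \<P> x) ?S" using S by simp
  finally have "(\<integral>\<^sup>+\<xi>. of_bool (absorbed \<Gamma> n \<xi>) \<partial>particle_law \<P> x) = emeasure (particle_law \<P> x) ?S" .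
  then show ?thesis by (simp add: absorption_prob_def L.emeasure_eq_measure)
qed

lemma absorption_prob_bounds: "0 \<le> absorption_prob \<Gamma> n \<P> x" "absorption_prob \<Gamma> n \<P> x \<le> 1"
  using prob_space.prob_le_1[OF prob_space_particle_law] by (simp_all add: absorption_prob_def)

lemma measurable_absorption_prob [measurable]: "absorption_prob \<Gamma> n \<P> \<in> borel_measurable borel"
proof -
  have "(\<lambda>x. enn2real (\<integral>\<^sup>+\<xi>. of_bool (absorbed \<Gamma> n \<xi>) \<partial>particle_law \<P> x)) \<in> borel_measurable borel"
    by measurable
  then show ?thesis by (simp flip: emeasure_absorbed add: absorption_prob_bounds)
qed

lemma branch_mean_le_1: "branch_mean \<phi> x \<le> 1"
proof -
  interpret L: prob_space "particle_law \<P> x" by (rule prob_space_particle_law)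
  have "branch_mean \<phi> x \<le> (\<integral>\<^sup>+\<xi>. 1 \<partial>particle_law \<P> x)"
    unfolding branch_mean_def using Q_poly_bounds(2) by (intro nn_integral_mono) (auto simp: of_bool_def)
  then show ?thesis by (simp add: L.emeasure_space_1[simplified])
qed

lemma branch_mean_mono:
  assumes "\<And>y. 0 \<le> \<phi> y \<and> \<phi> y \<le> \<psi> y \<and> \<psi> y \<le> 1"
  shows "branch_mean \<phi> x \<le> branch_mean \<psi> x"
  unfolding branch_mean_def
  by (intro nn_integral_mono mult_left_mono ennreal_leI Q_poly_mono) (use assms in auto)

lemma measurable_branch_mean:
  assumes "\<phi> \<in> borel_measurable borel" "\<And>y. 0 \<le> \<phi> y \<and> \<phi> y \<le> 1"
  shows "branch_mean \<phi> \<in> borel_measurable borel"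
proof -
  have [measurable]: "(\<lambda>y. Q (\<phi> y)) \<in> borel_measurable borel"
    by (rule measurable_Q_poly) (use assms in auto)
  show ?thesis unfolding branch_mean_def[abs_def] by measurable
qed

text \<open>All offspring start at the same point and are independently good with the same
  probability there, so they span with probability \<open>Q\<close> of it.\<close>

lemma outcome_prob_Suc_True:
  "ennreal (good_prob (Suc i) x) = ennreal (absorption_prob \<Gamma> n \<P> x) + branch_mean (good_prob i) x"
proof -
  have sum: "(\<Sum>W\<in>configs True. of_bool (branches \<Gamma> n \<xi>) * (\<Prod>c\<in>cells k. outcome_prob i (c \<in> W) (offspring_place \<xi>)))
    = of_bool (branches \<Gamma> n \<xi>) * ennreal (Q (good_prob i (offspring_place \<xi>)))" for \<xi>
    unfolding outcome_prob_eq Q_poly_eq_sum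
    by (simp add: prod_ennreal sum_ennreal prod_nonneg flip: sum_distrib_left)
  have "ennreal (good_prob (Suc i) x) = outcome_prob (Suc i) True x"
    using good_prob_bounds[of "Suc i" x] by (simp add: outcome_prob_eq del: outcome_prob.simps)
  also have "\<dots> = (\<integral>\<^sup>+\<xi>. of_bool (unbranched True \<xi>) \<partial>particle_law \<P> x) + branch_mean (good_prob i) x"
    unfolding outcome_prob.simps sum branch_mean_def
    using measurable_Q_poly[OF measurable_good_prob[of i], where D = D and k = k] good_prob_bounds
    by (intro nn_integral_add) auto
  also have "(\<integral>\<^sup>+\<xi>. of_bool (unbranched True \<xi>) \<partial>particle_law \<P> x) = ennreal (absorption_prob \<Gamma> n \<P> x)"
    unfolding emeasure_absorbed by (intro nn_integral_cong) (auto simp: unbranched_def absorbed_def)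
  finally show ?thesis .
qed

text \<open>Off \<open>\<Gamma>\<close> this is the \<open>j\<close>-th iterate of \<^const>\<open>F_op\<close>. Written with the particle law instead of the
  density it is measurable on the whole manifold; nothing is known about \<open>K x\<close> for \<open>x \<in> \<Gamma>\<close>.\<close>

primrec iterate :: "nat \<Rightarrow> 'm \<Rightarrow> real" where
  "iterate 0 x = absorption_prob \<Gamma> n \<P> x"
| "iterate (Suc j) x = absorption_prob \<Gamma> n \<P> x +
     (1 - absorption_prob \<Gamma> n \<P> x) * enn2real (branch_mean (iterate j) x)"

lemma branch_mean_less_top: "branch_mean \<phi> x < \<top>"
  using branch_mean_le_1[of \<phi> x] by (simp add: order_le_less_trans)

lemma branch_mean_real: "0 \<le> enn2real (branch_mean \<phi> x)" "enn2real (branch_mean \<phi> x) \<le> 1"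
  "branch_mean \<phi> x = ennreal (enn2real (branch_mean \<phi> x))"
proof -
  show e: "branch_mean \<phi> x = ennreal (enn2real (branch_mean \<phi> x))"
    using branch_mean_less_top[of \<phi> x] by simp
  show "enn2real (branch_mean \<phi> x) \<le> 1" using branch_mean_le_1[of \<phi> x] e by (metis ennreal_le_1)
qed simp

lemma iterate_bounds: "0 \<le> iterate j x \<and> iterate j x \<le> 1"
proof (cases j)
  case 0
  then show ?thesis by (simp add: absorption_prob_bounds)
next
  case (Suc i)
  let ?a = "absorption_prob \<Gamma> n \<P> x" and ?m = "enn2real (branch_mean (iterate i) x)"
  have "(1 - ?a) * ?m \<le> (1 - ?a) * 1"
    using branch_mean_real(2) absorption_prob_bounds by (intro mult_left_mono) auto
  moreover have "0 \<le> (1 - ?a) * ?m" using absorption_prob_bounds branch_mean_real(1) by simp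
  ultimately show ?thesis using absorption_prob_bounds(1)[of x] by (simp add: Suc)
qed

lemma measurable_iterate [measurable]: "iterate j \<in> borel_measurable borel"
proof (induction j)
  case 0
  then show ?case using measurable_absorption_prob by (simp cong: measurable_cong)
next
  case (Suc j)
  note [measurable] = measurable_branch_mean[OF Suc iterate_bounds]
  have "(\<lambda>x. absorption_prob \<Gamma> n \<P> x + (1 - absorption_prob \<Gamma> n \<P> x) * enn2real (branch_mean (iterate j) x))
      \<in> borel_measurable borel" by measurable
  then show ?case by (simp cong: measurable_cong)
qed

text \<open>The first step adds a nonnegative term to the absorption probability, and monotonicity
  of \<open>Q\<close> propagates the inequality.\<close>

lemma iterate_Suc_ge: "iterate j x \<le> iterate (Suc j) x"
proof (induction j arbitrary: x)
  case 0
  then show ?case using absorption_prob_bounds branch_mean_real(1) by simp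
next
  case (Suc j)
  have "branch_mean (iterate j) x \<le> branch_mean (iterate (Suc j)) x"
    by (rule branch_mean_mono) (use iterate_bounds Suc in blast)
  then have "enn2real (branch_mean (iterate j) x) \<le> enn2real (branch_mean (iterate (Suc j)) x)"
    by (intro enn2real_mono branch_mean_less_top)
  then show ?case
    using absorption_prob_bounds[of x] by (simp add: mult_left_mono)
qed

text \<open>The exact recursion for \<^const>\<open>good_prob\<close> does not have the factor \<open>1 - \<rho>\<close> of \<^const>\<open>F_op\<close>, whence
  only an inequality.\<close>

lemma iterate_le_good_prob: "iterate j x \<le> good_prob j x"
proof (induction j arbitrary: x)
  case 0
  show ?case using absorption_prob_bounds(1)[of x]
    by (simp add: good_prob_def flip: emeasure_absorbed)
next
  case (Suc j)
  let ?a = "absorption_prob \<Gamma> n \<P> x" and ?m = "enn2real (branch_mean (iterate j) x)"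
  have "(1 - ?a) * ?m \<le> 1 * ?m"
    using branch_mean_real(1) absorption_prob_bounds by (intro mult_right_mono) auto
  then have "ennreal (iterate (Suc j) x) \<le> ennreal (?a + ?m)" by (intro ennreal_leI) simp
  also have "\<dots> = ennreal ?a + branch_mean (iterate j) x"
    using branch_mean_real absorption_prob_bounds by (simp add: ennreal_plus)
  also have "\<dots> \<le> ennreal ?a + branch_mean (good_prob j) x"
    by (intro add_left_mono branch_mean_mono) (use iterate_bounds good_prob_bounds Suc in blast)
  also have "\<dots> = ennreal (good_prob (Suc j) x)" by (rule outcome_prob_Suc_True[symmetric])
  finally show ?case using good_prob_bounds(1) by (subst (asm) ennreal_le_iff) auto
qed

end

section \<open>The density of the branching point and the iterates of \<open>F_op\<close>\<close>

context branching_cells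
begin

text \<open>Both sides integrate \<open>\<phi>\<close> against one measure, the law of the branching
  point on the event of branching. Branching points avoid \<open>\<Gamma>\<close>, so any Borel set
  may be cut down to the region where the density hypothesis speaks.\<close>

lemma nn_integral_branch_density:
  assumes K: "first_branching_density \<Gamma> n \<P> vol K" and vol: "sets vol = sets borel"
    and x: "x \<notin> \<Gamma>" and \<phi>: "\<phi> \<in> borel_measurable borel"
  shows "(\<integral>\<^sup>+\<xi>. of_bool (branches \<Gamma> n \<xi>) * \<phi> (offspring_place \<xi>) \<partial>particle_law \<P> x) =
    (\<integral>\<^sup>+y. ennreal (K x y) * indicator (- \<Gamma>) y * \<phi> y \<partial>vol)"
proof -
  let ?L = "particle_law \<P> x"
  let ?br = "\<lambda>\<xi>. of_bool (branches \<Gamma> n \<xi>) :: ennreal"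
  let ?k = "\<lambda>y. ennreal (K x y) * indicator (- \<Gamma>) y"
  have "(\<lambda>y. ennreal (indicator (- \<Gamma>) y *\<^sub>R K x y)) \<in> borel_measurable vol"
    using K x by (intro measurable_compose[OF _ measurable_ennreal])
      (auto simp: first_branching_density_def set_borel_measurable_def)
  moreover have "(\<lambda>y. ennreal (indicator (- \<Gamma>) y *\<^sub>R K x y)) = ?k" by (auto simp: indicator_def)
  ultimately have km: "?k \<in> borel_measurable vol" by simp
  have \<phi>v: "\<phi> \<in> borel_measurable vol" using \<phi> vol by (simp cong: measurable_cong_sets)
  have brm: "?br \<in> borel_measurable ?L" by simp
  have om: "offspring_place \<in> density ?L ?br \<rightarrow>\<^sub>M borel" by (simp cong: measurable_cong_sets)
  have "distr (density ?L ?br) borel offspring_place = density vol ?k"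
  proof (rule measure_eqI)
    show "sets (distr (density ?L ?br) borel offspring_place) = sets (density vol ?k)" using vol by simp
    fix B assume "B \<in> sets (distr (density ?L ?br) borel offspring_place)"
    then have B: "B \<in> sets borel" by simp
    have oB: "offspring_place -` B \<inter> space ?L \<in> sets ?L"
      using measurable_sets[OF measurable_offspring_place B] by simp
    have "emeasure (distr (density ?L ?br) borel offspring_place) B = emeasure (density ?L ?br) (offspring_place -` B \<inter> space ?L)"
      using om B by (simp add: emeasure_distr)
    also have "\<dots> = (\<integral>\<^sup>+\<xi>. ?br \<xi> * indicator (offspring_place -` B \<inter> space ?L) \<xi> \<partial>?L)"
      by (rule emeasure_density[OF brm oB])
    also have "\<dots> = (\<integral>\<^sup>+\<xi>. indicator {\<xi>\<in>space ?L. branches \<Gamma> n \<xi> \<and> branch_point \<Gamma> n \<xi> \<in> B \<inter> - \<Gamma>} \<xi> \<partial>?L)"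
      by (intro nn_integral_cong)
        (auto simp: indicator_def offspring_place_def branch_point_notin[OF particle_path])
    also have "\<dots> = emeasure ?L {\<xi>\<in>space ?L. branches \<Gamma> n \<xi> \<and> branch_point \<Gamma> n \<xi> \<in> B \<inter> - \<Gamma>}"
    proof (rule nn_integral_indicator)
      have "{\<xi>\<in>space ?L. branches \<Gamma> n \<xi> \<and> branch_point \<Gamma> n \<xi> \<in> B \<inter> - \<Gamma>} =
        {\<xi>\<in>space (particle_space \<Gamma>). branches \<Gamma> n \<xi> \<and> offspring_place \<xi> \<in> B \<inter> - \<Gamma>}"
        by (auto simp: offspring_place_def)
      also have "\<dots> \<in> sets (particle_space \<Gamma>)" using B by measurable
      finally show "{\<xi>\<in>space ?L. branches \<Gamma> n \<xi> \<and> branch_point \<Gamma> n \<xi> \<in> B \<inter> - \<Gamma>} \<in> sets ?L" by simp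
    qed
    also have "\<dots> = (\<integral>\<^sup>+y\<in>B \<inter> - \<Gamma>. ennreal (K x y) \<partial>vol)"
    proof -
      have B\<Gamma>: "B \<inter> - \<Gamma> \<in> sets borel" using B borel_sets(2) by (rule sets.Int)
      have "x \<in> - \<Gamma>" using x by simp
      from bspec[OF K[unfolded first_branching_density_def] this]
      have d: "\<forall>B\<in>sets borel. B \<subseteq> - \<Gamma> \<longrightarrow> emeasure ?L {\<xi>\<in>space ?L. branches \<Gamma> n \<xi> \<and> branch_point \<Gamma> n \<xi> \<in> B} =
          (\<integral>\<^sup>+y\<in>B. ennreal (K x y) \<partial>vol)"
        by (elim conjE)
      show ?thesis by (rule d[THEN bspec, OF B\<Gamma>, THEN mp, OF Int_lower2])
    qed
    also have "\<dots> = (\<integral>\<^sup>+y. ?k y * indicator B y \<partial>vol)"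
      by (intro nn_integral_cong) (auto simp: indicator_def)
    also have "\<dots> = emeasure (density vol ?k) B"
      using km B vol by (simp add: emeasure_density)
    finally show "emeasure (distr (density ?L ?br) borel offspring_place) B = emeasure (density vol ?k) B" .
  qed
  moreover have "(\<integral>\<^sup>+\<xi>. ?br \<xi> * \<phi> (offspring_place \<xi>) \<partial>?L) = (\<integral>\<^sup>+y. \<phi> y \<partial>distr (density ?L ?br) borel offspring_place)"
    using brm om \<phi> by (simp add: nn_integral_distr nn_integral_density)
  moreover have "(\<integral>\<^sup>+y. \<phi> y \<partial>density vol ?k) = (\<integral>\<^sup>+y. ?k y * \<phi> y \<partial>vol)"
    by (rule nn_integral_density[OF km \<phi>v])
  ultimately show ?thesis by simp
qed

text \<open>Agreement of \<open>\<phi>\<close> with a measurable \<open>f\<close> is required only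
  off \<open>\<Gamma>\<close>, because the iterates of \<open>F_op\<close> are not controlled on
  \<open>\<Gamma>\<close>.\<close>

lemma F_op_eq:
  assumes K: "first_branching_density \<Gamma> n \<P> vol K" and vol: "sets vol = sets borel"
    and x: "x \<notin> \<Gamma>" and f: "f \<in> borel_measurable borel" "\<And>y. 0 \<le> f y \<and> f y \<le> 1"
    and eq: "\<And>y. y \<notin> \<Gamma> \<Longrightarrow> \<phi> y = f y"
  shows "F_op D k \<Gamma> vol \<rho> K \<phi> x = \<rho> x + (1 - \<rho> x) * enn2real (branch_mean f x)"
proof -
  have Qm: "(\<lambda>y. Q (f y)) \<in> borel_measurable borel" by (rule measurable_Q_poly) (use f in auto)
  then have Qv: "(\<lambda>y. Q (f y)) \<in> borel_measurable vol" using vol by (simp cong: measurable_cong_sets)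
  have Km: "(\<lambda>y. indicator (- \<Gamma>) y *\<^sub>R K x y) \<in> borel_measurable vol" and K0: "\<And>y. y \<notin> \<Gamma> \<Longrightarrow> 0 \<le> K x y"
    using K x by (auto simp: first_branching_density_def set_borel_measurable_def)
  have "(LINT y:- \<Gamma>|vol. K x y * Q (\<phi> y)) = (LINT y|vol. (indicator (- \<Gamma>) y *\<^sub>R K x y) * Q (f y))"
    unfolding set_lebesgue_integral_def
    by (rule Bochner_Integration.integral_cong) (auto simp: indicator_def eq)
  also have "\<dots> = enn2real (\<integral>\<^sup>+y. ennreal ((indicator (- \<Gamma>) y *\<^sub>R K x y) * Q (f y)) \<partial>vol)"
    by (rule integral_eq_nn_integral[OF borel_measurable_times[OF Km Qv]])
      (use K0 Q_poly_bounds(1)[of D k] in \<open>auto simp: indicator_def\<close>)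
  also have "(\<integral>\<^sup>+y. ennreal ((indicator (- \<Gamma>) y *\<^sub>R K x y) * Q (f y)) \<partial>vol) =
      (\<integral>\<^sup>+y. ennreal (K x y) * indicator (- \<Gamma>) y * ennreal (Q (f y)) \<partial>vol)"
    by (intro nn_integral_cong) (auto simp: indicator_def ennreal_mult K0 Q_poly_bounds)
  also have "\<dots> = branch_mean f x"
    unfolding branch_mean_def
    by (rule nn_integral_branch_density[OF K vol x, symmetric]) (use Qm in measurable)
  finally show ?thesis by (simp add: F_op_def)
qed

lemma F_op_iterate:
  assumes K: "first_branching_density \<Gamma> n \<P> vol K" and vol: "sets vol = sets borel" and x: "x \<notin> \<Gamma>"
  shows "(F_op D k \<Gamma> vol (absorption_prob \<Gamma> n \<P>) K ^^ j) (absorption_prob \<Gamma> n \<P>) x = iterate j x"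
  using x
proof (induction j arbitrary: x)
  case (Suc j)
  show ?case
    unfolding funpow.simps(2) comp_def iterate.simps(2)
    by (rule F_op_eq[OF K vol Suc.prems, of "iterate j"]) (simp_all only: iterate_bounds Suc.IH measurable_iterate simp_thms)
qed simp

text \<open>Monotonicity and boundedness show that the \<open>lim\<close> in \<open>P_lim\<close> is
  a genuine limit; its form as a supremum prepares monotone convergence.\<close>

lemma P_lim_iterate:
  assumes K: "first_branching_density \<Gamma> n \<P> vol K" and vol: "sets vol = sets borel" and x: "x \<notin> \<Gamma>"
  shows "ennreal (P_lim D k \<Gamma> vol (absorption_prob \<Gamma> n \<P>) K x) = (SUP j. ennreal (iterate j x))"
    and "0 \<le> P_lim D k \<Gamma> vol (absorption_prob \<Gamma> n \<P>) K x"
proof -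
  have inc: "incseq (\<lambda>j. iterate j x)" using iterate_Suc_ge by (rule incseq_SucI)
  moreover have "norm (iterate j x) \<le> 1" for j using iterate_bounds[of j x] by simp
  ultimately have "convergent (\<lambda>j. iterate j x)"
    by (intro Bseq_monoseq_convergent BseqI' incseq_imp_monoseq)
  then have lim: "(\<lambda>j. iterate j x) \<longlonglongrightarrow> lim (\<lambda>j. iterate j x)" by (simp add: convergent_LIMSEQ_iff)
  then have "(\<lambda>j. ennreal (iterate j x)) \<longlonglongrightarrow> ennreal (lim (\<lambda>j. iterate j x))" by simp
  moreover have "(\<lambda>j. ennreal (iterate j x)) \<longlonglongrightarrow> (SUP j. ennreal (iterate j x))"
    using inc by (intro LIMSEQ_SUP) (auto simp: incseq_def intro: ennreal_leI)
  ultimately have "ennreal (lim (\<lambda>j. iterate j x)) = (SUP j. ennreal (iterate j x))"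
    by (rule LIMSEQ_unique)
  then show "ennreal (P_lim D k \<Gamma> vol (absorption_prob \<Gamma> n \<P>) K x) = (SUP j. ennreal (iterate j x))"
    by (simp add: P_lim_def F_op_iterate[OF K vol x])
  show "0 \<le> P_lim D k \<Gamma> vol (absorption_prob \<Gamma> n \<P>) K x"
    unfolding P_lim_def F_op_iterate[OF K vol x]
    by (rule LIMSEQ_le_const[OF lim]) (use iterate_bounds in blast)
qed

end

section \<open>From the limit to the density of good unit cubes\<close>

context branching_process
begin

lemma prob_good_eq:
  assumes \<gamma>: "distributed \<Omega> vol X0 (\<lambda>x. ennreal (\<gamma> x))" and vol: "sets vol = sets borel"
  shows "ennreal (prob {\<omega>\<in>space \<Omega>. good (\<lambda>u. T u \<omega>) i []}) = (\<integral>\<^sup>+x. ennreal (\<gamma> x) * ennreal (good_prob i x) \<partial>vol)"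
proof -
  have m: "(\<lambda>x. ennreal (good_prob i x)) \<in> borel_measurable vol"
    using measurable_good_prob[of i] vol by (simp cong: measurable_cong_sets)
  have "(\<integral>\<^sup>+x. ennreal (\<gamma> x) * ennreal (good_prob i x) \<partial>vol) = (\<integral>\<^sup>+\<omega>. ennreal (good_prob i (X0 \<omega>)) \<partial>\<Omega>)"
    by (rule distributed_nn_integral[OF \<gamma> m])
  also have "\<dots> = (\<integral>\<^sup>+\<omega>. outcome_prob i True (X0 \<omega>) \<partial>\<Omega>)"
    using good_prob_bounds by (simp add: outcome_prob_eq)
  finally show ?thesis by (simp add: emeasure_good flip: emeasure_eq_measure)
qed

text \<open>Used contrapositively: if \<open>p_star\<close> exceeds \<open>p\<close>, some finite
  depth already gives a density of good unit cubes above \<open>p\<close>. Monotone convergence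
  exchanges the supremum over depths with the integral over the starting point.\<close>

lemma p_star_le:
  assumes K: "first_branching_density \<Gamma> n \<P> vol K" and vol: "sets vol = sets borel"
    and \<gamma>: "distributed \<Omega> vol X0 (\<lambda>x. ennreal (\<gamma> x))" "\<And>x. 0 \<le> \<gamma> x"
    and p: "0 \<le> p" "\<And>i. prob {\<omega>\<in>space \<Omega>. good (\<lambda>u. T u \<omega>) i []} \<le> p"
  shows "p_star D k \<Gamma> vol (absorption_prob \<Gamma> n \<P>) K \<gamma> \<le> p"
proof -
  let ?P = "P_lim D k \<Gamma> vol (absorption_prob \<Gamma> n \<P>) K"
  let ?f = "\<lambda>x. indicator (- \<Gamma>) x *\<^sub>R (\<gamma> x * ?P x)"
  note P = P_lim_iterate(1)[OF K vol] and P0 = P_lim_iterate(2)[OF K vol]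
  have it: "ennreal (iterate j x) \<le> ennreal (good_prob j x)" for j x
    by (intro ennreal_leI iterate_le_good_prob)
  have \<gamma>m: "(\<lambda>x. ennreal (\<gamma> x)) \<in> borel_measurable vol"
    by (rule distributed_borel_measurable[OF \<gamma>(1)])
  have im: "(\<lambda>x. ennreal (\<gamma> x) * ennreal (iterate j x)) \<in> borel_measurable vol" for j
  proof -
    have "(\<lambda>x. ennreal (iterate j x)) \<in> borel_measurable vol"
      using measurable_iterate[of j] vol by (simp cong: measurable_cong_sets)
    then show ?thesis using \<gamma>m by measurable
  qed
  have inc: "incseq (\<lambda>j x. ennreal (\<gamma> x) * ennreal (iterate j x))"
    by (rule incseq_SucI) (auto simp: le_fun_def intro!: mult_left_mono ennreal_leI iterate_Suc_ge simp del: iterate.simps)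
  \<comment> \<open>A Bochner integral of a non-integrable function is 0, so the inequality holds in
    either case.\<close>
  have "ennreal (LINT x|vol. ?f x) \<le> (\<integral>\<^sup>+x. ennreal (?f x) \<partial>vol)"
  proof (cases "integrable vol ?f")
    case True
    have "(\<integral>\<^sup>+x. ennreal (?f x) \<partial>vol) = ennreal (LINT x|vol. ?f x)"
      by (rule nn_integral_eq_integral[OF True]) (use P0 \<gamma>(2) in \<open>auto simp: indicator_def\<close>)
    then show ?thesis by simp
  qed (simp add: not_integrable_integral_eq)
  also have "\<dots> \<le> (\<integral>\<^sup>+x. (SUP j. ennreal (\<gamma> x) * ennreal (iterate j x)) \<partial>vol)"
  proof (intro nn_integral_mono)
    fix x
    show "ennreal (?f x) \<le> (SUP j. ennreal (\<gamma> x) * ennreal (iterate j x))"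
    proof (cases "x \<in> \<Gamma>")
      case False
      then have "ennreal (?f x) = ennreal (\<gamma> x) * ennreal (?P x)"
        by (simp add: ennreal_mult P0 \<gamma>(2))
      also have "\<dots> = (SUP j. ennreal (\<gamma> x) * ennreal (iterate j x))"
        unfolding P[OF False] by (rule SUP_mult_left_ennreal)
      finally show ?thesis by simp
    qed simp
  qed
  also have "\<dots> = (SUP j. \<integral>\<^sup>+x. ennreal (\<gamma> x) * ennreal (iterate j x) \<partial>vol)"
    by (rule nn_integral_monotone_convergence_SUP[OF inc im])
  also have "\<dots> \<le> ennreal p"
  proof (rule SUP_least)
    fix j
    have "(\<integral>\<^sup>+x. ennreal (\<gamma> x) * ennreal (iterate j x) \<partial>vol) \<le> (\<integral>\<^sup>+x. ennreal (\<gamma> x) * ennreal (good_prob j x) \<partial>vol)"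
      by (intro nn_integral_mono mult_left_mono it) simp
    also have "\<dots> \<le> ennreal p"
      unfolding prob_good_eq[OF \<gamma>(1) vol, symmetric] by (intro ennreal_leI p)
    finally show "(\<integral>\<^sup>+x. ennreal (\<gamma> x) * ennreal (iterate j x) \<partial>vol) \<le> ennreal p" .
  qed
  finally show ?thesis
    unfolding p_star_def set_lebesgue_integral_def using p(1) by (simp add: ennreal_le_iff)
qed

end


section \<open>From an infinite cluster of good unit cubes to percolation\<close>

lemma black_cubeI:
  assumes "born k \<Gamma> n (T z) v" "absorbed \<Gamma> n (T z v)"
  shows "particle_cube k z v \<in> final_black_cubes k \<Gamma> n T"
proof -
  let ?t = "birth_time \<Gamma> n (T z) v + hit_time \<Gamma> (fst (T z v))"
  have "particle_cube k z v \<in> black_cubes k \<Gamma> n T (max 0 ?t)"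
    using assms unfolding black_cubes_def by fastforce
  then show ?thesis unfolding final_black_cubes_def by (intro UN_I[of "max 0 ?t"]) auto
qed

lemma has_path_to_infinity_if_good_sites:
  fixes C :: "(int ^ 'D::finite) set"
  assumes k: "k \<ge> 2" and C: "infinite C" "connected_sites C"
    and good: "\<And>z. z \<in> C \<Longrightarrow> good_label k (\<lambda>v. absorbed \<Gamma> n (T z v)) (\<lambda>v. branches \<Gamma> n (T z v)) i []"
  shows "has_path_to_infinity (final_black_cubes k \<Gamma> n T)"
proof -
  let ?blk = "\<lambda>z v. absorbed \<Gamma> n (T z v)" and ?br = "\<lambda>z v. branches \<Gamma> n (T z v)"
  obtain X where X: "\<And>z. z \<in> C \<Longrightarrow> spanning_cluster k (?blk z) (?br z) [] (X z)"
    using good_label_cluster[OF good] by metis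
  have born: "set v \<subseteq> cells k \<and> born k \<Gamma> n (T z) v" if "z \<in> C" "v \<in> X z" for z v
    by (rule spanning_cluster_induct_down[OF k X[OF that(1)] that(2)]) auto
  show ?thesis
  proof (rule has_path_to_infinity_if_infinite_cluster[OF k C X])
    fix z v assume zv: "z \<in> C" "v \<in> X z"
    then show "set v \<subseteq> cells k" using born by blast
    have "absorbed \<Gamma> n (T z v)" using spanning_cluster_leaves[OF k X[OF zv(1)]] zv(2) by blast
    then show "particle_cube k z v \<in> final_black_cubes k \<Gamma> n T" using born[OF zv] by (intro black_cubeI) auto
  qed
qed

theorem theorem1:
  fixes \<A> :: "('m::{t2_space, second_countable_topology}, 'd::finite) chart set"
    and \<Gamma> :: "'m set" and vol :: "'m measure" and cal :: calculus
    and sg :: "('m, 'd) chart \<Rightarrow> real ^ 'd \<Rightarrow> real ^ 'd ^ 'd"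
    and b :: "('m, 'd) chart \<Rightarrow> real ^ 'd \<Rightarrow> real ^ 'd"
    and \<G> :: "('m \<Rightarrow> real) \<Rightarrow> 'm \<Rightarrow> real"
    and n \<gamma> :: "'m \<Rightarrow> real" and \<P> :: "'m \<Rightarrow> (real \<Rightarrow> 'm) measure"
    and k :: nat and lam1 :: real
    and \<rho> :: "'m \<Rightarrow> real" and K :: "'m \<Rightarrow> 'm \<Rightarrow> real"
    and \<Omega> :: "'w measure"
    and X0 :: "int ^ 'D::finite \<Rightarrow> 'w \<Rightarrow> 'm"
    and T :: "int ^ 'D \<Rightarrow> 'D label \<Rightarrow> 'w \<Rightarrow> 'm particle"
  assumes "smooth_atlas \<A>" and "smooth_volume \<A> vol" and "closed \<Gamma>"
    and "diffusion_generator \<A> \<Gamma> cal sg b \<G>"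
    and "diffusion \<A> \<Gamma> \<G> \<P>"
    and "accessible \<Gamma> \<P>"
    and "smooth_fun_on \<A> (- \<Gamma>) n" and "\<forall>x\<in>- \<Gamma>. 0 < n x"
    and "k \<ge> 3"
    and "principal_eigenvalue \<A> \<Gamma> \<G> n (k ^ CARD('D)) lam1" and "0 < lam1"
    and "\<rho> = absorption_prob \<Gamma> n \<P>"
    and "first_branching_density \<Gamma> n \<P> vol K"
    and "\<forall>x. 0 \<le> \<gamma> x"
    and "prob_space \<Omega>"
    and "cube_branching \<Omega> k \<Gamma> n \<P> vol \<gamma> X0 T"
    and "p_star TYPE('D) k \<Gamma> vol \<rho> K \<gamma> > site_threshold TYPE('D)"
  shows "percolates \<Omega> (\<lambda>\<omega>. final_black_cubes k \<Gamma> n (\<lambda>z v. T z v \<omega>))"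
proof -
  interpret branching_cells \<Gamma> n \<P> k "TYPE('D)"
  proof unfold_locales
    show "closed \<Gamma>" by fact
    show "\<exists>V. open V \<and> x \<in> V \<and> closure V \<subseteq> U" if "open U" "x \<in> U" for U and x :: 'm
      using smooth_atlas_regular[OF \<open>smooth_atlas \<A>\<close> that] .
    show "continuous_on (- \<Gamma>) n"
      using smooth_fun_on_continuous \<open>smooth_atlas \<A>\<close> \<open>smooth_fun_on \<A> (- \<Gamma>) n\<close> \<open>closed \<Gamma>\<close> by blast
    show "0 < n x" if "x \<notin> \<Gamma>" for x using \<open>\<forall>x\<in>- \<Gamma>. 0 < n x\<close> that by blast
    show "\<P> \<in> borel \<rightarrow>\<^sub>M prob_algebra (path_space \<Gamma>)"
      using \<open>diffusion \<A> \<Gamma> \<G> \<P>\<close> by (simp add: diffusion_def)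
  qed
  interpret prob_space \<Omega> by fact
  have vol: "sets vol = sets borel" using \<open>smooth_volume \<A> vol\<close> by (simp add: smooth_volume_def)
  have dist: "\<And>z. distributed \<Omega> vol (X0 z) (\<lambda>x. ennreal (\<gamma> x))"
    and bd: "\<And>z. branching_diffusion \<Omega> k \<Gamma> n \<P> (X0 z) (T z)"
    and indep: "indep_vars (\<lambda>_. borel \<Otimes>\<^sub>M PiM UNIV (\<lambda>_. particle_space \<Gamma>)) (\<lambda>z \<omega>. (X0 z \<omega>, \<lambda>v. T z v \<omega>)) UNIV"
    using \<open>cube_branching \<Omega> k \<Gamma> n \<P> vol \<gamma> X0 T\<close> by (auto simp: cube_branching_def)
  have bp: "branching_process \<Gamma> n \<P> k \<Omega> (X0 z) (T z)" for z
    by unfold_locales (rule bd)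
  obtain p where p: "0 \<le> p" "p < p_star TYPE('D) k \<Gamma> vol \<rho> K \<gamma>"
    "AE \<omega> in site_measure p. \<exists>C :: (int ^ 'D) set. infinite C \<and> connected_sites C \<and> (\<forall>x\<in>C. \<omega> x)"
    using site_threshold_lessE \<open>p_star TYPE('D) k \<Gamma> vol \<rho> K \<gamma> > site_threshold TYPE('D)\<close> by blast
  define Z where "Z i z \<omega> \<longleftrightarrow> good (\<lambda>u. T z u \<omega>) i []" for i z \<omega>
  define q where "q i = prob {\<omega>\<in>space \<Omega>. Z i 0 \<omega>}" for i
  \<comment> \<open>The density depends only on the law of the starting point, which is the same for
    all unit cubes.\<close>
  have q: "prob {\<omega>\<in>space \<Omega>. Z i z \<omega>} = q i" for i z
  proof -
    have "ennreal (prob {\<omega>\<in>space \<Omega>. Z i z \<omega>}) = ennreal (q i)"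
      unfolding Z_def q_def branching_process.prob_good_eq[OF bp dist vol] ..
    then show ?thesis by (simp add: q_def)
  qed
  \<comment> \<open>The strict gap between \<open>p\<close> and \<open>p_star\<close> is used here:
    if no depth exceeded \<open>p\<close>, then \<open>p_star\<close> would be at most
    \<open>p\<close>.\<close>
  obtain i where i: "p < q i"
  proof (rule ccontr)
    assume "\<not> thesis"
    then have "q i \<le> p" for i using that[of i] by (meson not_le)
    then have "p_star TYPE('D) k \<Gamma> vol (absorption_prob \<Gamma> n \<P>) K \<gamma> \<le> p"
      by (intro branching_process.p_star_le[OF bp[of 0] \<open>first_branching_density \<Gamma> n \<P> vol K\<close> vol dist])
        (use p(1) \<open>\<forall>x. 0 \<le> \<gamma> x\<close> in \<open>auto simp: q_def Z_def\<close>)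
    then show False using p(2) \<open>\<rho> = absorption_prob \<Gamma> n \<P>\<close> by simp
  qed
  have gm: "Measurable.pred (borel \<Otimes>\<^sub>M PiM UNIV (\<lambda>_. particle_space \<Gamma>)) (\<lambda>x. good (snd x) i [])"
    by (rule measurable_good) measurable
  \<comment> \<open>Goodness of a unit cube is a measurable function of its own branching diffusion,
    so independence is inherited.\<close>
  have "indep_vars (\<lambda>_. count_space UNIV) (Z i) UNIV"
    using indep_vars_compose2[OF indep, of "\<lambda>_ x. good (snd x) i []" "\<lambda>_. count_space UNIV"] gm
    by (simp add: Z_def[abs_def])
  then have "AE \<omega> in \<Omega>. \<exists>C :: (int ^ 'D) set. infinite C \<and> connected_sites C \<and> (\<forall>x\<in>C. Z i x \<omega>)"
    by (rule AE_increasing_event_of_indep[OF _ q p(1) _ _ p(3)[unfolded site_measure_def]])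
      (use i p(1) in auto)
  then show ?thesis
    unfolding percolates_def
  proof (rule eventually_mono)
    fix \<omega> assume "\<exists>C :: (int ^ 'D) set. infinite C \<and> connected_sites C \<and> (\<forall>x\<in>C. Z i x \<omega>)"
    then show "has_path_to_infinity (final_black_cubes k \<Gamma> n (\<lambda>z v. T z v \<omega>))"
      using has_path_to_infinity_if_good_sites[of k _ \<Gamma> n "\<lambda>z v. T z v \<omega>" i] \<open>k \<ge> 3\<close>
      by (auto simp: Z_def)
  qed
qed

end
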